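(* Let $K^0$ be either $K^0_{\mathrm{st}}$ or $K^0_{\mathrm{par}}$, with associated $K_{M^0}$, $\rho_{M^0}$, $N(\rho_{M^0})$ and $W(\rho_{M^0})=N(\rho_{M^0})/K_{M^0}$ as in the context, and let $s,s',z$ (and, if $K^0=K^0_{\mathrm{par}}$, $\epsilon_{M^0}$) be the elements of $W(\rho_{M^0})$ defined in the context. Then $$W(\rho_{M^0})=\begin{cases}\langle s,s'\rangle\times\langle z\rangle\;\simeq\;W_{\mathrm{aff}}(\widetilde A_1)\times\mathbb Z & \text{if } K^0=K^0_{\mathrm{st}},\\ \langle s,s'\rangle\times\langle z,\epsilon_{M^0}\rangle\;\simeq\;W_{\mathrm{aff}}(\widetilde A_1)\times\mathbb Z\times\mathbb Z/2\mathbb Z & \text{if } K^0=K^0_{\mathrm{par}},\end{cases}$$ where $W_{\mathrm{aff}}(\widetilde A_1)$ denotes the affine Weyl group of type $\widetilde A_1$, i.e. the Coxeter group generated by two simple reflections with no relation between them (the infinite dihedral group), and the factors $\langle s,s'\rangle$, $\langle z\rangle$ (resp. $\langle z,\epsilon_{M^0}\rangle$) correspond to $W_{\mathrm{aff}}(\widetilde A_1)$, $\mathbb Z$ (resp. $\mathbb Z\times\mathbb Z/2\mathbb Z$).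
   Context: Let $F$ be a non-archimedean local field with residue field $\mathfrak f$ of odd characteristic $p$ and order $q$, with $4\mid q-1$. For a finite extension $E/F$, $\mathcal O_E$, $\mathfrak p_E$, $N_{E/F}$ denote the ring of integers, its maximal ideal and the norm map. Fix a uniformizer $\varpi_F$ of $F$, a primitive $(q-1)$-st root of unity $\zeta\in F$, and a square root $\sqrt{-1}\in\mathbb C^\times$ of $-1$. Let $\eta\colon F^\times\to\mathbb C^\times$ be the unique character trivial on $\varpi_F$ and on $1+\mathfrak p_F$ with $\eta(\zeta)=\sqrt{-1}$. Let $E_2$ (resp. $E_4$) be the splitting field over $F$ of $X^2+\varpi_F$ (resp. $X^4+\zeta\varpi_F$); these are totally ramified of degree $2$ and $4$, so their residue fields are identified with $\mathfrak f$. Fix uniformizers $\varpi_{E_2}\in E_2$, $\varpi_{E_4}\in E_4$ with $\varpi_{E_2}^2=-\varpi_F$ and $\varpi_{E_4}^4=-\zeta\varpi_F$. Let $G^0$ be the group over $F$ given by $(\mathrm{Res}_{E_2/F}\mathrm{GL}_2\times\mathrm{Res}_{E_4/F}\mathrm{GL}_1)\cap\mathrm{SL}_8$ (embedded in $\mathrm{GL}_8$ via $F$-bases of $E_2$ and $E_4$), so $G^0(F)=\{(g_2,g_4)\in\mathrm{GL}_2(E_2)\times E_4^\times: N_{E_2/F}(\det g_2)N_{E_4/F}(g_4)=1\}$. Let $M^0\subset G^0$ be the maximal torus for which $g_2$ is diagonal; write its $F$-points as $(x,y,z)\in E_2^\times\times E_2^\times\times E_4^\times$, meaning $(\mathrm{diag}(x,y),z)$.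 Let $I_2=\{\begin{pmatrix}a&b\\c&d\end{pmatrix}\in\mathrm{GL}_2(E_2): a,d\in\mathcal O_{E_2}^\times,\ b\in\mathcal O_{E_2},\ c\in\mathfrak p_{E_2}\}$. Put $K^0_{\mathrm{st}}=(I_2\times\mathcal O_{E_4}^\times)\cap G^0(F)$ (the stabilizer of a point $x_0$ of the enlarged Bruhat–Tits building) and $K^0_{\mathrm{par}}=\{(g_2,g_4)\in K^0_{\mathrm{st}}: (\det g_2\bmod\mathfrak p_{E_2})\cdot(g_4\bmod\mathfrak p_{E_4})^2=1 \text{ in }\mathfrak f^\times\}$ (the corresponding parahoric subgroup). For $K^0$ one of these, $K_{M^0}=K^0\cap M^0(F)$, and $\rho_{M^0}$ is the character $(x,y,z)\mapsto\eta(N_{E_2/F}(y))$ of $K_{M^0}$. Notation: ${}^nK=nKn^{-1}$ and ${}^n\rho(x)=\rho(n^{-1}xn)$. Put $N(\rho_{M^0})=\{n\in N_{G^0}(M^0)(F): {}^nK_{M^0}=K_{M^0},\ {}^n\rho_{M^0}=\rho_{M^0}\}$, where $N_{G^0}(M^0)$ is the normalizer, and $W(\rho_{M^0})=N(\rho_{M^0})/K_{M^0}$. Define $\widetilde s=\left(\begin{pmatrix}0&1\\-1&0\end{pmatrix},1\right)$, $\widetilde s'=\left(\begin{pmatrix}0&\varpi_{E_2}^{-1}\\-\varpi_{E_2}&0\end{pmatrix},1\right)$, $\widetilde z=(\zeta\varpi_{E_2},\varpi_{E_2},\varpi_{E_4}^{-2})\in M^0(F)$, and $\widetilde\epsilon_{M^0}=(-1,1,1)\in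 M^0(F)$. These elements lie in $N(\rho_{M^0})$; $s,s',z,\epsilon_{M^0}$ denote their images in $W(\rho_{M^0})$ ($\epsilon_{M^0}$ is used only when $K^0=K^0_{\mathrm{par}}$). *)

theory Defs
  imports
    "HOL-Analysis.Determinants"
    "HOL-Library.Extended_Nat"
    "HOL-Algebra.Algebra"
    "HOL-Algebra.Algebraic_Closure_Type"
begin


section \<open>Non-archimedean local fields\<close>

text \<open>
  The local field is the whole type \<open>'a\<close>, with its normalised discrete valuation
  \<open>v\<close>. The value \<open>v 0\<close> is unspecified; \<open>val_ge v n x\<close> means
  \<open>v x \<ge> n\<close> under the convention \<open>v 0 = \<infinity>\<close>.
\<close>

definition val_ge :: "('a::field \<Rightarrow> int) \<Rightarrow> int \<Rightarrow> 'a \<Rightarrow> bool" where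
  "val_ge v n x \<longleftrightarrow> x = 0 \<or> n \<le> v x"

definition integers :: "('a::field \<Rightarrow> int) \<Rightarrow> 'a set" where
  "integers v = {x. val_ge v 0 x}"

definition prime_ideal :: "('a::field \<Rightarrow> int) \<Rightarrow> 'a set" where
  "prime_ideal v = {x. val_ge v 1 x}"

definition residue_field :: "('a::field \<Rightarrow> int) \<Rightarrow> 'a set ring" where
  "residue_field v = ring_of_type_algebra\<lparr>carrier := integers v\<rparr> Quot prime_ideal v"

definition uniformizer :: "('a::field \<Rightarrow> int) \<Rightarrow> 'a \<Rightarrow> bool" where
  "uniformizer v w \<longleftrightarrow> w \<noteq> 0 \<and> v w = 1"

definition nonarch_local_field :: "('a::field \<Rightarrow> int) \<Rightarrow> bool" where
  "nonarch_local_field v \<longleftrightarrow>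
     (\<forall>x y. x \<noteq> 0 \<longrightarrow> y \<noteq> 0 \<longrightarrow> v (x * y) = v x + v y) \<and>
     (\<forall>x y n. val_ge v n x \<longrightarrow> val_ge v n y \<longrightarrow> val_ge v n (x + y)) \<and>
     (\<exists>w. uniformizer v w) \<and>
     (\<forall>f :: nat \<Rightarrow> 'a.
        (\<forall>n. \<exists>k. \<forall>i\<ge>k. \<forall>j\<ge>k. val_ge v n (f i - f j)) \<longrightarrow>
        (\<exists>x. \<forall>n. \<exists>k. \<forall>i\<ge>k. val_ge v n (f i - x))) \<and>
     finite (carrier (residue_field v))"

section \<open>Finite extensions inside the algebraic closure\<close>

definition splitting_field :: "'a::field poly \<Rightarrow> 'a alg_closure set" where
  "splitting_field P = generate_field ring_of_type_algebra
     (range to_ac \<union> {x. poly (map_poly to_ac P) x = 0})"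

definition embeddings ::
  "'a::field alg_closure set \<Rightarrow> ('a alg_closure \<Rightarrow> 'a alg_closure) set" where
  "embeddings E = {\<sigma> \<in> extensional E.
     \<sigma> \<in> ring_hom (ring_of_type_algebra\<lparr>carrier := E\<rparr>) ring_of_type_algebra \<and>
     (\<forall>a. \<sigma> (to_ac a) = to_ac a)}"

text \<open>
  The norm of a finite separable extension, as the product of the conjugates. The
  extensions considered here have degree 2 and 4 in odd residue characteristic, so they are
  separable.
\<close>

definition field_norm :: "'a::field alg_closure set \<Rightarrow> 'a alg_closure \<Rightarrow> 'a" where
  "field_norm E x = (THE a. to_ac a = (\<Prod>\<sigma>\<in>embeddings E. \<sigma> x))"

text \<open>The ring of integers of an extension is the integral closure of the integers of \<open>'a\<close>.\<close>

definition ext_integers ::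
  "('a::field \<Rightarrow> int) \<Rightarrow> 'a alg_closure set \<Rightarrow> 'a alg_closure set" where
  "ext_integers v E = {x \<in> E. \<exists>P. lead_coeff P = 1 \<and> (\<forall>k. poly.coeff P k \<in> integers v) \<and>
     poly (map_poly to_ac P) x = 0}"

definition ext_units ::
  "('a::field \<Rightarrow> int) \<Rightarrow> 'a alg_closure set \<Rightarrow> 'a alg_closure set" where
  "ext_units v E = {x \<in> ext_integers v E. x \<noteq> 0 \<and> inverse x \<in> ext_integers v E}"

text \<open>The maximal ideal of the local ring \<open>ext_integers v E\<close>: its non-units.\<close>

definition ext_prime_ideal ::
  "('a::field \<Rightarrow> int) \<Rightarrow> 'a alg_closure set \<Rightarrow> 'a alg_closure set" where
  "ext_prime_ideal v E = ext_integers v E - ext_units v E"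

text \<open>
  For totally ramified \<open>E\<close>, the residue field of \<open>E\<close> is identified with that
  of \<open>'a\<close>: the residue class of \<open>x\<close> is the class of those integers
  of \<open>'a\<close> that are congruent to \<open>x\<close>.
\<close>

definition reduction ::
  "('a::field \<Rightarrow> int) \<Rightarrow> 'a alg_closure set \<Rightarrow> 'a alg_closure \<Rightarrow> 'a set" where
  "reduction v E x = {a \<in> integers v. to_ac a - x \<in> ext_prime_ideal v E}"

section \<open>The groups\<close>

definition GL1 :: "'k::field set \<Rightarrow> 'k monoid" where
  "GL1 E = \<lparr>carrier = E - {0}, monoid.mult = (*), one = 1\<rparr>"

definition GL2 :: "'k::field set \<Rightarrow> ('k^2^2) monoid" where
  "GL2 E = \<lparr>carrier = {g. (\<forall>i j. g $ i $ j \<in> E) \<and> det g \<noteq> 0},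
            monoid.mult = (**), one = mat 1\<rparr>"

definition mat2 :: "'k::zero \<Rightarrow> 'k \<Rightarrow> 'k \<Rightarrow> 'k \<Rightarrow> 'k^2^2" where
  "mat2 a b c d = vector [vector [a, b], vector [c, d]]"

definition diagonal :: "'k::zero^2^2 \<Rightarrow> bool" where
  "diagonal g \<longleftrightarrow> g $ 1 $ 2 = 0 \<and> g $ 2 $ 1 = 0"

type_synonym 'a point = "('a alg_closure^2^2) \<times> 'a alg_closure"

type_synonym 'a geom_point =
  "(('a alg_closure \<Rightarrow> 'a alg_closure) \<Rightarrow> 'a alg_closure^2^2) \<times>
   (('a alg_closure \<Rightarrow> 'a alg_closure) \<Rightarrow> 'a alg_closure)"

text \<open>\<open>G0\<close> and \<open>M0\<close> are the groups of rational points.\<close>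

definition G0 :: "'a::field alg_closure set \<Rightarrow> 'a alg_closure set \<Rightarrow> 'a point monoid" where
  "G0 E2 E4 = (GL2 E2 \<times>\<times> GL1 E4)\<lparr>carrier :=
     {(g2, g4) \<in> carrier (GL2 E2) \<times> carrier (GL1 E4).
        field_norm E2 (det g2) * field_norm E4 g4 = 1}\<rparr>"

definition M0 :: "'a::field alg_closure set \<Rightarrow> 'a alg_closure set \<Rightarrow> 'a point set" where
  "M0 E2 E4 = {(g2, g4) \<in> carrier (G0 E2 E4). diagonal g2}"

text \<open>
  \<open>G0_geom\<close> and \<open>M0_geom\<close> are the groups of points over the algebraic closure
  \<open>C\<close>. Via the isomorphism of \<open>E \<otimes> C\<close> with the product of copies of
  \<open>C\<close> indexed by the embeddings of \<open>E\<close>, a point of the restriction of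
  scalars of a group is a family of points indexed by the embeddings, and the condition of
  having determinant 1 on the 8-dimensional space is that the product of all determinants
  is 1. A rational point gives the family of its conjugates.
\<close>

definition G0_geom :: "'a::field alg_closure set \<Rightarrow> 'a alg_closure set \<Rightarrow> 'a geom_point monoid" where
  "G0_geom E2 E4 =
     (product_group (embeddings E2) (\<lambda>_. GL2 UNIV) \<times>\<times>
      product_group (embeddings E4) (\<lambda>_. GL1 UNIV))\<lparr>carrier :=
     {(g, h) \<in> (embeddings E2 \<rightarrow>\<^sub>E carrier (GL2 UNIV)) \<times> (embeddings E4 \<rightarrow>\<^sub>E carrier (GL1 UNIV)).
        (\<Prod>\<sigma>\<in>embeddings E2. det (g \<sigma>)) * (\<Prod>\<tau>\<in>embeddings E4. h \<tau>) = 1}\<rparr>"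

definition M0_geom :: "'a::field alg_closure set \<Rightarrow> 'a alg_closure set \<Rightarrow> 'a geom_point set" where
  "M0_geom E2 E4 = {(g, h) \<in> carrier (G0_geom E2 E4). \<forall>\<sigma>\<in>embeddings E2. diagonal (g \<sigma>)}"

definition to_geom :: "'a::field alg_closure set \<Rightarrow> 'a alg_closure set \<Rightarrow>
    'a point \<Rightarrow> 'a geom_point" where
  "to_geom E2 E4 = (\<lambda>(g2, g4).
     (\<lambda>\<sigma>\<in>embeddings E2. \<chi> i j. \<sigma> (g2 $ i $ j), \<lambda>\<tau>\<in>embeddings E4. \<tau> g4))"

text \<open>
  Rational points of the normaliser of the torus as an algebraic subgroup, that is, of the
  normaliser of its points over the algebraic closure.
\<close>

definition normalizer_M0 :: "'a::field alg_closure set \<Rightarrow> 'a alg_closure set \<Rightarrow> 'a point set" where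
  "normalizer_M0 E2 E4 =
     {n \<in> carrier (G0 E2 E4). to_geom E2 E4 n \<in> normalizer (G0_geom E2 E4) (M0_geom E2 E4)}"

definition iwahori :: "('a::field \<Rightarrow> int) \<Rightarrow> 'a alg_closure set \<Rightarrow>
    ('a alg_closure^2^2) set" where
  "iwahori v E = {g \<in> carrier (GL2 E). g $ 1 $ 1 \<in> ext_units v E \<and> g $ 2 $ 2 \<in> ext_units v E \<and>
     g $ 1 $ 2 \<in> ext_integers v E \<and> g $ 2 $ 1 \<in> ext_prime_ideal v E}"

definition K_st :: "('a::field \<Rightarrow> int) \<Rightarrow> 'a alg_closure set \<Rightarrow> 'a alg_closure set \<Rightarrow> 'a point set" where
  "K_st v E2 E4 = (iwahori v E2 \<times> ext_units v E4) \<inter> carrier (G0 E2 E4)"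

definition K_par :: "('a::field \<Rightarrow> int) \<Rightarrow> 'a alg_closure set \<Rightarrow> 'a alg_closure set \<Rightarrow> 'a point set" where
  "K_par v E2 E4 = {(g2, g4) \<in> K_st v E2 E4.
     reduction v E2 (det g2) \<otimes>\<^bsub>residue_field v\<^esub>
       (reduction v E4 g4 [^]\<^bsub>residue_field v\<^esub> (2::nat)) = \<one>\<^bsub>residue_field v\<^esub>}"

section \<open>The group \<open>W(\<rho>)\<close>\<close>

definition K_M :: "'a::field alg_closure set \<Rightarrow> 'a alg_closure set \<Rightarrow>
    'a point set \<Rightarrow> 'a point set" where
  "K_M E2 E4 K = K \<inter> M0 E2 E4"

definition rho_M :: "('a::field \<Rightarrow> complex) \<Rightarrow> 'a alg_closure set \<Rightarrow> 'a point \<Rightarrow> complex" where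
  "rho_M \<eta> E2 = (\<lambda>(g2, g4). \<eta> (field_norm E2 (g2 $ 2 $ 2)))"

definition N_rho :: "('a::field \<Rightarrow> complex) \<Rightarrow> 'a alg_closure set \<Rightarrow> 'a alg_closure set \<Rightarrow>
    'a point set \<Rightarrow> 'a point set" where
  "N_rho \<eta> E2 E4 K = {n \<in> normalizer_M0 E2 E4.
     n <#\<^bsub>G0 E2 E4\<^esub> K_M E2 E4 K #>\<^bsub>G0 E2 E4\<^esub> inv\<^bsub>G0 E2 E4\<^esub> n = K_M E2 E4 K \<and>
     (\<forall>x \<in> K_M E2 E4 K.
        rho_M \<eta> E2 (inv\<^bsub>G0 E2 E4\<^esub> n \<otimes>\<^bsub>G0 E2 E4\<^esub> x \<otimes>\<^bsub>G0 E2 E4\<^esub> n) = rho_M \<eta> E2 x)}"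

definition W_rho :: "('a::field \<Rightarrow> complex) \<Rightarrow> 'a alg_closure set \<Rightarrow> 'a alg_closure set \<Rightarrow>
    'a point set \<Rightarrow> 'a point set monoid" where
  "W_rho \<eta> E2 E4 K = (G0 E2 E4)\<lparr>carrier := N_rho \<eta> E2 E4 K\<rparr> Mod K_M E2 E4 K"

definition W_class :: "'a::field alg_closure set \<Rightarrow> 'a alg_closure set \<Rightarrow>
    'a point set \<Rightarrow> 'a point \<Rightarrow> 'a point set" where
  "W_class E2 E4 K n = K_M E2 E4 K #>\<^bsub>G0 E2 E4\<^esub> n"

section \<open>Coxeter groups\<close>

text \<open>
  The Coxeter group with generating set the type \<open>'s\<close> and Coxeter matrix \<open>m\<close>
  (with \<open>m s s = 1\<close>) is the group presented by the relations
  \<open>(s t)^(m s t) = 1\<close> for finite \<open>m s t\<close>. As the generators are involutions,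
  it is a quotient of the free monoid of words.
\<close>

inductive coxeter_eq :: "('s \<Rightarrow> 's \<Rightarrow> enat) \<Rightarrow> 's list \<Rightarrow> 's list \<Rightarrow> bool"
  for m :: "'s \<Rightarrow> 's \<Rightarrow> enat" where
  coxeter_relation: "m s t = enat k \<Longrightarrow>
    coxeter_eq m (u @ concat (replicate k [s, t]) @ w) (u @ w)"
| coxeter_refl: "coxeter_eq m u u"
| coxeter_sym: "coxeter_eq m u w \<Longrightarrow> coxeter_eq m w u"
| coxeter_trans: "coxeter_eq m u w \<Longrightarrow> coxeter_eq m w x \<Longrightarrow> coxeter_eq m u x"

definition coxeter_group :: "('s \<Rightarrow> 's \<Rightarrow> enat) \<Rightarrow> 's list set monoid" where
  "coxeter_group m =
     \<lparr>carrier = UNIV // {(u, w). coxeter_eq m u w},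
      monoid.mult = (\<lambda>A B. \<Union>a\<in>A. \<Union>b\<in>B. {w. coxeter_eq m (a @ b) w}),
      one = {w. coxeter_eq m [] w}\<rparr>"

definition W_aff_A1 :: "bool list set monoid" where
  "W_aff_A1 = coxeter_group (\<lambda>s t. if s = t then 1 else \<infinity>)"

section \<open>Direct products\<close>

definition internal_direct_product :: "('g, 'm) monoid_scheme \<Rightarrow> 'g set \<Rightarrow> 'g set \<Rightarrow> bool" where
  "internal_direct_product W A B \<longleftrightarrow> group W \<and> subgroup A W \<and> subgroup B W \<and>
     (\<lambda>(a, b). a \<otimes>\<^bsub>W\<^esub> b) \<in> iso (W\<lparr>carrier := A\<rparr> \<times>\<times> W\<lparr>carrier := B\<rparr>) W"

text \<open>An isomorphism of \<open>W\<close> with \<open>H \<times> K\<close> taking \<open>A\<close> and \<open>B\<close> to the two factors.\<close>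

definition iso_with_factors ::
  "('g, 'm) monoid_scheme \<Rightarrow> 'g set \<Rightarrow> 'g set \<Rightarrow> 'h monoid \<Rightarrow> 'k monoid \<Rightarrow> bool" where
  "iso_with_factors W A B H K \<longleftrightarrow> (\<exists>\<phi> \<in> iso W (H \<times>\<times> K).
     \<phi> ` A = carrier H \<times> {\<one>\<^bsub>K\<^esub>} \<and> \<phi> ` B = {\<one>\<^bsub>H\<^esub>} \<times> carrier K)"

end

theory Submission
  imports Defs
begin

text \<open>
  Rational points of the normaliser of \<open>M0\<close> are the pairs \<open>(g, h)\<close> with \<open>g\<close> diagonal or
  antidiagonal, and all of them fix \<open>\<rho>\<close>: for \<open>(x, y, z)\<close> in \<open>K_M\<close> with residues \<open>a\<close>, \<open>b\<close>,
  \<open>r\<close> the norm condition reads \<open>a\<^sup>2 b\<^sup>2 r\<^sup>4 = 1\<close>, and since \<open>\<eta>\<^sup>4 = 1\<close> on units this gives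
  \<open>\<eta>(a\<^sup>2) = \<eta>(b\<^sup>2)\<close>. If the entries of \<open>g\<close> have valuations \<open>i\<close>, \<open>j\<close> and
  that of \<open>h\<close> is \<open>l\<close>, the norm condition forces \<open>i + j + l = 0\<close> and makes \<open>\<zeta>\<close> to the power
  \<open>i + j\<close> a square in the residue field, so \<open>i = m + k\<close> and \<open>j = m - k\<close>. The integer
  \<open>k\<close> together with the permutation type of \<open>g\<close> is an element of the infinite dihedral
  group, \<open>m\<close> is the factor \<open>\<int>\<close>, and the remaining ambiguity is the square root
  \<open>\<plusminus> 1\<close> in \<open>(det g \<cdot> h\<^sup>2)\<^sup>2 = 1\<close> on residues, which is trivial exactly on the parahoric subgroup.
  These invariants are multiplicative, the kernel is \<open>K_M\<close>, and the given elements map to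
  generators of the factors.
\<close>

section \<open>Valuations and residues\<close>

text \<open>Upstairs there is no valuation to start from: integers, prime ideal and norm of an
  extension are given by integral closure, non-units and embeddings. Both extensions are therefore
  treated at once, as generated by \<open>\<pi>\<close> with \<open>\<pi> ^ e = - c\<close> and
  \<open>v c = 1\<close> over a field containing a primitive \<open>e\<close>-th root of unity
  \<open>w\<close>. Elements are values of polynomials at \<open>\<pi>\<close>, conjugation is the
  substitution \<open>X \<mapsto> w X\<close>, and every invariant is read off from leading terms.
  For \<open>e = 4\<close> the root \<open>w\<close> exists because of \<open>4 dvd q - 1\<close>;
  in both degrees the powers of \<open>w\<close> multiply to \<open>- 1\<close>, so
  \<open>\<pi>\<close> has norm \<open>c\<close>. The factor \<zeta> in the quartic equation is the
  source of the parity constraint: \<open>\<pi>4\<close> has norm \<open>\<zeta> * \<pi>F\<close>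
  while \<open>\<pi>2\<close> has norm \<open>\<pi>F\<close>, so the norm condition equates a power
  of \<zeta> with a square of residues. Dividing the square root by \<open>\<zeta> powi m\<close>
  makes the remaining sign multiplicative, which is why the factor of order 2 splits off from the
  integers.\<close>

locale local_field =
  fixes v :: "'a::field \<Rightarrow> int"
  assumes nonarch: "nonarch_local_field v"
begin

text \<open>Congruences between representatives replace elements of the quotient ring, so that signs
  and powers of \<zeta> remain ordinary field elements.\<close>

definition rescong :: "'a \<Rightarrow> 'a \<Rightarrow> bool" where
  "rescong a b \<longleftrightarrow> a - b \<in> prime_ideal v"

definition unit :: "'a \<Rightarrow> bool" where
  "unit a \<longleftrightarrow> a \<noteq> 0 \<and> v a = 0"

lemma v_mult: "x \<noteq> 0 \<Longrightarrow> y \<noteq> 0 \<Longrightarrow> v (x * y) = v x + v y"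
  using nonarch unfolding nonarch_local_field_def by blast

lemma val_ge_add: "val_ge v n x \<Longrightarrow> val_ge v n y \<Longrightarrow> val_ge v n (x + y)"
  using nonarch unfolding nonarch_local_field_def by blast

lemma v_one [simp]: "v 1 = 0"
  using v_mult[of 1 1] by simp

lemma v_neg_one [simp]: "v (- 1) = 0"
  using v_mult[of "-1" "-1"] by simp

lemma v_minus [simp]: "v (- x) = v x"
proof (cases "x = 0")
  case False
  then show ?thesis using v_mult[of "-1" x] by simp
qed auto

lemma v_power: "x \<noteq> 0 \<Longrightarrow> v (x ^ n) = int n * v x"
  by (induction n) (auto simp: v_mult algebra_simps)

lemma v_inverse: "x \<noteq> 0 \<Longrightarrow> v (inverse x) = - v x"
  using v_mult[of x "inverse x"] by simp

lemma v_power_int: "x \<noteq> 0 \<Longrightarrow> v (x powi n) = n * v x"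
  by (cases n rule: int_cases3) (auto simp: v_power v_inverse power_int_minus)

lemma val_ge_minus [simp]: "val_ge v n (- x) \<longleftrightarrow> val_ge v n x"
  by (auto simp: val_ge_def)

lemma val_ge_mult: "val_ge v n x \<Longrightarrow> val_ge v m y \<Longrightarrow> val_ge v (n + m) (x * y)"
  by (auto simp: val_ge_def v_mult)

lemma val_ge_0 [simp]: "val_ge v n 0"
  by (simp add: val_ge_def)

lemma integers_iff: "x \<in> integers v \<longleftrightarrow> val_ge v 0 x"
  by (simp add: integers_def)

lemma prime_ideal_iff: "x \<in> prime_ideal v \<longleftrightarrow> val_ge v 1 x"
  by (simp add: prime_ideal_def)

lemma integers_closed [simp, intro]:
  "0 \<in> integers v" "1 \<in> integers v"
  "x \<in> integers v \<Longrightarrow> y \<in> integers v \<Longrightarrow> x + y \<in> integers v"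
  "x \<in> integers v \<Longrightarrow> y \<in> integers v \<Longrightarrow> x * y \<in> integers v"
  "x \<in> integers v \<Longrightarrow> y \<in> integers v \<Longrightarrow> x - y \<in> integers v"
  "x \<in> integers v \<Longrightarrow> - x \<in> integers v"
  using val_ge_add[of 0 x y] val_ge_add[of 0 x "-y"] val_ge_mult[of 0 x 0 y]
  by (auto simp: integers_iff, auto simp: val_ge_def)

lemma integers_power [intro]: "x \<in> integers v \<Longrightarrow> x ^ n \<in> integers v"
  by (induction n) auto

lemma integers_sum: "(\<And>i. i \<in> A \<Longrightarrow> f i \<in> integers v) \<Longrightarrow> sum f A \<in> integers v"
  by (induction A rule: infinite_finite_induct) auto

lemma prime_ideal_closed [simp, intro]:
  "0 \<in> prime_ideal v"
  "x \<in> prime_ideal v \<Longrightarrow> y \<in> prime_ideal v \<Longrightarrow> x + y \<in> prime_ideal v"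
  "x \<in> prime_ideal v \<Longrightarrow> y \<in> prime_ideal v \<Longrightarrow> x - y \<in> prime_ideal v"
  "x \<in> prime_ideal v \<Longrightarrow> - x \<in> prime_ideal v"
  "x \<in> prime_ideal v \<Longrightarrow> y \<in> integers v \<Longrightarrow> x * y \<in> prime_ideal v"
  "x \<in> prime_ideal v \<Longrightarrow> y \<in> integers v \<Longrightarrow> y * x \<in> prime_ideal v"
  using val_ge_add[of 1 x y] val_ge_add[of 1 x "-y"] val_ge_mult[of 1 x 0 y] val_ge_mult[of 0 y 1 x]
  by (auto simp: integers_iff prime_ideal_iff)

lemma prime_ideal_subset: "x \<in> prime_ideal v \<Longrightarrow> x \<in> integers v"
  by (auto simp: integers_iff prime_ideal_iff val_ge_def)

lemma prime_ideal_sum: "(\<And>i. i \<in> A \<Longrightarrow> f i \<in> prime_ideal v) \<Longrightarrow> sum f A \<in> prime_ideal v"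
  by (induction A rule: infinite_finite_induct) auto

lemma unit_iff: "unit x \<longleftrightarrow> x \<in> integers v \<and> x \<notin> prime_ideal v"
  by (auto simp: integers_iff prime_ideal_iff val_ge_def unit_def)

lemma unit_integers: "unit x \<Longrightarrow> x \<in> integers v"
  by (simp add: unit_iff)

lemma unit_closed [simp, intro]:
  "unit 1" "unit (- 1)" "unit x \<Longrightarrow> unit y \<Longrightarrow> unit (x * y)" "unit x \<Longrightarrow> unit (inverse x)"
  "unit x \<Longrightarrow> unit (x ^ n)"
  by (auto simp: unit_def v_mult v_inverse v_power)

lemma unit_power_int [simp, intro]: "unit x \<Longrightarrow> unit (x powi n)"
  by (auto simp: unit_def v_power_int)

lemma unit_nonzero: "unit x \<Longrightarrow> x \<noteq> 0"
  by (simp add: unit_def)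

lemma rescong_refl [simp, intro]: "rescong a a"
  by (simp add: rescong_def)

lemma rescong_sym: "rescong a b \<Longrightarrow> rescong b a"
  using prime_ideal_closed(4)[of "a - b"] by (simp add: rescong_def)

lemma rescong_trans: "rescong a b \<Longrightarrow> rescong b c \<Longrightarrow> rescong a c"
  using prime_ideal_closed(2)[of "a - b" "b - c"] by (simp add: rescong_def)

lemma rescong_integers: "rescong a b \<Longrightarrow> b \<in> integers v \<Longrightarrow> a \<in> integers v"
  using integers_closed(3)[of "a - b" b] prime_ideal_subset by (simp add: rescong_def)

lemma rescong_mult:
  assumes "rescong a b" "rescong c d" "b \<in> integers v" "d \<in> integers v"
  shows "rescong (a * c) (b * d)"
proof -
  have "a * c - b * d = (a - b) * c + b * (c - d)" by (simp add: algebra_simps)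
  then show ?thesis using assms rescong_integers[OF assms(2,4)] by (auto simp: rescong_def)
qed

lemma rescong_power: "rescong a b \<Longrightarrow> b \<in> integers v \<Longrightarrow> rescong (a ^ n) (b ^ n)"
  by (induction n) (auto intro: rescong_mult)

lemma rescong_sum: "(\<And>i. i \<in> A \<Longrightarrow> rescong (f i) (g i)) \<Longrightarrow> rescong (sum f A) (sum g A)"
  by (simp add: rescong_def prime_ideal_sum flip: sum_subtractf)

lemma rescong_0_iff: "rescong a 0 \<longleftrightarrow> a \<in> prime_ideal v"
  by (simp add: rescong_def)

lemma rescong_unit:
  assumes "rescong a b" "unit b" shows "unit a"
  using assms rescong_integers[of a b] rescong_trans[of b a 0] rescong_sym[of a b]
  by (auto simp: unit_iff rescong_0_iff)

lemma rescong_cancel: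
  assumes "rescong (c * a) (c * b)" "unit c" shows "rescong a b"
proof -
  have "inverse c * (c * a - c * b) \<in> prime_ideal v"
    using assms unit_integers by (auto simp: rescong_def)
  moreover have "inverse c * (c * a - c * b) = a - b"
    using unit_nonzero[OF assms(2)] by (simp add: field_simps)
  ultimately show ?thesis by (simp add: rescong_def)
qed

lemma rescong_inverse:
  assumes "rescong a b" "unit b" shows "rescong (inverse a) (inverse b)"
proof (rule rescong_cancel)
  show "unit (a * b)" using assms rescong_unit by blast
  show "rescong (a * b * inverse a) (a * b * inverse b)"
    using assms rescong_sym rescong_unit unit_nonzero by (simp add: field_simps)
qed

lemma prime_ideal_mult_iff:
  assumes "x \<in> integers v" "y \<in> integers v"
  shows "x * y \<in> prime_ideal v \<longleftrightarrow> x \<in> prime_ideal v \<or> y \<in> prime_ideal v"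
  using assms unit_closed(3)[of x y] by (auto simp: unit_iff)

lemma rescong_square_1:
  assumes "rescong (t ^ 2) 1" "t \<in> integers v" shows "rescong t 1 \<or> rescong t (- 1)"
proof -
  have "(t - 1) * (t + 1) \<in> prime_ideal v"
    using assms(1) by (simp add: rescong_def algebra_simps power2_eq_square)
  then show ?thesis using assms(2) by (subst (asm) prime_ideal_mult_iff) (auto simp: rescong_def)
qed

section \<open>The residue field as a ring of congruence classes\<close>

abbreviation "valuation_ring \<equiv> ring_of_type_algebra\<lparr>carrier := integers v\<rparr>"

definition residue_class :: "'a \<Rightarrow> 'a set" where
  "residue_class a = {b. rescong b a}"

lemma valuation_ring_cring: "cring valuation_ring"
proof -
  have "\<exists>y \<in> integers v. x + y = 0 \<and> y + x = 0" if "x \<in> integers v" for x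
    using that by (intro bexI[of _ "- x"]) auto
  then show ?thesis
    by unfold_locales (auto simp: ring_of_type_algebra_def Units_def algebra_simps)
qed

lemma prime_ideal_ideal: "ideal (prime_ideal v) valuation_ring"
proof (rule idealI)
  show "ring valuation_ring" using valuation_ring_cring cring.axioms(1) by blast
  interpret cring valuation_ring by (rule valuation_ring_cring)
  have inv: "inv\<^bsub>add_monoid valuation_ring\<^esub> x = - x" if "x \<in> integers v" for x
    using that
    by (intro group.inv_equality[OF a_group]) (auto simp: ring_of_type_algebra_def)
  show "subgroup (prime_ideal v) (add_monoid valuation_ring)"
    by (rule group.subgroupI[OF a_group])
       (use inv prime_ideal_subset in \<open>auto simp: ring_of_type_algebra_def\<close>)
qed (auto simp: ring_of_type_algebra_def)

lemma residue_ring: "ring (residue_field v)"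
  unfolding residue_field_def by (rule ideal.quotient_is_ring[OF prime_ideal_ideal])

lemma coset_eq_residue_class:
  assumes "a \<in> integers v"
  shows "prime_ideal v +>\<^bsub>valuation_ring\<^esub> a = residue_class a"
proof -
  have "b \<in> (\<Union>h\<in>prime_ideal v. {h + a}) \<longleftrightarrow> rescong b a" for b
    by (auto simp: rescong_def intro!: bexI[of _ "b - a"])
  then show ?thesis
    by (auto simp: a_r_coset_def' residue_class_def ring_of_type_algebra_def)
qed

lemma carrier_residue_field: "carrier (residue_field v) = residue_class ` integers v"
proof -
  have "carrier (residue_field v) = (\<Union>a\<in>integers v. {prime_ideal v +>\<^bsub>valuation_ring\<^esub> a})"
    unfolding residue_field_def FactRing_def A_RCOSETS_def RCOSETS_def a_r_coset_def
    by (simp add: ring_of_type_algebra_def)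
  then show ?thesis using coset_eq_residue_class by (auto simp: image_iff)
qed

lemma residue_class_eq_iff: "residue_class a = residue_class b \<longleftrightarrow> rescong a b"
  unfolding residue_class_def using rescong_trans rescong_sym by blast

lemma residue_mult:
  assumes "a \<in> integers v" "b \<in> integers v"
  shows "residue_class a \<otimes>\<^bsub>residue_field v\<^esub> residue_class b = residue_class (a * b)"
proof -
  have "(prime_ideal v +>\<^bsub>valuation_ring\<^esub> a) \<otimes>\<^bsub>residue_field v\<^esub> (prime_ideal v +>\<^bsub>valuation_ring\<^esub> b)
      = prime_ideal v +>\<^bsub>valuation_ring\<^esub> (a * b)"
    using ideal.rcoset_mult_add[OF prime_ideal_ideal, of a b] assms
    by (simp add: residue_field_def FactRing_def ring_of_type_algebra_def)
  then show ?thesis using assms by (simp add: coset_eq_residue_class)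
qed

lemma residue_one: "\<one>\<^bsub>residue_field v\<^esub> = residue_class 1"
  using coset_eq_residue_class[of 1]
  by (simp add: residue_field_def FactRing_def ring_of_type_algebra_def)

lemma residue_zero: "\<zero>\<^bsub>residue_field v\<^esub> = residue_class 0"
  by (auto simp: residue_field_def FactRing_def residue_class_def rescong_def)

lemma residue_add:
  assumes "a \<in> integers v" "b \<in> integers v"
  shows "residue_class a \<oplus>\<^bsub>residue_field v\<^esub> residue_class b = residue_class (a + b)"
proof -
  have "(prime_ideal v +>\<^bsub>valuation_ring\<^esub> (a \<oplus>\<^bsub>valuation_ring\<^esub> b))
      = (prime_ideal v +>\<^bsub>valuation_ring\<^esub> a) \<oplus>\<^bsub>residue_field v\<^esub> (prime_ideal v +>\<^bsub>valuation_ring\<^esub> b)"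
    using ring_hom_add[OF ideal.rcos_ring_hom[OF prime_ideal_ideal], of a b] assms
    by (simp add: residue_field_def)
  moreover have "a \<oplus>\<^bsub>valuation_ring\<^esub> b = a + b"
    by (simp add: ring_of_type_algebra_def)
  ultimately show ?thesis using assms by (simp add: coset_eq_residue_class)
qed

lemma residue_of_nat: "[n] \<cdot>\<^bsub>residue_field v\<^esub> \<one>\<^bsub>residue_field v\<^esub> = residue_class (of_nat n)"
proof (induction n)
  case 0
  show ?case by (simp add: add_pow_def residue_zero)
next
  case (Suc n)
  have "of_nat n \<in> integers v" for n by (induction n) auto
  then have "residue_class (of_nat n) \<oplus>\<^bsub>residue_field v\<^esub> residue_class 1 = residue_class (of_nat n + 1)"
    by (intro residue_add) auto
  then show ?case using Suc by (simp add: add_pow_def residue_one add.commute)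
qed

text \<open>Carries statements on the characteristic from the quotient ring, where the hypotheses
  make them, to the valuation ring.\<close>

lemma of_nat_prime_ideal_iff:
  "of_nat n \<in> prime_ideal v \<longleftrightarrow> [n] \<cdot>\<^bsub>residue_field v\<^esub> \<one>\<^bsub>residue_field v\<^esub> = \<zero>\<^bsub>residue_field v\<^esub>"
  by (simp add: residue_of_nat residue_zero residue_class_eq_iff rescong_0_iff)

text \<open>Lagrange's theorem in the additive group of the residue field: its order kills
  1.\<close>

lemma residue_order_prime_ideal: "of_nat (Coset.order (residue_field v)) \<in> prime_ideal v"
proof -
  interpret ring "residue_field v" by (rule residue_ring)
  have "Coset.order (add_monoid (residue_field v)) = Coset.order (residue_field v)"
    by (simp add: Coset.order_def)
  then show ?thesis
    using group.pow_order_eq_1[OF add.is_group, of "\<one>\<^bsub>residue_field v\<^esub>"]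
    by (simp add: of_nat_prime_ideal_iff add_pow_def)
qed

end

section \<open>Roots of unity and their residues\<close>

locale tame_local_field = local_field v for v :: "'a::field \<Rightarrow> int" +
  fixes p q :: nat and \<zeta> :: 'a
  assumes odd_p: "odd p" and residue_char: "of_nat p \<in> prime_ideal v"
    and q_def: "q = Coset.order (residue_field v)" and q_mod_4: "4 dvd q - 1"
    and \<zeta>_root: "\<zeta> ^ (q - 1) = 1" and \<zeta>_primitive: "\<forall>k. 0 < k \<and> k < q - 1 \<longrightarrow> \<zeta> ^ k \<noteq> 1"
begin

lemma q_ge_2: "q \<ge> 2"
proof -
  have "finite (carrier (residue_field v))"
    using nonarch by (simp add: nonarch_local_field_def)
  moreover have "{residue_class 0, residue_class 1} \<subseteq> carrier (residue_field v)"
    by (auto simp: carrier_residue_field)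
  moreover have "residue_class 0 \<noteq> residue_class 1"
    using unit_closed(1) rescong_sym[of 0 1] by (auto simp: residue_class_eq_iff rescong_0_iff unit_iff)
  ultimately show ?thesis
    using card_mono[of "carrier (residue_field v)" "{residue_class 0, residue_class 1}"]
    by (simp add: q_def Coset.order_def)
qed

text \<open>With \<open>p = 2 * k + 1\<close>, having both 2 and \<open>p\<close> in the prime ideal
  would put 1 there. This is what separates the two signs on residues.\<close>

lemma two_unit: "\<not> rescong 1 (- 1)"
proof
  assume "rescong 1 (- 1)"
  then have "(2::'a) \<in> prime_ideal v" by (simp add: rescong_def)
  moreover obtain k where "p = 2 * k + 1" using odd_p by (elim oddE)
  moreover have "of_nat k \<in> integers v" for k by (induction k) auto
  ultimately have "2 * of_nat k \<in> prime_ideal v" by auto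
  then have "of_nat p - 2 * of_nat k \<in> prime_ideal v"
    by (rule prime_ideal_closed(3)[OF residue_char])
  moreover have "of_nat p - 2 * of_nat k = (1::'a)" using \<open>p = 2 * k + 1\<close> by simp
  ultimately show False using unit_closed(1) by (simp add: unit_iff)
qed

lemma neg_one_neq_one: "- 1 \<noteq> (1::'a)"
  using two_unit by (metis rescong_refl)

lemma unit_\<zeta> [simp, intro]: "unit \<zeta>"
proof -
  have "\<zeta> \<noteq> 0" using \<zeta>_root q_ge_2 by (auto simp: power_0_left split: if_splits)
  moreover from this have "int (q - 1) * v \<zeta> = 0"
    using v_power[of \<zeta> "q - 1"] \<zeta>_root by simp
  ultimately show ?thesis using q_ge_2 by (simp add: unit_def)
qed

text \<open>A geometric sum shows that the root stays primitive after reduction: the sum of the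
  \<open>q - 1\<close> powers of \<open>\<zeta> ^ k\<close> vanishes, but if
  \<open>\<zeta> ^ k\<close> were congruent to 1 it would be congruent to \<open>q - 1\<close>,
  hence to \<open>- 1\<close>.\<close>

lemma \<zeta>_power_not_rescong_1:
  assumes "0 < k" "k < q - 1" shows "\<not> rescong (\<zeta> ^ k) 1"
proof
  assume *: "rescong (\<zeta> ^ k) 1"
  have "(\<zeta> ^ k - 1) * (\<Sum>j<q-1. (\<zeta> ^ k) ^ j) = (\<zeta> ^ k) ^ (q - 1) - 1"
    by (metis power_diff_1_eq)
  also have "(\<zeta> ^ k) ^ (q - 1) = 1"
    by (metis \<zeta>_root mult.commute power_mult power_one)
  finally have "(\<Sum>j<q-1. (\<zeta> ^ k) ^ j) = 0"
    using \<zeta>_primitive assms by auto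
  moreover have "rescong (\<Sum>j<q-1. (\<zeta> ^ k) ^ j) (\<Sum>j<q-1. 1 ^ j)"
    by (intro rescong_sum rescong_power * ) auto
  ultimately have "rescong 0 (of_nat q - 1)"
    using q_ge_2 by simp
  moreover have "rescong (of_nat q) 0"
    using residue_order_prime_ideal by (simp add: rescong_0_iff q_def)
  ultimately have "rescong 1 0"
    using prime_ideal_closed(2)[of "0 - (of_nat q - 1)" "of_nat q - 0"] by (simp add: rescong_def)
  then show False using unit_closed(1) by (simp add: rescong_0_iff unit_iff)
qed

text \<open>By counting: the first \<open>q - 1\<close> powers of \<zeta> have distinct classes, and
  there are only \<open>q - 1\<close> nonzero classes.\<close>

lemma unit_rescong_\<zeta>_power:
  assumes "unit a" obtains k where "rescong a (\<zeta> ^ k)"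
proof -
  let ?f = "\<lambda>k. residue_class (\<zeta> ^ k)" and ?C = "carrier (residue_field v) - {residue_class 0}"
  have fin: "finite (carrier (residue_field v))"
    using nonarch by (simp add: nonarch_local_field_def)
  have inj: "inj_on ?f {..<q - 1}"
  proof (rule linorder_inj_onI)
    fix i j assume ij: "i < j" "i \<in> {..<q - 1}" "j \<in> {..<q - 1}"
    show "?f i \<noteq> ?f j"
    proof
      assume "?f i = ?f j"
      then have "rescong (\<zeta> ^ i * \<zeta> ^ (j - i)) (\<zeta> ^ i * 1)"
        using ij rescong_sym by (simp add: residue_class_eq_iff flip: power_add)
      moreover have "0 < j - i" "j - i < q - 1" using ij by auto
      ultimately show False using \<zeta>_power_not_rescong_1[of "j - i"] rescong_cancel[of "\<zeta> ^ i" "\<zeta> ^ (j - i)" 1] by auto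
    qed
  qed auto
  have unit_class: "residue_class a \<in> ?C" if "unit a" for a
    using that by (auto simp: carrier_residue_field residue_class_eq_iff rescong_0_iff unit_iff)
  have "card ?C = q - 1"
    using fin by (subst card_Diff_singleton) (auto simp: carrier_residue_field q_def Coset.order_def)
  then have "?f ` {..<q - 1} = ?C"
    using fin unit_class inj by (intro card_subset_eq) (auto simp: card_image)
  then have "residue_class a \<in> ?f ` {..<q - 1}" using unit_class[OF assms] by simp
  then show ?thesis using that by (auto simp: residue_class_eq_iff)
qed

text \<open>A square root of 1 other than 1. It makes odd powers of \<zeta> non-squares modulo the
  prime ideal, and later yields a fourth root of unity whose square is \<open>- 1\<close>.\<close>

lemma \<zeta>_half_power: "\<zeta> ^ ((q - 1) div 2) = - 1"
proof -
  have "(\<zeta> ^ ((q - 1) div 2))\<^sup>2 = 1"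
    using q_mod_4 \<zeta>_root by (simp flip: power_mult) (metis dvd_div_mult_self dvd_trans dvd_triv_left numeral_Bit0 mult_2)
  moreover have "\<zeta> ^ ((q - 1) div 2) \<noteq> 1"
    using q_mod_4 q_ge_2 by (intro \<zeta>_primitive[rule_format]) auto
  ultimately show ?thesis by (simp add: power2_eq_1_iff)
qed

end

section \<open>Totally tamely ramified extensions\<close>

text \<open>Elements of an extension are written as such values, which turns computations upstairs
  into computations with polynomials over the base field.\<close>

definition ac_eval :: "'a::field poly \<Rightarrow> 'a alg_closure \<Rightarrow> 'a alg_closure" where
  "ac_eval P x = poly (map_poly to_ac P) x"

lemma ac_eval_pCons [simp]: "ac_eval (pCons a P) x = to_ac a + x * ac_eval P x"
  by (simp add: ac_eval_def map_poly_pCons)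

lemma ac_eval_0 [simp]: "ac_eval 0 x = 0"
  by (simp add: ac_eval_def)

lemma ac_eval_1 [simp]: "ac_eval 1 x = 1"
  by (simp add: one_pCons)

lemma ac_eval_add [simp]: "ac_eval (P + Q) x = ac_eval P x + ac_eval Q x"
proof -
  have "map_poly to_ac (P + Q) = map_poly to_ac P + map_poly to_ac Q"
    by (intro poly_eqI) (simp add: coeff_map_poly)
  then show ?thesis by (simp add: ac_eval_def)
qed

lemma ac_eval_smult [simp]: "ac_eval (smult a P) x = to_ac a * ac_eval P x"
  by (induction P) (auto simp: algebra_simps)

lemma ac_eval_minus [simp]: "ac_eval (- P) x = - ac_eval P x"
  using ac_eval_smult[of "- 1" P x] by simp

lemma ac_eval_diff [simp]: "ac_eval (P - Q) x = ac_eval P x - ac_eval Q x"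
  using ac_eval_add[of P "- Q" x] by simp

lemma ac_eval_mult [simp]: "ac_eval (P * Q) x = ac_eval P x * ac_eval Q x"
  by (induction P) (auto simp: algebra_simps)

lemma ac_eval_div_mod: "ac_eval P x = ac_eval (P div Q) x * ac_eval Q x + ac_eval (P mod Q) x"
  by (simp flip: ac_eval_mult ac_eval_add)

lemma ac_eval_power [simp]: "ac_eval (P ^ n) x = ac_eval P x ^ n"
  by (induction n) auto

lemma ac_eval_prod: "ac_eval (prod f A) x = (\<Prod>i\<in>A. ac_eval (f i) x)"
  by (induction A rule: infinite_finite_induct) auto

lemma ac_eval_pcompose: "ac_eval (pcompose P Q) x = ac_eval P (ac_eval Q x)"
  by (induction P) (auto simp: pcompose_pCons)

lemma ac_eval_monom: "ac_eval (Polynomial.monom a n) x = to_ac a * x ^ n"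
  by (simp add: ac_eval_def map_poly_monom poly_monom)

lemma ac_eval_sum_coeff:
  "Polynomial.degree P \<le> n \<Longrightarrow> ac_eval P x = (\<Sum>i\<le>n. to_ac (Polynomial.coeff P i) * x ^ i)"
  unfolding ac_eval_def
  by (subst poly_altdef, simp add: coeff_map_poly degree_map_poly)
     (intro sum.mono_neutral_left, auto simp: coeff_eq_0)

section \<open>Kummer extensions generated by a root of \<open>X ^ e + c\<close>\<close>

locale tame_extension = local_field v for v :: "'a::field \<Rightarrow> int" +
  fixes e :: nat and w c :: 'a and \<pi> :: "'a alg_closure"
  assumes e_pos: "e > 0" and w_root: "w ^ e = 1"
    and w_primitive: "\<And>k. 0 < k \<Longrightarrow> k < e \<Longrightarrow> w ^ k \<noteq> 1"
    and prod_w: "(\<Prod>k<e. w ^ k) = - 1"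
    and c_nonzero: "c \<noteq> 0" and v_c: "v c = 1" and \<pi>_power: "\<pi> ^ e = - to_ac c"
begin

definition ext :: "'a alg_closure set" where
  "ext = range (\<lambda>P. ac_eval P \<pi>)"

definition kummer_poly :: "'a poly" where
  "kummer_poly = Polynomial.monom 1 e + [:c:]"

lemma \<pi>_nonzero [simp]: "\<pi> \<noteq> 0"
  using \<pi>_power c_nonzero e_pos by (auto simp: power_0_left)

lemma w_nonzero [simp]: "w \<noteq> 0"
  using w_root e_pos by (auto simp: power_0_left)

lemma unit_w [simp, intro]: "unit w"
  using v_power[of w e] w_root e_pos by (simp add: unit_def)

lemma w_power_eq_1_iff: "w ^ k = 1 \<longleftrightarrow> e dvd k"
proof
  assume "w ^ k = 1"
  moreover have "w ^ k = w ^ (k mod e)"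
  proof -
    have "w ^ k = w ^ (e * (k div e) + k mod e)" by simp
    also have "\<dots> = w ^ (k mod e)" by (simp only: power_add power_mult w_root power_one mult_1)
    finally show ?thesis .
  qed
  ultimately show "e dvd k" using w_primitive[of "k mod e"] e_pos by (cases "k mod e = 0") auto
qed (auto simp: power_mult w_root)

text \<open>The quotient \<open>y / \<pi>\<close> is an \<open>e\<close>-th root of unity, and the
  powers of \<open>w\<close> already supply \<open>e\<close> distinct roots of
  \<open>X ^ e - 1\<close>.\<close>

lemma root_eq_w_power:
  assumes "y ^ e = \<pi> ^ e" obtains k where "k < e" "y = to_ac (w ^ k) * \<pi>"
proof -
  let ?p = "Polynomial.monom 1 e + [:- 1:] :: 'a alg_closure poly"
  let ?R = "{x. poly ?p x = 0}"
  have R: "?R = {x. x ^ e = 1}" by (auto simp: poly_monom)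
  have inj: "inj_on (\<lambda>k. to_ac (w ^ k)) {..<e}"
  proof (rule linorder_inj_onI)
    fix i j assume ij: "i < j" "i \<in> {..<e}" "j \<in> {..<e}"
    show "to_ac (w ^ i) \<noteq> to_ac (w ^ j)"
    proof
      assume "to_ac (w ^ i) = to_ac (w ^ j)"
      then have "w ^ i * w ^ (j - i) = w ^ i" using ij
        by (metis inj_to_ac injD le_add_diff_inverse less_imp_le_nat power_add)
      moreover have "0 < j - i" "j - i < e" using ij by auto
      ultimately show False using w_primitive[of "j - i"] by auto
    qed
  qed auto
  have "Polynomial.degree ?p = e"
    using e_pos by (subst degree_add_eq_left) (auto simp: degree_monom_eq)
  moreover from this have "?p \<noteq> 0" using e_pos by auto
  ultimately have "card ?R \<le> e" "finite ?R"
    using card_poly_roots_bound[of ?p] poly_roots_finite[of ?p] by auto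
  moreover have "(\<lambda>k. to_ac (w ^ k)) ` {..<e} \<subseteq> ?R"
  proof clarify
    fix k
    have "(w ^ k) ^ e = 1" by (metis mult.commute power_mult power_one w_root)
    then show "poly ?p (to_ac (w ^ k)) = 0" by (simp add: poly_monom flip: to_ac_power)
  qed
  ultimately have "(\<lambda>k. to_ac (w ^ k)) ` {..<e} = ?R"
    using card_image[OF inj] by (intro card_seteq) simp_all
  moreover have "y / \<pi> \<in> ?R"
    using assms by (simp add: R power_divide poly_monom)
  ultimately obtain k where "k < e" "y / \<pi> = to_ac (w ^ k)" by blast
  then show ?thesis using that by (simp add: field_simps)
qed

text \<open>
  A minimal polynomial of degree \<open>m\<close> would divide \<open>X\<^sup>e + c\<close>, so the \<open>e\<close>-th
  power of its constant term would be \<open>\<plusminus> c\<^sup>m\<close>, whose valuation is \<open>m\<close>; hence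
  \<open>e\<close> divides \<open>m\<close>.
\<close>

lemma ac_eval_\<pi>_nonzero:
  assumes "P \<noteq> 0" "Polynomial.degree P < e" shows "ac_eval P \<pi> \<noteq> 0"
proof
  assume "ac_eval P \<pi> = 0"
  define A where "A = (\<lambda>P. P \<noteq> 0 \<and> ac_eval P \<pi> = 0)"
  obtain Q where Q: "A Q" "\<And>R. A R \<Longrightarrow> Polynomial.degree Q \<le> Polynomial.degree R"
    using exists_least_iff[of "\<lambda>n. \<exists>P. A P \<and> Polynomial.degree P = n"] assms(1) \<open>ac_eval P \<pi> = 0\<close>
    unfolding A_def by (metis not_le_imp_less)
  let ?m = "Polynomial.degree Q"
  have m: "?m < e" using Q(2)[of P] assms \<open>ac_eval P \<pi> = 0\<close> by (simp add: A_def)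
  have m0: "?m > 0"
  proof (rule ccontr)
    assume "\<not> ?m > 0"
    then obtain a where "Q = [:a:]" by (metis degree_eq_zeroE not_gr_zero)
    then show False using Q(1) by (auto simp: A_def)
  qed
  have "ac_eval kummer_poly \<pi> = 0"
    by (simp add: kummer_poly_def ac_eval_monom \<pi>_power)
  then have "ac_eval (kummer_poly mod Q) \<pi> = 0"
    using ac_eval_div_mod[of kummer_poly \<pi> Q] Q(1) by (simp add: A_def)
  then have mod0: "kummer_poly mod Q = 0"
    using Q degree_mod_less[of Q kummer_poly] by (metis A_def linorder_not_less)
  obtain B where B: "size B = Polynomial.degree (map_poly to_ac Q)"
    "map_poly to_ac Q = smult (Polynomial.lead_coeff (map_poly to_ac Q)) (\<Prod>x\<in>#B. [:-x, 1:])"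
    using alg_closed_imp_factorization[of "map_poly to_ac Q"] Q(1)
    by (auto simp: A_def map_poly_eq_0_iff)
  define l where "l = Polynomial.lead_coeff Q"
  have l: "l \<noteq> 0" using Q(1) by (simp add: A_def l_def)
  have size_B: "size B = ?m" using B(1) by (simp add: degree_map_poly)
  have lc: "Polynomial.lead_coeff (map_poly to_ac Q) = to_ac l"
    by (simp add: degree_map_poly coeff_map_poly l_def)
  have root: "x ^ e = - to_ac c" if "x \<in># B" for x
  proof -
    have "poly (\<Prod>x\<in>#B. [:-x, 1:]) x = 0"
      using that by (auto simp: poly_prod_mset prod_mset_zero_iff image_iff)
    then have "ac_eval Q x = 0"
      using arg_cong[OF B(2), of "\<lambda>p. poly p x"] by (simp add: ac_eval_def)
    moreover have "kummer_poly = kummer_poly div Q * Q" using mod0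
      by (metis add.right_neutral div_mult_mod_eq)
    ultimately have "ac_eval kummer_poly x = 0" by (metis ac_eval_mult mult_zero_right)
    then show ?thesis by (simp add: kummer_poly_def ac_eval_monom eq_neg_iff_add_eq_0)
  qed
  have prod: "(\<Prod>x\<in>#C. - x) ^ e = ((- 1) ^ e * (- to_ac c)) ^ size C"
    if "\<And>x. x \<in># C \<Longrightarrow> x ^ e = - to_ac c" for C :: "'a alg_closure multiset"
    using that
  proof (induction C)
    case (add x C)
    have "(- x) ^ e = (- 1) ^ e * (- to_ac c)"
      using add.prems[of x] by (subst power_minus) simp
    moreover have "(\<Prod>x\<in>#C. - x) ^ e = ((- 1) ^ e * (- to_ac c)) ^ size C"
      using add by simp
    moreover have "(\<Prod>x\<in>#add_mset x C. - x) ^ e = (- x) ^ e * (\<Prod>x\<in>#C. - x) ^ e"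
      by (simp only: image_mset_add_mset prod_mset.add_mset power_mult_distrib)
    ultimately show ?case by (simp only: size_add_mset power_Suc)
  qed simp
  have "to_ac (Polynomial.coeff Q 0) = poly (map_poly to_ac Q) 0"
    by (simp add: poly_0_coeff_0 coeff_map_poly)
  also have "\<dots> = to_ac l * (\<Prod>x\<in>#B. - x)"
    by (subst B(2)) (simp add: lc poly_prod_mset image_mset.compositionality o_def)
  finally have "to_ac (Polynomial.coeff Q 0) ^ e = to_ac l ^ e * ((- 1) ^ e * (- to_ac c)) ^ ?m"
    using prod[of B] root size_B by (simp add: power_mult_distrib)
  then have "to_ac (Polynomial.coeff Q 0 ^ e) = to_ac (l ^ e * ((- 1) ^ e * (- c)) ^ ?m)"
    by simp
  then have eq: "Polynomial.coeff Q 0 ^ e = l ^ e * ((- 1) ^ e * (- c)) ^ ?m"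
    by (simp only: to_ac_eq_iff)
  have "Polynomial.coeff Q 0 \<noteq> 0"
  proof
    assume "Polynomial.coeff Q 0 = 0"
    then show False using eq l c_nonzero e_pos by (auto simp: power_0_left)
  qed
  then have "int e * v (Polynomial.coeff Q 0) = int e * v l + int ?m"
    using arg_cong[OF eq, of v] l c_nonzero v_c by (simp add: v_power v_mult)
  then have "int ?m = int e * (v (Polynomial.coeff Q 0) - v l)"
    by (simp add: algebra_simps)
  then have "int e dvd int ?m" by (metis dvd_triv_left)
  then have "e dvd ?m" by presburger
  then show False using m m0 by (auto dest: dvd_imp_le)
qed

text \<open>A remainder vanishing at \<open>\<pi>\<close> has degree below \<open>e\<close> and must
  be 0, so \<open>kummer_poly\<close> is the minimal polynomial.\<close>

lemma kummer_dvd_iff: "ac_eval P \<pi> = 0 \<longleftrightarrow> kummer_poly dvd P"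
proof
  have deg: "Polynomial.degree kummer_poly = e"
    unfolding kummer_poly_def using e_pos by (subst degree_add_eq_left) (auto simp: degree_monom_eq)
  then have k0: "kummer_poly \<noteq> 0" using e_pos by auto
  have ev0: "ac_eval kummer_poly \<pi> = 0"
    by (simp add: kummer_poly_def ac_eval_monom \<pi>_power)
  show "ac_eval P \<pi> = 0" if "kummer_poly dvd P"
    using that ev0 by (auto elim!: dvdE)
  assume "ac_eval P \<pi> = 0"
  then have "ac_eval (P mod kummer_poly) \<pi> = 0"
    using ac_eval_div_mod[of P \<pi> kummer_poly] ev0 by simp
  then show "kummer_poly dvd P"
    using ac_eval_\<pi>_nonzero[of "P mod kummer_poly"] degree_mod_less[OF k0, of P] deg
    by (auto simp: mod_eq_0_iff_dvd)
qed

text \<open>Such a \<open>P\<close> is a multiple of \<open>kummer_poly\<close>, which vanishes at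
  every conjugate. This makes substituting a conjugate well defined on values at
  \<open>\<pi>\<close>.\<close>

lemma ac_eval_conjugate_0:
  assumes "ac_eval P \<pi> = 0" shows "ac_eval P (to_ac (w ^ k) * \<pi>) = 0"
proof -
  have "to_ac (w ^ k) ^ e = 1"
    by (metis mult.commute power_mult power_one to_ac_1 to_ac_power w_root)
  then have "ac_eval kummer_poly (to_ac (w ^ k) * \<pi>) = 0"
    by (simp add: kummer_poly_def ac_eval_monom \<pi>_power power_mult_distrib del: to_ac_power)
  then show ?thesis using assms by (auto simp: kummer_dvd_iff elim!: dvdE)
qed

lemma ac_eval_conjugate_cong:
  assumes "ac_eval P \<pi> = ac_eval Q \<pi>"
  shows "ac_eval P (to_ac (w ^ k) * \<pi>) = ac_eval Q (to_ac (w ^ k) * \<pi>)"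
  using ac_eval_conjugate_0[of "P - Q" k] assms by (simp del: to_ac_power)

section \<open>Conjugates and norms at the level of polynomials\<close>

definition conjugate :: "nat \<Rightarrow> 'a poly \<Rightarrow> 'a poly" where
  "conjugate k P = pcompose P [:0, w ^ k:]"

lemma ac_eval_conjugate: "ac_eval (conjugate k P) x = ac_eval P (to_ac (w ^ k) * x)"
  by (simp add: conjugate_def ac_eval_pcompose mult.commute)

lemma conjugate_0 [simp]: "conjugate 0 P = P"
  by (simp add: conjugate_def)

definition norm_poly :: "'a poly \<Rightarrow> 'a poly" where
  "norm_poly P = (\<Prod>k<e. conjugate k P)"

definition integral_poly :: "'a poly \<Rightarrow> bool" where
  "integral_poly P \<longleftrightarrow> (\<forall>i. Polynomial.coeff P i \<in> integers v)"

lemma integral_poly_0 [simp, intro]: "integral_poly 0"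
  by (simp add: integral_poly_def)

lemma integral_poly_1 [simp, intro]: "integral_poly 1"
  by (simp add: integral_poly_def)

lemma integral_poly_pCons [simp]:
  "integral_poly (pCons a P) \<longleftrightarrow> a \<in> integers v \<and> integral_poly P"
  unfolding integral_poly_def by (metis coeff_pCons_0 coeff_pCons_Suc old.nat.exhaust)

lemma integral_poly_add [intro]: "integral_poly P \<Longrightarrow> integral_poly Q \<Longrightarrow> integral_poly (P + Q)"
  by (auto simp: integral_poly_def)

lemma integral_poly_minus [intro]: "integral_poly P \<Longrightarrow> integral_poly (- P)"
  by (auto simp: integral_poly_def)

lemma integral_poly_diff [intro]: "integral_poly P \<Longrightarrow> integral_poly Q \<Longrightarrow> integral_poly (P - Q)"
  by (auto simp: integral_poly_def)

lemma integral_poly_smult [intro]: "a \<in> integers v \<Longrightarrow> integral_poly P \<Longrightarrow> integral_poly (smult a P)"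
  by (auto simp: integral_poly_def)

lemma integral_poly_mult [intro]: "integral_poly P \<Longrightarrow> integral_poly Q \<Longrightarrow> integral_poly (P * Q)"
  by (auto simp: integral_poly_def coeff_mult intro!: integers_sum)

lemma integral_poly_prod: "(\<And>i. i \<in> A \<Longrightarrow> integral_poly (f i)) \<Longrightarrow> integral_poly (prod f A)"
  by (induction A rule: infinite_finite_induct) auto

lemma integral_poly_power [intro]: "integral_poly P \<Longrightarrow> integral_poly (P ^ n)"
  by (induction n) auto

lemma integral_poly_conjugate [intro]: "integral_poly P \<Longrightarrow> integral_poly (conjugate k P)"
  using unit_integers[OF unit_w]
  by (auto simp: integral_poly_def conjugate_def coeff_pcompose_linear)

lemma coeff_conjugate_0 [simp]: "Polynomial.coeff (conjugate k P) 0 = Polynomial.coeff P 0"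
  by (simp add: conjugate_def poly_0_coeff_0)

lemma conjugate_prod: "conjugate k (prod f A) = (\<Prod>i\<in>A. conjugate k (f i))"
  by (simp add: conjugate_def pcompose_prod)

lemma conjugate_conjugate: "conjugate j (conjugate k P) = conjugate (k + j) P"
  by (simp add: conjugate_def pcompose_pCons power_add flip: pcompose_assoc)

text \<open>The index is cyclic of period \<open>e\<close>, so a shift by one permutes the factors.
  The general monoid covers both the norm and the characteristic polynomial, whose factors are
  polynomials over polynomials.\<close>

lemma prod_conjugate_shift:
  fixes f :: "nat \<Rightarrow> 'b::comm_monoid_mult"
  assumes "f e = f 0" shows "(\<Prod>k<e. f (Suc k)) = (\<Prod>k<e. f k)"
proof -
  obtain m where m: "e = Suc m" using e_pos by (cases e) auto
  have "(\<Prod>k<Suc m. f k) = f 0 * (\<Prod>k<m. f (Suc k))"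
    by (rule prod.lessThan_Suc_shift)
  then show ?thesis using assms by (simp add: m mult.commute)
qed

lemma conjugate_e: "conjugate e P = P"
  by (simp add: conjugate_def w_root)

lemma conjugate_norm_poly: "conjugate 1 (norm_poly P) = norm_poly P"
proof -
  have "conjugate 1 (norm_poly P) = (\<Prod>k<e. conjugate (Suc k) P)"
    by (simp add: norm_poly_def conjugate_prod conjugate_conjugate)
  then show ?thesis
    using prod_conjugate_shift[of "\<lambda>k. conjugate k P"] by (simp add: norm_poly_def conjugate_e)
qed

lemma integral_norm_poly: "integral_poly P \<Longrightarrow> integral_poly (norm_poly P)"
  by (auto simp: norm_poly_def intro: integral_poly_prod)

lemma coeff_prod_0: "Polynomial.coeff (prod f A) 0 = (\<Prod>i\<in>A. Polynomial.coeff (f i) 0)"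
  by (induction A rule: infinite_finite_induct) (auto simp: coeff_mult_0)

lemma coeff_norm_poly_0: "Polynomial.coeff (norm_poly P) 0 = Polynomial.coeff P 0 ^ e"
  by (simp add: norm_poly_def coeff_prod_0)

text \<open>
  A polynomial invariant under \<open>X \<mapsto> w X\<close> is a polynomial in \<open>X\<^sup>e\<close>; its value at
  \<open>\<pi>\<close> is computed from \<open>\<pi>\<^sup>e = - c\<close>.
\<close>

definition value_in_base :: "'a poly \<Rightarrow> 'a" where
  "value_in_base R =
     (\<Sum>i\<le>Polynomial.degree R. if e dvd i then Polynomial.coeff R i * (- c) ^ (i div e) else 0)"

lemma ac_eval_conjugate_invariant:
  assumes "conjugate 1 R = R" shows "ac_eval R \<pi> = to_ac (value_in_base R)"
proof -
  have "to_ac (Polynomial.coeff R i) * \<pi> ^ i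
      = to_ac (if e dvd i then Polynomial.coeff R i * (- c) ^ (i div e) else 0)" for i
  proof (cases "e dvd i")
    case True
    then have "\<pi> ^ i = (\<pi> ^ e) ^ (i div e)" by (simp flip: power_mult)
    then show ?thesis using True by (simp add: \<pi>_power)
  next
    case False
    then have "Polynomial.coeff R i = 0"
      using arg_cong[OF assms, of "\<lambda>p. Polynomial.coeff p i"]
      by (simp add: conjugate_def coeff_pcompose_linear w_power_eq_1_iff)
    then show ?thesis using False by simp
  qed
  then show ?thesis
    by (simp only: ac_eval_sum_coeff[OF order_refl] value_in_base_def to_ac_sum)
qed

lemma c_prime_ideal: "c \<in> prime_ideal v"
  by (simp add: prime_ideal_iff val_ge_def v_c)

text \<open>Every term except the constant one carries a positive power of \<open>c\<close>, which
  has valuation 1.\<close>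

lemma value_in_base_rescong:
  assumes "integral_poly R" shows "rescong (value_in_base R) (Polynomial.coeff R 0)"
proof -
  let ?f = "\<lambda>i. if e dvd i then Polynomial.coeff R i * (- c) ^ (i div e) else 0"
  have c: "- c \<in> prime_ideal v" using c_prime_ideal by blast
  have "?f i \<in> prime_ideal v" if "i > 0" for i
  proof (cases "e dvd i")
    case True
    then have "i div e \<noteq> 0" using that by (auto simp: dvd_div_eq_0_iff)
    then obtain j where j: "i div e = Suc j" using not0_implies_Suc by blast
    have "Polynomial.coeff R i * ((- c) ^ j * (- c)) \<in> prime_ideal v"
      using c assms prime_ideal_subset unfolding integral_poly_def by blast
    then show ?thesis using True j by (simp add: mult.commute)
  qed auto
  then have "(\<Sum>i\<in>{..Polynomial.degree R} - {0}. ?f i) \<in> prime_ideal v"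
    by (intro prime_ideal_sum) auto
  moreover have "value_in_base R = ?f 0 + (\<Sum>i\<in>{..Polynomial.degree R} - {0}. ?f i)"
    unfolding value_in_base_def by (subst sum.remove[of _ 0]) auto
  ultimately show ?thesis by (simp add: rescong_def)
qed

lemma value_in_base_integers:
  assumes "integral_poly R" shows "value_in_base R \<in> integers v"
  using rescong_integers[OF value_in_base_rescong[OF assms]] assms by (simp add: integral_poly_def)

text \<open>The norm as an explicit element of the base field, computed from coefficients so that
  its residue is visible; agreement with \<open>field_norm\<close> follows once the embeddings are
  known.\<close>

definition ext_norm :: "'a poly \<Rightarrow> 'a" where
  "ext_norm P = value_in_base (norm_poly P)"

lemma to_ac_ext_norm: "to_ac (ext_norm P) = (\<Prod>k<e. ac_eval P (to_ac (w ^ k) * \<pi>))"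
  using ac_eval_conjugate_invariant[OF conjugate_norm_poly, of P]
  by (simp add: ext_norm_def norm_poly_def ac_eval_prod ac_eval_conjugate del: to_ac_power)

lemma ext_norm_rescong:
  "integral_poly P \<Longrightarrow> rescong (ext_norm P) (Polynomial.coeff P 0 ^ e)"
  using value_in_base_rescong[OF integral_norm_poly, of P] by (simp add: ext_norm_def coeff_norm_poly_0)

lemma ext_norm_nonzero:
  assumes "ac_eval P \<pi> \<noteq> 0" shows "ext_norm P \<noteq> 0"
proof -
  have "ac_eval P (to_ac (w ^ k) * \<pi>) \<noteq> 0" if "k < e" for k
  proof
    assume "ac_eval P (to_ac (w ^ k) * \<pi>) = 0"
    then have "ac_eval (conjugate (e - k) (conjugate k P)) \<pi> = 0"
      using ac_eval_conjugate_0[of "conjugate k P" "e - k"] by (simp add: ac_eval_conjugate del: to_ac_power)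
    then show False using assms that by (simp add: conjugate_conjugate conjugate_e)
  qed
  then have "to_ac (ext_norm P) \<noteq> 0" by (auto simp: to_ac_ext_norm simp del: to_ac_power)
  then show ?thesis by auto
qed

text \<open>The product of the nontrivial conjugates. Divided by the norm it represents the inverse,
  with control over integrality.\<close>

definition cofactor :: "'a poly \<Rightarrow> 'a poly" where
  "cofactor P = (\<Prod>k\<in>{1..<e}. conjugate k P)"

lemma norm_poly_cofactor: "norm_poly P = P * cofactor P"
proof -
  have "{..<e} = insert 0 {1..<e}" using e_pos by auto
  then show ?thesis by (simp add: norm_poly_def cofactor_def)
qed

lemma ac_eval_mult_cofactor: "ac_eval P \<pi> * ac_eval (cofactor P) \<pi> = to_ac (ext_norm P)"
  using ac_eval_conjugate_invariant[OF conjugate_norm_poly, of P]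
  by (simp add: ext_norm_def norm_poly_cofactor)

lemma ac_eval_inverse:
  assumes "ac_eval P \<pi> \<noteq> 0"
  shows "inverse (ac_eval P \<pi>) = ac_eval (smult (inverse (ext_norm P)) (cofactor P)) \<pi>"
proof (rule inverse_unique)
  show "ac_eval P \<pi> * ac_eval (smult (inverse (ext_norm P)) (cofactor P)) \<pi> = 1"
    using ac_eval_mult_cofactor[of P] ext_norm_nonzero[OF assms] by (simp add: field_simps)
qed

lemma ext_closed [simp, intro]:
  "to_ac a \<in> ext" "\<pi> \<in> ext" "0 \<in> ext" "1 \<in> ext"
  "x \<in> ext \<Longrightarrow> y \<in> ext \<Longrightarrow> x + y \<in> ext" "x \<in> ext \<Longrightarrow> y \<in> ext \<Longrightarrow> x * y \<in> ext"
  "x \<in> ext \<Longrightarrow> - x \<in> ext" "x \<in> ext \<Longrightarrow> y \<in> ext \<Longrightarrow> x - y \<in> ext"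
  "x \<in> ext \<Longrightarrow> inverse x \<in> ext"
proof -
  show "to_ac a \<in> ext" unfolding ext_def by (rule range_eqI[of _ _ "[:a:]"]) simp
  show "\<pi> \<in> ext" unfolding ext_def by (rule range_eqI[of _ _ "[:0, 1:]"]) simp
  show z: "0 \<in> ext" unfolding ext_def by (rule range_eqI[of _ _ 0]) simp
  show "1 \<in> ext" unfolding ext_def by (rule range_eqI[of _ _ 1]) simp
  show "x + y \<in> ext" if "x \<in> ext" "y \<in> ext" using that by (auto simp: ext_def simp flip: ac_eval_add)
  show "x - y \<in> ext" if "x \<in> ext" "y \<in> ext" using that by (auto simp: ext_def simp flip: ac_eval_diff)
  show "x * y \<in> ext" if "x \<in> ext" "y \<in> ext" using that by (auto simp: ext_def simp flip: ac_eval_mult)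
  show "- x \<in> ext" if "x \<in> ext" using that by (auto simp: ext_def simp flip: ac_eval_minus)
  show "inverse x \<in> ext" if "x \<in> ext"
  proof (cases "x = 0")
    case False
    with that show ?thesis unfolding ext_def using ac_eval_inverse by blast
  qed (use z in simp)
qed

lemma ext_power_int [intro]: "x \<in> ext \<Longrightarrow> x powi n \<in> ext"
proof -
  assume x: "x \<in> ext"
  have "y ^ m \<in> ext" if "y \<in> ext" for y and m :: nat using that by (induction m) auto
  then show ?thesis using x by (cases n rule: int_cases3) (auto simp: power_int_minus)
qed

end

lemma map_poly_mult:
  fixes h :: "'b::comm_ring_1 \<Rightarrow> 'c::comm_ring_1"
  assumes "h 0 = 0" "\<And>x y. h (x + y) = h x + h y" "\<And>x y. h (x * y) = h x * h y"
  shows "map_poly h (p * q) = map_poly h p * map_poly h q"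
proof -
  have "h (sum f A) = (\<Sum>i\<in>A. h (f i))" for f and A :: "nat set"
    using assms by (induction A rule: infinite_finite_induct) auto
  then show ?thesis using assms by (intro poly_eqI) (simp add: coeff_map_poly coeff_mult)
qed

lemma map_poly_prod:
  fixes h :: "'b::comm_ring_1 \<Rightarrow> 'c::comm_ring_1"
  assumes "h 0 = 0" "h 1 = 1" "\<And>x y. h (x + y) = h x + h y" "\<And>x y. h (x * y) = h x * h y"
  shows "map_poly h (prod f A) = (\<Prod>i\<in>A. map_poly h (f i))"
  by (induction A rule: infinite_finite_induct) (use assms in \<open>auto simp: map_poly_mult\<close>)

lemma ac_eval_sum: "ac_eval (sum f A) x = (\<Sum>i\<in>A. ac_eval (f i) x)"
  by (induction A rule: infinite_finite_induct) auto

lemma to_ac_power_int [simp]: "to_ac (a powi n) = to_ac a powi n"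
  by (cases n rule: int_cases3) (auto simp: power_int_minus)

section \<open>Splitting field, embeddings and field norm\<close>

context tame_extension
begin

text \<open>Since \<open>w\<close> lies in the base field, one root generates all the others, and
  \<open>ext\<close> is already closed under the field operations.\<close>

lemma splitting_field_kummer: "splitting_field kummer_poly = ext"
proof -
  let ?R = "ring_of_type_algebra :: 'a alg_closure ring"
  let ?H = "range to_ac \<union> {x. poly (map_poly to_ac kummer_poly) x = 0}"
  interpret R: field ?R by rule
  have neg: "\<ominus>\<^bsub>?R\<^esub> x = - x" for x
    by (rule R.minus_equality) (auto simp: ring_of_type_algebra_def)
  have inv: "inv\<^bsub>?R\<^esub> x = inverse x" if "x \<noteq> 0" for x
    using that by (intro R.comm_inv_char) (auto simp: ring_of_type_algebra_def)
  have root: "x \<in> ext" if "ac_eval kummer_poly x = 0" for x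
  proof -
    have "x ^ e = \<pi> ^ e"
      using that by (simp add: kummer_poly_def ac_eval_monom \<pi>_power eq_neg_iff_add_eq_0)
    then show ?thesis by (metis root_eq_w_power ext_closed(1,2,6))
  qed
  have "generate_field ?R ?H \<subseteq> ext"
  proof
    fix x assume "x \<in> generate_field ?R ?H"
    then show "x \<in> ext"
    proof (induction rule: generate_field.induct)
      case (incl h)
      then show ?case using root by (auto simp: ac_eval_def)
    next
      case (m_inv h)
      then show ?case using inv[of h] by (simp add: ring_of_type_algebra_def)
    qed (auto simp: neg, auto simp: ring_of_type_algebra_def)
  qed
  \<comment> \<open>Conversely, Horner's rule builds every value from constants and
    \<open>\<pi>\<close>.\<close>
  moreover have "ac_eval P \<pi> \<in> generate_field ?R ?H" for P
  proof (induction P)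
    case 0
    have "to_ac 0 \<in> generate_field ?R ?H" by (rule generate_field.incl) blast
    then show ?case by simp
  next
    case (pCons a P)
    have "\<pi> \<in> generate_field ?R ?H"
      by (rule generate_field.incl)
         (simp flip: ac_eval_def, simp add: kummer_poly_def ac_eval_monom \<pi>_power)
    moreover have "to_ac a \<in> generate_field ?R ?H" by (rule generate_field.incl) blast
    ultimately have "to_ac a \<oplus>\<^bsub>?R\<^esub> (\<pi> \<otimes>\<^bsub>?R\<^esub> ac_eval P \<pi>) \<in> generate_field ?R ?H"
      using pCons by (intro generate_field.eng_add generate_field.eng_mult)
    then show ?case by (simp add: ring_of_type_algebra_def)
  qed
  ultimately show ?thesis unfolding splitting_field_def by (auto simp: ext_def)
qed

text \<open>The choice of \<open>P\<close> is harmless, because polynomials agreeing at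
  \<open>\<pi>\<close> agree at its conjugates. The restriction to \<open>ext\<close> makes the map
  extensional, as \<open>embeddings\<close> demands.\<close>

definition \<sigma> :: "nat \<Rightarrow> 'a alg_closure \<Rightarrow> 'a alg_closure" where
  "\<sigma> k = (\<lambda>x\<in>ext. ac_eval (SOME P. x = ac_eval P \<pi>) (to_ac (w ^ k) * \<pi>))"

lemma \<sigma>_ac_eval: "\<sigma> k (ac_eval P \<pi>) = ac_eval P (to_ac (w ^ k) * \<pi>)"
proof -
  have "ac_eval P \<pi> = ac_eval (SOME Q. ac_eval P \<pi> = ac_eval Q \<pi>) \<pi>"
    by (rule someI[of _ P]) simp
  from ac_eval_conjugate_cong[OF this, of k, symmetric] show ?thesis
    unfolding \<sigma>_def ext_def by (simp only: restrict_apply, simp)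
qed

text \<open>An embedding is determined by the image of \<open>\<pi>\<close>, which is again a root
  of \<open>kummer_poly\<close> and hence a power of \<open>w\<close> times
  \<open>\<pi>\<close>.\<close>

lemma embeddings_ext: "embeddings ext = \<sigma> ` {..<e}"
proof
  show "\<sigma> ` {..<e} \<subseteq> embeddings ext"
  proof clarify
    fix k
    have "\<sigma> k (x + y) = \<sigma> k x + \<sigma> k y" "\<sigma> k (x * y) = \<sigma> k x * \<sigma> k y"
      if xy: "x \<in> ext" "y \<in> ext" for x y
    proof -
      obtain P Q where "x = ac_eval P \<pi>" "y = ac_eval Q \<pi>" using xy unfolding ext_def by blast
      then show "\<sigma> k (x + y) = \<sigma> k x + \<sigma> k y" "\<sigma> k (x * y) = \<sigma> k x * \<sigma> k y"
        by (simp_all add: \<sigma>_ac_eval del: to_ac_power flip: ac_eval_add ac_eval_mult)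
    qed
    moreover have "\<sigma> k 1 = 1" using \<sigma>_ac_eval[of k 1] by simp
    moreover have "\<sigma> k (to_ac a) = to_ac a" for a using \<sigma>_ac_eval[of k "[:a:]"] by simp
    ultimately show "\<sigma> k \<in> embeddings ext"
      by (auto simp: embeddings_def ring_hom_def ring_of_type_algebra_def \<sigma>_def)
  qed
  show "embeddings ext \<subseteq> \<sigma> ` {..<e}"
  proof
    fix \<tau> assume \<tau>: "\<tau> \<in> embeddings ext"
    have hom: "\<tau> (x + y) = \<tau> x + \<tau> y" "\<tau> (x * y) = \<tau> x * \<tau> y" if "x \<in> ext" "y \<in> ext" for x y
      using \<tau> that by (auto simp: embeddings_def ring_hom_def ring_of_type_algebra_def)
    have base: "\<tau> (to_ac a) = to_ac a" for a using \<tau> by (simp add: embeddings_def)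
    have eval: "\<tau> (ac_eval P \<pi>) = ac_eval P (\<tau> \<pi>)" for P
    proof (induction P)
      case 0
      then show ?case using base[of 0] by simp
    next
      case (pCons a P)
      have "ac_eval P \<pi> \<in> ext" by (simp add: ext_def)
      then show ?case using pCons by (simp add: hom base)
    qed
    have "ac_eval kummer_poly (\<tau> \<pi>) = \<tau> 0"
      unfolding eval[symmetric] by (simp add: kummer_poly_def ac_eval_monom \<pi>_power)
    then have "(\<tau> \<pi>) ^ e = \<pi> ^ e"
      using base[of 0] by (simp add: kummer_poly_def ac_eval_monom \<pi>_power eq_neg_iff_add_eq_0)
    then obtain k where k: "k < e" "\<tau> \<pi> = to_ac (w ^ k) * \<pi>" by (rule root_eq_w_power)
    have "\<tau> x = \<sigma> k x" for x
    proof (cases "x \<in> ext")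
      case True
      then obtain P where "x = ac_eval P \<pi>" unfolding ext_def by blast
      then show ?thesis by (simp only: eval k \<sigma>_ac_eval)
    next
      case False
      then show ?thesis using \<tau> by (simp add: embeddings_def extensional_def \<sigma>_def)
    qed
    then show "\<tau> \<in> \<sigma> ` {..<e}" using k(1) by auto
  qed
qed

lemma inj_on_\<sigma>: "inj_on \<sigma> {..<e}"
proof (rule linorder_inj_onI)
  fix i j assume ij: "i < j" "i \<in> {..<e}" "j \<in> {..<e}"
  show "\<sigma> i \<noteq> \<sigma> j"
  proof
    assume "\<sigma> i = \<sigma> j"
    then have "to_ac (w ^ i) * \<pi> = to_ac (w ^ j) * \<pi>"
      using \<sigma>_ac_eval[of _ "[:0, 1:]"] by (metis ac_eval_0 ac_eval_pCons add_0 mult_zero_right to_ac_0 to_ac_1 mult_1_right add.right_neutral)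
    then have "to_ac (w ^ i) = to_ac (w ^ j)" by (simp only: mult_cancel_right \<pi>_nonzero) simp
    then have "w ^ i = w ^ j" by (simp only: to_ac_eq_iff)
    moreover have "w ^ j = w ^ i * w ^ (j - i)" using ij by (simp flip: power_add)
    ultimately have "w ^ (j - i) = 1" by simp
    moreover have "0 < j - i" "j - i < e" using ij by auto
    ultimately show False using w_primitive[of "j - i"] by auto
  qed
qed auto

lemma finite_embeddings: "finite (embeddings ext)"
  by (simp add: embeddings_ext)

lemma embedding_nonzero:
  assumes "\<tau> \<in> embeddings ext" "x \<in> ext" shows "\<tau> x = 0 \<longleftrightarrow> x = 0"
proof -
  have mult: "\<tau> (x * y) = \<tau> x * \<tau> y" if "x \<in> ext" "y \<in> ext" for x y
    using assms that by (auto simp: embeddings_def ring_hom_def ring_of_type_algebra_def)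
  have base: "\<tau> (to_ac a) = to_ac a" for a using assms by (simp add: embeddings_def)
  show ?thesis
    using mult[OF assms(2) ext_closed(9)[OF assms(2)]] base[of 0] base[of 1] by (cases "x = 0") auto
qed

text \<open>Resolves the definite description in \<open>field_norm\<close>: the product of the
  conjugates does lie in the base field.\<close>

lemma field_norm_ac_eval: "field_norm ext (ac_eval P \<pi>) = ext_norm P"
proof -
  have "(\<Prod>\<sigma>\<in>embeddings ext. \<sigma> (ac_eval P \<pi>)) = to_ac (ext_norm P)"
    unfolding embeddings_ext to_ac_ext_norm
    by (subst prod.reindex[OF inj_on_\<sigma>]) (simp add: \<sigma>_ac_eval)
  then show ?thesis unfolding field_norm_def by (intro the_equality) auto
qed

lemma field_norm_mult:
  assumes "x \<in> ext" "y \<in> ext" shows "field_norm ext (x * y) = field_norm ext x * field_norm ext y"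
proof -
  obtain P Q where PQ: "x = ac_eval P \<pi>" "y = ac_eval Q \<pi>" using assms unfolding ext_def by blast
  have "to_ac (ext_norm (P * Q)) = to_ac (ext_norm P * ext_norm Q)"
    by (simp add: to_ac_ext_norm prod.distrib del: to_ac_power)
  then have "ext_norm (P * Q) = ext_norm P * ext_norm Q" by (simp only: to_ac_eq_iff)
  then show ?thesis by (simp add: PQ field_norm_ac_eval flip: ac_eval_mult)
qed

lemma field_norm_to_ac: "field_norm ext (to_ac a) = a ^ e"
proof -
  have "to_ac (ext_norm [:a:]) = to_ac (a ^ e)" by (simp add: to_ac_ext_norm)
  then show ?thesis using field_norm_ac_eval[of "[:a:]"] by (simp del: to_ac_power)
qed

lemma field_norm_1 [simp]: "field_norm ext 1 = 1"
  using field_norm_to_ac[of 1] by simp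

lemma field_norm_nonzero: "x \<in> ext \<Longrightarrow> x \<noteq> 0 \<Longrightarrow> field_norm ext x \<noteq> 0"
proof -
  assume "x \<in> ext" "x \<noteq> 0"
  then obtain P where "x = ac_eval P \<pi>" "ac_eval P \<pi> \<noteq> 0" unfolding ext_def by blast
  then show ?thesis using ext_norm_nonzero by (simp add: field_norm_ac_eval)
qed

text \<open>The sign from the product of the powers of \<open>w\<close> cancels the one in
  \<open>\<pi> ^ e = - c\<close>.\<close>

lemma field_norm_\<pi>: "field_norm ext \<pi> = c"
proof -
  have "to_ac (ext_norm [:0, 1:]) = to_ac (\<Prod>k<e. w ^ k) * \<pi> ^ e"
    by (simp add: to_ac_ext_norm prod.distrib to_ac_prod)
  also have "\<dots> = to_ac c" by (simp add: prod_w \<pi>_power)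
  finally show ?thesis using field_norm_ac_eval[of "[:0, 1:]"] by simp
qed

lemma field_norm_inverse: "x \<in> ext \<Longrightarrow> x \<noteq> 0 \<Longrightarrow> field_norm ext (inverse x) = inverse (field_norm ext x)"
proof (rule inverse_unique[symmetric])
  assume "x \<in> ext" "x \<noteq> 0"
  then show "field_norm ext x * field_norm ext (inverse x) = 1"
    using field_norm_mult[of x "inverse x"] by simp
qed

lemma field_norm_power: "x \<in> ext \<Longrightarrow> x ^ n \<in> ext \<and> field_norm ext (x ^ n) = field_norm ext x ^ n"
  by (induction n) (auto simp: field_norm_mult)

lemma field_norm_power_int:
  "x \<in> ext \<Longrightarrow> x \<noteq> 0 \<Longrightarrow> field_norm ext (x powi n) = field_norm ext x powi n"
  by (cases n rule: int_cases3) (auto simp: field_norm_power field_norm_inverse power_int_minus)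

text \<open>\<open>has_lead x n a\<close> says that \<open>x = \<pi>\<^sup>n u\<close> where \<open>u\<close> is a unit with residue class that of \<open>a\<close>.\<close>

definition has_lead :: "'a alg_closure \<Rightarrow> int \<Rightarrow> 'a \<Rightarrow> bool" where
  "has_lead x n a \<longleftrightarrow> unit a \<and>
     (\<exists>P. integral_poly P \<and> rescong (Polynomial.coeff P 0) a \<and> x = \<pi> powi n * ac_eval P \<pi>)"

text \<open>The norm of the value is 0 and congruent to the \<open>e\<close>-th power of the
  constant coefficient, which is therefore no unit. Applied to differences, this makes residues
  independent of the representing polynomial.\<close>

lemma vanishing_coeff_0:
  assumes "integral_poly D" "ac_eval D \<pi> = 0" shows "Polynomial.coeff D 0 \<in> prime_ideal v"
proof -
  have "ext_norm D = 0" using field_norm_ac_eval[of D] field_norm_to_ac[of 0] e_pos assms by simp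
  then have "rescong (Polynomial.coeff D 0 ^ e) 0"
    using ext_norm_rescong[OF assms(1)] rescong_sym by auto
  then have "\<not> unit (Polynomial.coeff D 0)"
    using unit_closed(5)[of "Polynomial.coeff D 0" e] by (auto simp: rescong_0_iff unit_iff)
  then show ?thesis using assms(1) by (auto simp: unit_iff integral_poly_def)
qed

lemma ac_eval_eq_rescong:
  assumes "integral_poly P" "integral_poly Q" "ac_eval P \<pi> = ac_eval Q \<pi>"
  shows "rescong (Polynomial.coeff P 0) (Polynomial.coeff Q 0)"
  using vanishing_coeff_0[of "P - Q"] assms by (auto simp: rescong_def)

text \<open>The power of \<open>\<pi>\<close> contributes the same power of its norm
  \<open>c\<close>, and the unit part contributes a norm congruent to the \<open>e\<close>-th power
  of its residue. This is the form in which norm conditions are exploited.\<close>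

lemma has_lead_norm:
  assumes "has_lead x n a"
  obtains u where "field_norm ext x = c powi n * u" "rescong u (a ^ e)" "unit u"
    "x \<in> ext" "x \<noteq> 0"
proof -
  obtain P where P: "integral_poly P" "rescong (Polynomial.coeff P 0) a" "x = \<pi> powi n * ac_eval P \<pi>"
    and a: "unit a" using assms by (auto simp: has_lead_def)
  have "rescong (ext_norm P) (a ^ e)"
    using ext_norm_rescong[OF P(1)] rescong_power[OF P(2), of e] unit_integers[OF a] rescong_trans by blast
  moreover have "unit (ext_norm P)" using calculation a rescong_unit by blast
  moreover have "ac_eval P \<pi> \<noteq> 0"
    using vanishing_coeff_0[OF P(1)] rescong_unit[OF P(2) a] by (auto simp: unit_iff)
  moreover have "ac_eval P \<pi> \<in> ext" by (simp add: ext_def)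
  moreover have "field_norm ext x = c powi n * ext_norm P"
    using P(3) calculation(4) by (subst P(3), subst field_norm_mult)
      (auto simp: field_norm_power_int field_norm_\<pi> field_norm_ac_eval)
  ultimately show ?thesis using that[of "ext_norm P"] P(3) by auto
qed

lemma v_field_norm: "has_lead x n a \<Longrightarrow> v (field_norm ext x) = n"
  by (elim has_lead_norm) (simp add: v_mult v_power_int c_nonzero v_c unit_def)

text \<open>The exponent is recovered as the valuation of the norm; once the power of
  \<open>\<pi>\<close> is cancelled, equal values have congruent constant coefficients.\<close>

lemma has_lead_unique:
  assumes "has_lead x n a" "has_lead x m b" shows "n = m" "rescong a b"
proof -
  show nm: "n = m" using assms v_field_norm by metis
  obtain P Q where PQ: "integral_poly P" "rescong (Polynomial.coeff P 0) a" "x = \<pi> powi n * ac_eval P \<pi>"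
    "integral_poly Q" "rescong (Polynomial.coeff Q 0) b" "x = \<pi> powi m * ac_eval Q \<pi>"
    using assms by (auto simp: has_lead_def)
  then have "ac_eval P \<pi> = ac_eval Q \<pi>" using nm by auto
  then show "rescong a b" using PQ ac_eval_eq_rescong rescong_trans rescong_sym by meson
qed

lemma has_lead_mult:
  assumes "has_lead x n a" "has_lead y m b" shows "has_lead (x * y) (n + m) (a * b)"
proof -
  obtain P Q where PQ: "integral_poly P" "rescong (Polynomial.coeff P 0) a" "x = \<pi> powi n * ac_eval P \<pi>"
    "integral_poly Q" "rescong (Polynomial.coeff Q 0) b" "y = \<pi> powi m * ac_eval Q \<pi>"
    and u: "unit a" "unit b" using assms by (auto simp: has_lead_def)
  have "x * y = \<pi> powi (n + m) * ac_eval (P * Q) \<pi>" using PQ by (simp add: power_int_add)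
  moreover have "rescong (Polynomial.coeff (P * Q) 0) (a * b)"
    using PQ u unit_integers by (simp add: coeff_mult_0 rescong_mult)
  ultimately show ?thesis using PQ(1,4) u unfolding has_lead_def by blast
qed

text \<open>The inverse of the unit part is its cofactor divided by its norm. That norm is a unit,
  so the representing polynomial stays integral.\<close>

lemma has_lead_inverse:
  assumes "has_lead x n a" shows "has_lead (inverse x) (- n) (inverse a)"
proof -
  obtain P where P: "integral_poly P" "rescong (Polynomial.coeff P 0) a" "x = \<pi> powi n * ac_eval P \<pi>"
    and a: "unit a" using assms by (auto simp: has_lead_def)
  let ?N = "ext_norm P" and ?p = "Polynomial.coeff P 0" and ?C = "cofactor P"
  have up: "unit ?p" using P(2) a rescong_unit by blast
  have N: "rescong ?N (?p ^ e)" using ext_norm_rescong[OF P(1)] .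
  then have uN: "unit ?N" using up rescong_unit by blast
  have nz: "ac_eval P \<pi> \<noteq> 0" using vanishing_coeff_0[OF P(1)] up by (auto simp: unit_iff)
  have C: "integral_poly ?C" using P(1) by (auto simp: cofactor_def intro: integral_poly_prod)
  let ?Q = "smult (inverse ?N) ?C"
  have "?p * Polynomial.coeff ?C 0 = ?p ^ e"
    using coeff_norm_poly_0[of P] by (simp add: norm_poly_cofactor coeff_mult_0)
  then have "rescong (?N * (?p * Polynomial.coeff ?Q 0)) (?N * 1)"
    using uN N rescong_sym unit_nonzero by (simp add: field_simps)
  then have "rescong (?p * Polynomial.coeff ?Q 0) (?p * inverse ?p)"
    using rescong_cancel[OF _ uN] unit_nonzero[OF up] by simp
  then have "rescong (Polynomial.coeff ?Q 0) (inverse a)"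
    using rescong_cancel[OF _ up] rescong_inverse[OF P(2) a] rescong_trans by blast
  moreover have "integral_poly ?Q" using C uN unit_integers by blast
  moreover have "inverse x = \<pi> powi (- n) * ac_eval ?Q \<pi>"
    using ac_eval_inverse[OF nz] by (simp add: P(3) power_int_minus)
  ultimately show ?thesis using a unfolding has_lead_def by blast
qed

lemma has_lead_to_ac: "unit a \<Longrightarrow> has_lead (to_ac a) 0 a"
  unfolding has_lead_def by (auto intro!: exI[of _ "[:a:]"] unit_integers)

lemma has_lead_\<pi>: "has_lead \<pi> 1 1"
  unfolding has_lead_def by (auto intro!: exI[of _ 1])

lemma has_lead_power:
  "has_lead x n a \<Longrightarrow> has_lead (x ^ k) (int k * n) (a ^ k)"
proof (induction k)
  case (Suc k)
  then show ?case using has_lead_mult[OF Suc.prems Suc.IH] by (simp add: algebra_simps)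
qed (use has_lead_to_ac[of 1] in simp)

text \<open>
  The terms \<open>a\<^sub>i \<pi>\<^sup>i\<close> with \<open>i < e\<close> have pairwise distinct valuations modulo \<open>e\<close>, so a
  single one is dominant.
\<close>

lemma has_lead_exists:
  assumes "x \<in> ext" "x \<noteq> 0" obtains n a where "has_lead x n a"
proof -
  obtain Q0 where Q0: "x = ac_eval Q0 \<pi>" using assms by (auto simp: ext_def)
  define Q where "Q = Q0 mod kummer_poly"
  have deg: "Polynomial.degree kummer_poly = e"
    unfolding kummer_poly_def using e_pos by (subst degree_add_eq_left) (auto simp: degree_monom_eq)
  then have "kummer_poly \<noteq> 0" using e_pos by auto
  have xQ: "x = ac_eval Q \<pi>"
    using Q0 ac_eval_div_mod[of Q0 \<pi> kummer_poly] kummer_dvd_iff[of kummer_poly] by (simp add: Q_def)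
  then have Q_nz: "Q \<noteq> 0" using assms by auto
  then have deg_Q: "Polynomial.degree Q < e"
    using degree_mod_less[OF \<open>kummer_poly \<noteq> 0\<close>, of Q0] deg by (simp add: Q_def)
  let ?a = "Polynomial.coeff Q"
  define S where "S = {i. ?a i \<noteq> 0}"
  \<comment> \<open>\<open>f i\<close> is the valuation of the \<open>i\<close>-th term, scaled so
    that \<open>\<pi>\<close> has valuation 1.\<close>
  define f where "f = (\<lambda>i. int e * v (?a i) + int i)"
  have S: "S \<subseteq> {..Polynomial.degree Q}" by (auto simp: S_def le_degree)
  then have finS: "finite S" using finite_subset by blast
  have S_nz: "S \<noteq> {}" using Q_nz by (auto simp: S_def poly_eq_iff)
  define n where "n = Min (f ` S)"
  have n_le: "n \<le> f i" if "i \<in> S" for i using that finS by (simp add: n_def)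
  obtain i0 where i0: "i0 \<in> S" "f i0 = n"
  proof -
    have "n \<in> f ` S" using finS S_nz unfolding n_def by (intro Min_in) auto
    then show ?thesis using that by blast
  qed
  have f_inj: "i = i0" if "i \<in> S" "f i = n" for i
  proof -
    have "i < e" "i0 < e" using that(1) i0(1) S deg_Q by auto
    moreover have "f i mod int e = int i mod int e" for i by (simp add: f_def)
    then have "int i mod int e = int i0 mod int e" using that(2) i0(2) by metis
    ultimately show ?thesis by simp
  qed
  \<comment> \<open>As \<open>- c\<close> is \<open>\<pi> ^ e\<close>, dividing a coefficient by its
    power of \<open>- c\<close> moves its valuation into the exponent of \<open>\<pi>\<close> and
    leaves a unit.\<close>
  define u where "u = (\<lambda>i. ?a i * (- c) powi (- v (?a i)))"
  have u: "unit (u i)" if "i \<in> S" for i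
    using that c_nonzero v_c by (simp add: S_def u_def unit_def v_mult v_power_int)
  define P where "P = (\<Sum>i\<in>S. Polynomial.monom (u i) (nat (f i - n)))"
  have coeff_P: "Polynomial.coeff P j = (\<Sum>i\<in>S. if nat (f i - n) = j then u i else 0)" for j
    by (simp add: P_def coeff_sum)
  have "integral_poly P"
    unfolding integral_poly_def coeff_P using u unit_integers by (auto intro!: integers_sum)
  moreover have "Polynomial.coeff P 0 = u i0"
  proof -
    have "Polynomial.coeff P 0 = (\<Sum>i\<in>S. if i = i0 then u i else 0)"
      unfolding coeff_P
    proof (intro sum.cong refl)
      fix i assume i: "i \<in> S"
      have "nat (f i - n) = 0 \<longleftrightarrow> f i = n" using n_le[OF i] by linarith
      also have "\<dots> \<longleftrightarrow> i = i0" using f_inj[OF i] i0(2) by blast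
      finally show "(if nat (f i - n) = 0 then u i else 0) = (if i = i0 then u i else 0)" by simp
    qed
    then show ?thesis using finS i0(1) by simp
  qed
  moreover have "x = \<pi> powi n * ac_eval P \<pi>"
  proof -
    have term_eq: "\<pi> powi n * (to_ac (u i) * \<pi> ^ nat (f i - n)) = to_ac (?a i) * \<pi> ^ i" if "i \<in> S" for i
    proof -
      have "to_ac ((- c) powi m) = \<pi> powi (int e * m)" for m
        by (simp add: power_int_mult \<pi>_power)
      then have "to_ac (u i) = to_ac (?a i) * \<pi> powi (- (int e * v (?a i)))"
        by (simp add: u_def del: to_ac_power_int)
      moreover have "\<pi> ^ nat (f i - n) = \<pi> powi (f i - n)"
        using n_le[OF that] by (simp add: power_int_def)
      moreover have "\<pi> powi n * (\<pi> powi (- (int e * v (?a i))) * \<pi> powi (f i - n)) = \<pi> powi (int i)"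
        by (simp add: f_def flip: power_int_add)
      ultimately show ?thesis by (simp add: algebra_simps)
    qed
    have "\<pi> powi n * ac_eval P \<pi> = (\<Sum>i\<in>S. to_ac (?a i) * \<pi> ^ i)"
      unfolding P_def ac_eval_sum sum_distrib_left ac_eval_monom by (intro sum.cong refl term_eq)
    also have "\<dots> = (\<Sum>i\<le>Polynomial.degree Q. to_ac (?a i) * \<pi> ^ i)"
      using S by (intro sum.mono_neutral_left) (auto simp: S_def)
    finally show ?thesis by (simp add: xQ ac_eval_sum_coeff)
  qed
  ultimately have "has_lead x n (u i0)" using u[OF i0(1)] unfolding has_lead_def by auto
  then show ?thesis by (rule that)
qed

end

section \<open>Integers, units and reduction of the extension\<close>

context tame_extension
begin

lemma integral_poly_sum: "(\<And>i. i \<in> A \<Longrightarrow> integral_poly (f i)) \<Longrightarrow> integral_poly (sum f A)"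
  by (induction A rule: infinite_finite_induct) auto

text \<open>\<open>M\<close> is the characteristic polynomial. Conjugation permutes the linear
  factors of \<open>F\<close>, so the coefficients of \<open>F\<close> are invariant and
  \<open>value_in_base\<close> moves them to the integers of the base field.\<close>

lemma char_poly_exists:
  assumes "integral_poly P"
  obtains M where "Polynomial.lead_coeff M = 1" "integral_poly M" "ac_eval M (ac_eval P \<pi>) = 0"
proof -
  define F :: "'a poly poly" where "F = (\<Prod>k<e. [:- conjugate k P, 1:])"
  have deg: "Polynomial.degree F = e" "Polynomial.lead_coeff F = 1"
  proof -
    show "Polynomial.degree F = e"
      unfolding F_def by (subst degree_prod_eq_sum_degree) auto
    show "Polynomial.lead_coeff F = 1"
      unfolding F_def by (simp add: lead_coeff_prod)
  qed
  define M where "M = map_poly value_in_base F"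
  have v0: "value_in_base 0 = 0" by (simp add: value_in_base_def)
  have v1: "value_in_base 1 = 1" by (simp add: value_in_base_def)
  have inv: "conjugate 1 (Polynomial.coeff F i) = Polynomial.coeff F i" for i
  proof -
    have "map_poly (conjugate 1) F = (\<Prod>k<e. map_poly (conjugate 1) [:- conjugate k P, 1:])"
      unfolding F_def
      by (intro map_poly_prod) (auto simp: conjugate_def pcompose_add pcompose_mult pcompose_1)
    also have "\<dots> = (\<Prod>k<e. [:- conjugate (Suc k) P, 1:])"
      using conjugate_conjugate[of 1]
      by (simp add: map_poly_pCons conjugate_def pcompose_1 pcompose_uminus)
    also have "\<dots> = F"
      using prod_conjugate_shift[of "\<lambda>k. [:- conjugate k P, 1:]"] by (simp add: F_def conjugate_e)
    finally have "Polynomial.coeff (map_poly (conjugate 1) F) i = Polynomial.coeff F i" by simp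
    then show ?thesis by (simp add: coeff_map_poly conjugate_def)
  qed
  have integral_F: "integral_poly (Polynomial.coeff (\<Prod>k\<in>K. [:- conjugate k P, 1:]) i)"
    if "finite K" for K i
    using that
  proof (induction K arbitrary: i)
    case empty
    show ?case by (cases i) (auto simp: one_pCons)
  next
    case (insert k K)
    have "Polynomial.coeff ([:- conjugate k P, 1:] * A) i =
      - conjugate k P * Polynomial.coeff A i + (case i of 0 \<Rightarrow> 0 | Suc j \<Rightarrow> Polynomial.coeff A j)" for A
      by (cases i) auto
    then show ?case using insert assms by (cases i) auto
  qed
  have "Polynomial.lead_coeff M = 1"
    unfolding M_def using deg v0 v1 by (simp add: lead_coeff_map_poly_nz)
  moreover have "integral_poly M"
    using integral_F[of "{..<e}"]
    unfolding M_def integral_poly_def[of "map_poly _ _"]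
    by (auto simp: coeff_map_poly v0 F_def intro!: value_in_base_integers)
  moreover have "map_poly to_ac M = map_poly (\<lambda>Q. ac_eval Q \<pi>) F"
    using ac_eval_conjugate_invariant[OF inv]
    by (intro poly_eqI) (simp add: M_def coeff_map_poly v0)
  then have "map_poly to_ac M = (\<Prod>k<e. [:- ac_eval (conjugate k P) \<pi>, 1:])"
    unfolding F_def by (subst (asm) map_poly_prod) (auto simp: map_poly_pCons)
  then have "ac_eval M (ac_eval P \<pi>) = 0"
    using e_pos by (auto simp: ac_eval_def[of M] poly_prod intro!: bexI[of _ 0])
  ultimately show ?thesis by (rule that)
qed

text \<open>One inclusion is the characteristic polynomial. For the other, an element with negative
  leading exponent has an inverse of positive exponent, which is incompatible with a monic integral
  equation.\<close>

lemma ext_integers_ext: "ext_integers v ext = {ac_eval P \<pi> | P. integral_poly P}"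
proof
  show "{ac_eval P \<pi> | P. integral_poly P} \<subseteq> ext_integers v ext"
  proof clarify
    fix P assume "integral_poly P"
    then obtain M where "Polynomial.lead_coeff M = 1" "integral_poly M" "ac_eval M (ac_eval P \<pi>) = 0"
      by (rule char_poly_exists)
    then show "ac_eval P \<pi> \<in> ext_integers v ext"
      unfolding ext_integers_def integral_poly_def by (auto simp: ext_def ac_eval_def[of M])
  qed
  show "ext_integers v ext \<subseteq> {ac_eval P \<pi> | P. integral_poly P}"
  proof
    fix x assume "x \<in> ext_integers v ext"
    then obtain M where x: "x \<in> ext" and M: "Polynomial.lead_coeff M = 1" "integral_poly M" "ac_eval M x = 0"
      unfolding ext_integers_def integral_poly_def ac_eval_def by blast
    show "x \<in> {ac_eval P \<pi> | P. integral_poly P}"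
    proof (cases "x = 0")
      case True
      then show ?thesis by (auto intro!: exI[of _ 0])
    next
      case False
      then obtain n a where lead: "has_lead x n a" using has_lead_exists x by blast
      show ?thesis
      proof (cases "n \<ge> 0")
        case True
        obtain P where "integral_poly P" "x = \<pi> powi n * ac_eval P \<pi>"
          using lead by (auto simp: has_lead_def)
        moreover have "integral_poly (Polynomial.monom 1 (nat n))"
          by (auto simp: integral_poly_def)
        ultimately have "integral_poly (Polynomial.monom 1 (nat n) * P)"
          "x = ac_eval (Polynomial.monom 1 (nat n) * P) \<pi>"
          using True by (auto simp: ac_eval_monom power_int_def)
        then show ?thesis by blast
      next
        case n: False
        obtain Q where Q: "integral_poly Q" "inverse x = \<pi> powi (- n) * ac_eval Q \<pi>"
          using has_lead_inverse[OF lead] by (auto simp: has_lead_def)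
        define R where "R = Polynomial.monom 1 (nat (- n)) * Q"
        have R: "integral_poly R" "inverse x = ac_eval R \<pi>" "Polynomial.coeff R 0 = 0"
        proof -
          have "integral_poly (Polynomial.monom 1 (nat (- n)))" by (auto simp: integral_poly_def)
          then show "integral_poly R" using Q by (auto simp: R_def)
          show "inverse x = ac_eval R \<pi>" using Q n by (simp add: R_def ac_eval_monom power_int_def)
          show "Polynomial.coeff R 0 = 0" using n by (simp add: R_def coeff_mult_0)
        qed
        let ?d = "Polynomial.degree M" and ?m = "Polynomial.coeff M"
        \<comment> \<open>The monic equation of \<open>x\<close> multiplied by
          \<open>inverse x ^ ?d\<close>. Terms with \<open>i < ?d\<close> keep a positive power of
          \<open>R\<close>, whose constant coefficient is 0, so the constant coefficient of
          \<open>D\<close> is the leading 1 although \<open>D\<close> vanishes at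
          \<open>\<pi>\<close>.\<close>
        define D where "D = (\<Sum>i\<le>?d. smult (?m i) (R ^ (?d - i)))"
        have pow: "x ^ i * inverse x ^ ?d = inverse x ^ (?d - i)" if "i \<le> ?d" for i
        proof -
          have "inverse x ^ ?d = inverse x ^ i * inverse x ^ (?d - i)"
            using that by (simp flip: power_add)
          then show ?thesis using False by (simp add: power_inverse)
        qed
        have "ac_eval D \<pi> = (\<Sum>i\<le>?d. to_ac (?m i) * inverse x ^ (?d - i))"
          by (simp add: D_def ac_eval_sum R(2))
        also have "\<dots> = (\<Sum>i\<le>?d. to_ac (?m i) * x ^ i) * inverse x ^ ?d"
          unfolding sum_distrib_right by (intro sum.cong refl) (simp only: mult.assoc pow atMost_iff)
        also have "\<dots> = ac_eval M x * inverse x ^ ?d"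
          by (simp only: ac_eval_sum_coeff[OF order_refl])
        finally have "ac_eval D \<pi> = 0" using M(3) by simp
        moreover have "integral_poly D"
          unfolding D_def using M(2) R(1)
          by (intro integral_poly_sum integral_poly_smult integral_poly_power) (auto simp: integral_poly_def[of M])
        ultimately have "Polynomial.coeff D 0 \<in> prime_ideal v" by (intro vanishing_coeff_0)
        moreover have "Polynomial.coeff D 0 = 1"
        proof -
          have "Polynomial.coeff D 0 = (\<Sum>i\<le>?d. ?m i * 0 ^ (?d - i))"
            unfolding D_def coeff_sum using R(3) by (simp add: coeff_0_power)
          also have "\<dots> = (\<Sum>i\<le>?d. if i = ?d then ?m i else 0)"
            by (intro sum.cong) (auto simp: power_0_left)
          finally show ?thesis using M(1) by simp
        qed
        ultimately show ?thesis using unit_closed(1) by (simp add: unit_iff)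
      qed
    qed
  qed
qed

lemma ext_integers_base: "a \<in> integers v \<Longrightarrow> to_ac a \<in> ext_integers v ext"
  unfolding ext_integers_ext by (auto intro!: exI[of _ "[:a:]"])

text \<open>If the inverse is the value of an integral \<open>Q\<close>, then \<open>P * Q\<close>
  and 1 agree at \<open>\<pi>\<close>, so their constant coefficients are congruent. The other
  direction inverts a leading term of exponent 0.\<close>

lemma ext_units_ac_eval:
  assumes "integral_poly P"
  shows "ac_eval P \<pi> \<in> ext_units v ext \<longleftrightarrow> unit (Polynomial.coeff P 0)"
proof
  assume u: "unit (Polynomial.coeff P 0)"
  then have lead: "has_lead (ac_eval P \<pi>) 0 (Polynomial.coeff P 0)"
    using assms unfolding has_lead_def by auto
  then have "ac_eval P \<pi> \<noteq> 0" using has_lead_norm by blast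
  moreover obtain Q where "integral_poly Q" "inverse (ac_eval P \<pi>) = ac_eval Q \<pi>"
    using has_lead_inverse[OF lead] by (auto simp: has_lead_def)
  ultimately show "ac_eval P \<pi> \<in> ext_units v ext"
    using assms unfolding ext_units_def ext_integers_ext by auto
next
  assume "ac_eval P \<pi> \<in> ext_units v ext"
  then obtain Q where nz: "ac_eval P \<pi> \<noteq> 0" and Q: "integral_poly Q" "inverse (ac_eval P \<pi>) = ac_eval Q \<pi>"
    unfolding ext_units_def ext_integers_ext by auto
  have "ac_eval (P * Q) \<pi> = ac_eval 1 \<pi>" using nz by (simp flip: Q(2))
  then have "rescong (Polynomial.coeff P 0 * Polynomial.coeff Q 0) 1"
    using ac_eval_eq_rescong[of "P * Q" 1] assms Q(1) by (auto simp: coeff_mult_0)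
  then have "unit (Polynomial.coeff P 0 * Polynomial.coeff Q 0)" using rescong_unit by blast
  then show "unit (Polynomial.coeff P 0)"
    using assms Q(1) by (auto simp: unit_iff integral_poly_def)
qed

lemma ext_units_iff: "x \<in> ext_units v ext \<longleftrightarrow> (\<exists>a. has_lead x 0 a)"
proof
  assume "x \<in> ext_units v ext"
  moreover from this obtain P where "integral_poly P" "x = ac_eval P \<pi>"
    unfolding ext_units_def ext_integers_ext by auto
  ultimately show "\<exists>a. has_lead x 0 a"
    using ext_units_ac_eval[of P] unfolding has_lead_def by auto
next
  assume "\<exists>a. has_lead x 0 a"
  then obtain a P where "unit a" "integral_poly P" "rescong (Polynomial.coeff P 0) a" "x = ac_eval P \<pi>"
    unfolding has_lead_def by auto
  then show "x \<in> ext_units v ext" using ext_units_ac_eval[of P] rescong_unit by simp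
qed

text \<open>A value is a non-unit exactly when its constant coefficient lies in the prime ideal, so
  congruence upstairs is congruence of constant coefficients. Here the two residue fields are
  identified.\<close>

lemma reduction_ext:
  assumes "has_lead x 0 a" shows "reduction v ext x = residue_class a"
proof -
  obtain P where P: "unit a" "integral_poly P" "rescong (Polynomial.coeff P 0) a" "x = ac_eval P \<pi>"
    using assms unfolding has_lead_def by auto
  have "to_ac b - x \<in> ext_prime_ideal v ext \<longleftrightarrow> rescong b a" if b: "b \<in> integers v" for b
  proof -
    have int: "integral_poly ([:b:] - P)" using b P(2) by auto
    have eq: "to_ac b - x = ac_eval ([:b:] - P) \<pi>" by (simp add: P(4))
    have "to_ac b - x \<in> ext_integers v ext" using int unfolding eq ext_integers_ext by blast
    then have "to_ac b - x \<in> ext_prime_ideal v ext \<longleftrightarrow> \<not> unit (b - Polynomial.coeff P 0)"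
      using ext_units_ac_eval[OF int] by (simp add: ext_prime_ideal_def eq)
    also have "\<dots> \<longleftrightarrow> rescong b (Polynomial.coeff P 0)"
      using b P(2) by (auto simp: unit_iff rescong_def integral_poly_def)
    also have "\<dots> \<longleftrightarrow> rescong b a" using P(3) rescong_trans rescong_sym by blast
    finally show ?thesis .
  qed
  moreover have "rescong b a \<Longrightarrow> b \<in> integers v" for b
    using rescong_integers P(1) unit_integers by blast
  ultimately show ?thesis by (auto simp: reduction_def residue_class_def)
qed

lemma zero_ext_prime_ideal: "0 \<in> ext_prime_ideal v ext" "0 \<in> ext_integers v ext"
  using ext_integers_base[of 0] by (auto simp: ext_prime_ideal_def ext_units_def)

end

section \<open>The infinite dihedral group\<close>

text \<open>
  The pair \<open>(k, f)\<close> stands for the affine map \<open>t \<mapsto> k + t\<close> of \<open>\<int>\<close>,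
  or \<open>t \<mapsto> k - t\<close> when \<open>f\<close> holds.
\<close>

definition dihedral :: "(int \<times> bool) monoid" where
  "dihedral = \<lparr>carrier = UNIV,
     monoid.mult = (\<lambda>(k, f) (k', f'). (if f then k - k' else k + k', f \<noteq> f')), one = (0, False)\<rparr>"

lemma dihedral_simps [simp]:
  "carrier dihedral = UNIV" "\<one>\<^bsub>dihedral\<^esub> = (0, False)"
  "(k, f) \<otimes>\<^bsub>dihedral\<^esub> (k', f') = (if f then k - k' else k + k', f \<noteq> f')"
  by (simp_all add: dihedral_def)

lemma group_dihedral: "group dihedral"
proof (rule groupI)
  show "\<exists>y\<in>carrier dihedral. y \<otimes>\<^bsub>dihedral\<^esub> x = \<one>\<^bsub>dihedral\<^esub>" for x
    by (cases x) (intro bexI[of _ "(if snd x then fst x else - fst x, snd x)"], auto)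
qed auto

text \<open>The maps \<open>t \<mapsto> - t\<close> and \<open>t \<mapsto> - 1 - t\<close>; the
  constants are the invariants that \<open>s\<close> and \<open>s'\<close> turn out to have.\<close>

definition reflection :: "bool \<Rightarrow> int \<times> bool" where
  "reflection b = (if b then - 1 else 0, True)"

primrec word_value :: "bool list \<Rightarrow> int \<times> bool" where
  "word_value [] = (0, False)"
| "word_value (b # u) = reflection b \<otimes>\<^bsub>dihedral\<^esub> word_value u"

abbreviation A1_matrix :: "bool \<Rightarrow> bool \<Rightarrow> enat" where
  "A1_matrix \<equiv> \<lambda>s t. if s = t then 1 else \<infinity>"

abbreviation A1_eq :: "bool list \<Rightarrow> bool list \<Rightarrow> bool" where
  "A1_eq \<equiv> coxeter_eq A1_matrix"

lemma word_value_append: "word_value (u @ w) = word_value u \<otimes>\<^bsub>dihedral\<^esub> word_value w"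
proof -
  interpret group dihedral by (rule group_dihedral)
  show ?thesis
  proof (induction u)
    case Nil
    show ?case using l_one[of "word_value w"] by simp
  next
    case (Cons b u)
    then show ?case using m_assoc[of "reflection b" "word_value u" "word_value w"] by simp
  qed
qed

lemma A1_eq_imp_word_value: "A1_eq u w \<Longrightarrow> word_value u = word_value w"
proof (induction rule: coxeter_eq.induct)
  case (coxeter_relation s t k u w)
  then have "s = t" "k = 1" by (auto split: if_splits simp: one_enat_def)
  moreover have "word_value (s # s # w) = word_value w"
    by (cases "word_value w") (simp add: reflection_def)
  ultimately show ?case by (simp add: word_value_append)
qed auto

lemma A1_eq_cancel: "A1_eq (b # b # w) w"
  using coxeter_relation[of A1_matrix b b 1 "[]" w] by (simp add: one_enat_def)

lemma A1_eq_Cons: "A1_eq u w \<Longrightarrow> A1_eq (b # u) (b # w)"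
proof (induction rule: coxeter_eq.induct)
  case (coxeter_relation s t k u w)
  then show ?case using coxeter_eq.coxeter_relation[of A1_matrix s t k "b # u" w] by simp
qed (auto intro: coxeter_refl coxeter_sym coxeter_trans)

text \<open>Normal forms: the only relations cancel two equal neighbours, so every word reduces to
  an alternating one.\<close>

primrec alternating :: "bool \<Rightarrow> nat \<Rightarrow> bool list" where
  "alternating b 0 = []"
| "alternating b (Suc n) = b # alternating (\<not> b) n"

lemma A1_eq_alternating: "\<exists>b n. A1_eq u (alternating b n)"
proof (induction u)
  case Nil
  show ?case using coxeter_refl[of A1_matrix "[]"] by (intro exI[of _ True] exI[of _ 0]) simp
next
  case (Cons c u)
  then obtain b n where *: "A1_eq (c # u) (c # alternating b n)" using A1_eq_Cons by blast
  show ?case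
  proof (cases "c = b \<and> n > 0")
    case True
    then obtain m where "n = Suc m" using gr0_implies_Suc by blast
    then have "A1_eq (c # alternating b n) (alternating (\<not> b) m)" using True A1_eq_cancel by simp
    then show ?thesis using * coxeter_trans by blast
  next
    case False
    then have "c # alternating b n = alternating c (Suc n)" by (cases n) auto
    then show ?thesis using * by metis
  qed
qed

text \<open>Even lengths give translations and odd lengths reflections. The rounding up for words
  starting with \<open>True\<close> comes from the constant \<open>- 1\<close> of that
  reflection.\<close>

lemma word_value_alternating:
  "word_value (alternating b n) = (if b then - int ((n + 1) div 2) else int (n div 2), odd n)"
  by (induction n arbitrary: b) (auto simp: reflection_def)

text \<open>The first component is negative exactly for nonempty words starting with
  \<open>True\<close>; it thus recovers the first letter and, with the parity, the length.\<close>

lemma alternating_inject: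
  assumes "word_value (alternating b n) = word_value (alternating c m)"
  shows "alternating b n = alternating c m"
proof -
  have "odd n \<longleftrightarrow> odd m" and *: "(if b then - int ((n + 1) div 2) else int (n div 2))
      = (if c then - int ((m + 1) div 2) else int (m div 2))"
    using assms by (simp_all add: word_value_alternating)
  then consider i j where "n = 2 * i" "m = 2 * j" | i j where "n = 2 * i + 1" "m = 2 * j + 1"
    by (metis evenE oddE)
  then have "n = m \<and> (b = c \<or> n = 0)"
    using * by cases (auto split: if_splits)
  then show ?thesis by auto
qed

lemma A1_eq_iff: "A1_eq u w \<longleftrightarrow> word_value u = word_value w"
proof
  assume *: "word_value u = word_value w"
  obtain b n c m where u: "A1_eq u (alternating b n)" and w: "A1_eq w (alternating c m)"
    using A1_eq_alternating by metis
  then have "alternating b n = alternating c m"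
    using * by (intro alternating_inject) (simp flip: A1_eq_imp_word_value)
  then show "A1_eq u w" using coxeter_trans[OF u coxeter_sym] w by simp
qed (rule A1_eq_imp_word_value)

lemma word_value_surj: obtains u where "word_value u = d"
proof (cases d)
  case (Pair k f)
  \<comment> \<open>Inverts the formula for alternating words: a negative \<open>k\<close> calls for
    \<open>True\<close> as first letter, and then \<open>- k - 1\<close> undoes the rounding up for
    a reflection.\<close>
  let ?n = "2 * nat (if k < 0 then if f then - k - 1 else - k else k) + of_bool f"
  have "word_value (alternating (k < 0) ?n) = (k, f)"
    unfolding word_value_alternating by (cases f; cases "k < 0") auto
  then show ?thesis using that Pair by blast
qed

text \<open>Elements of the Coxeter group are classes of words, and these classes are the fibres of
  \<open>word_value\<close>.\<close>

lemma dihedral_iso_W_aff_A1: "(\<lambda>d. {w. word_value w = d}) \<in> iso dihedral W_aff_A1"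
proof -
  let ?\<psi> = "\<lambda>d. {w. word_value w = d}"
  have car: "carrier W_aff_A1 = range ?\<psi>"
  proof -
    have "carrier W_aff_A1 = range (\<lambda>u. {w. word_value u = word_value w})"
      unfolding W_aff_A1_def coxeter_group_def quotient_def by (auto simp: A1_eq_iff)
    also have "\<dots> = ?\<psi> ` range word_value" by (simp add: image_image eq_commute)
    also have "range word_value = UNIV" 
    proof -
      have "d \<in> range word_value" for d using word_value_surj[of d] by (metis rangeI)
      then show ?thesis by blast
    qed
    finally show ?thesis .
  qed
  have "?\<psi> (x \<otimes>\<^bsub>dihedral\<^esub> y) = ?\<psi> x \<otimes>\<^bsub>W_aff_A1\<^esub> ?\<psi> y" for x y
  proof -
    obtain a b where "word_value a = x" "word_value b = y" using word_value_surj by metis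
    then show ?thesis
      by (auto simp: W_aff_A1_def coxeter_group_def A1_eq_iff word_value_append)
  qed
  moreover have "inj ?\<psi>"
  proof (rule injI)
    fix x y assume "?\<psi> x = ?\<psi> y"
    moreover obtain u where "word_value u = x" by (rule word_value_surj)
    ultimately show "x = y" by blast
  qed
  ultimately show ?thesis
    by (auto simp: iso_def hom_def bij_betw_def car simp del: dihedral_simps(3))
qed

lemma one_W_aff_A1: "\<one>\<^bsub>W_aff_A1\<^esub> = {w. word_value w = (0, False)}"
  by (auto simp: W_aff_A1_def coxeter_group_def A1_eq_iff)

lemma generate_dihedral: "generate dihedral (range reflection) = carrier dihedral"
proof -
  have "word_value u \<in> generate dihedral (range reflection)" for u
  proof (induction u)
    case Nil
    show ?case using generate.one[of dihedral] by simp
  next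
    case (Cons b u)
    then show ?case by (simp add: generate.eng generate.incl)
  qed
  then show ?thesis by (metis UNIV_eq_I dihedral_simps(1) word_value_surj)
qed

section \<open>Direct products from generators\<close>

text \<open>Transported by the isomorphism, the two subgroups become the coordinate subgroups, which
  commute and meet trivially.\<close>

lemma iso_with_factors_imp_internal_direct_product:
  assumes iso: "iso_with_factors W A B H K"
    and groups: "group W" "group H" "group K" and sub: "subgroup A W" "subgroup B W"
  shows "internal_direct_product W A B"
proof -
  interpret W: group W by fact
  interpret H: group H by fact
  interpret K: group K by fact
  obtain \<phi> where \<phi>: "\<phi> \<in> iso W (H \<times>\<times> K)"
    and A: "\<phi> ` A = carrier H \<times> {\<one>\<^bsub>K\<^esub>}" and B: "\<phi> ` B = {\<one>\<^bsub>H\<^esub>} \<times> carrier K"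
    using iso by (auto simp: iso_with_factors_def)
  have bij: "bij_betw \<phi> (carrier W) (carrier H \<times> carrier K)" and inj: "inj_on \<phi> (carrier W)"
    using \<phi> by (auto simp: iso_def bij_betw_def)
  have mult: "\<phi> (x \<otimes>\<^bsub>W\<^esub> y) = \<phi> x \<otimes>\<^bsub>H \<times>\<times> K\<^esub> \<phi> y" if "x \<in> carrier W" "y \<in> carrier W" for x y
    using \<phi> that by (auto simp: iso_def hom_def)
  have in_W: "x \<in> carrier W" if "x \<in> A \<or> x \<in> B" for x
    using that sub subgroup.subset by blast
  have valA: "\<exists>h\<in>carrier H. \<phi> a = (h, \<one>\<^bsub>K\<^esub>)" if "a \<in> A" for a using A that by auto
  have valB: "\<exists>k\<in>carrier K. \<phi> b = (\<one>\<^bsub>H\<^esub>, k)" if "b \<in> B" for b using B that by auto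
  have comm: "b \<otimes>\<^bsub>W\<^esub> a = a \<otimes>\<^bsub>W\<^esub> b" if ab: "a \<in> A" "b \<in> B" for a b
  proof (rule inj_onD[OF inj])
    show "\<phi> (b \<otimes>\<^bsub>W\<^esub> a) = \<phi> (a \<otimes>\<^bsub>W\<^esub> b)"
      using valA[OF ab(1)] valB[OF ab(2)] in_W ab by (auto simp: mult)
  qed (use ab in_W in auto)
  let ?m = "\<lambda>(a, b). a \<otimes>\<^bsub>W\<^esub> b"
  have "?m \<in> hom (W\<lparr>carrier := A\<rparr> \<times>\<times> W\<lparr>carrier := B\<rparr>) W"
  proof (rule homI)
    fix x y assume "x \<in> carrier (W\<lparr>carrier := A\<rparr> \<times>\<times> W\<lparr>carrier := B\<rparr>)"
      "y \<in> carrier (W\<lparr>carrier := A\<rparr> \<times>\<times> W\<lparr>carrier := B\<rparr>)"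
    then obtain a b a' b' where ab: "x = (a, b)" "y = (a', b')" "a \<in> A" "b \<in> B" "a' \<in> A" "b' \<in> B"
      by auto
    have "a \<otimes>\<^bsub>W\<^esub> a' \<otimes>\<^bsub>W\<^esub> (b \<otimes>\<^bsub>W\<^esub> b') = a \<otimes>\<^bsub>W\<^esub> (a' \<otimes>\<^bsub>W\<^esub> b) \<otimes>\<^bsub>W\<^esub> b'"
      using ab in_W by (simp add: W.m_assoc)
    also have "\<dots> = a \<otimes>\<^bsub>W\<^esub> (b \<otimes>\<^bsub>W\<^esub> a') \<otimes>\<^bsub>W\<^esub> b'" using comm ab by simp
    also have "\<dots> = a \<otimes>\<^bsub>W\<^esub> b \<otimes>\<^bsub>W\<^esub> (a' \<otimes>\<^bsub>W\<^esub> b')"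
      using ab in_W by (simp add: W.m_assoc)
    finally show "?m (x \<otimes>\<^bsub>W\<lparr>carrier := A\<rparr> \<times>\<times> W\<lparr>carrier := B\<rparr>\<^esub> y) = ?m x \<otimes>\<^bsub>W\<^esub> ?m y"
      by (simp add: ab)
  qed (use in_W in auto)
  moreover have "bij_betw ?m (A \<times> B) (carrier W)"
    unfolding bij_betw_def
  proof
    show "inj_on ?m (A \<times> B)"
    proof (rule inj_onI, clarsimp)
      fix a b a' b' assume ab: "a \<in> A" "b \<in> B" "a' \<in> A" "b' \<in> B"
        and eq: "a \<otimes>\<^bsub>W\<^esub> b = a' \<otimes>\<^bsub>W\<^esub> b'"
      obtain h k h' k' where hk: "\<phi> a = (h, \<one>\<^bsub>K\<^esub>)" "\<phi> b = (\<one>\<^bsub>H\<^esub>, k)" "\<phi> a' = (h', \<one>\<^bsub>K\<^esub>)"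
        "\<phi> b' = (\<one>\<^bsub>H\<^esub>, k')" "h \<in> carrier H" "h' \<in> carrier H" "k \<in> carrier K" "k' \<in> carrier K"
        using valA valB ab by metis
      have "\<phi> a \<otimes>\<^bsub>H \<times>\<times> K\<^esub> \<phi> b = \<phi> a' \<otimes>\<^bsub>H \<times>\<times> K\<^esub> \<phi> b'"
        using eq ab in_W by (simp flip: mult)
      then have "\<phi> a = \<phi> a'" "\<phi> b = \<phi> b'" using hk by auto
      then show "a = a' \<and> b = b'" using inj_onD[OF inj] ab in_W by blast
    qed
    show "?m ` (A \<times> B) = carrier W"
    proof
      show "?m ` (A \<times> B) \<subseteq> carrier W" using in_W by auto
      show "carrier W \<subseteq> ?m ` (A \<times> B)"
      proof
        fix w assume w: "w \<in> carrier W"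
        then have "\<phi> w \<in> carrier H \<times> carrier K" using bij_betwE[OF bij] by blast
        then obtain h k where hk: "\<phi> w = (h, k)" "h \<in> carrier H" "k \<in> carrier K" by blast
        then obtain a b where ab: "a \<in> A" "\<phi> a = (h, \<one>\<^bsub>K\<^esub>)" "b \<in> B" "\<phi> b = (\<one>\<^bsub>H\<^esub>, k)"
        proof -
          have "(h, \<one>\<^bsub>K\<^esub>) \<in> \<phi> ` A" "(\<one>\<^bsub>H\<^esub>, k) \<in> \<phi> ` B" using A B hk by auto
          then show ?thesis using that by (metis imageE)
        qed
        have "\<phi> w = \<phi> (a \<otimes>\<^bsub>W\<^esub> b)" using hk ab in_W by (simp add: mult)
        then have "w = a \<otimes>\<^bsub>W\<^esub> b" using inj_onD[OF inj] w ab in_W by auto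
        then show "w \<in> ?m ` (A \<times> B)" using ab by auto
      qed
    qed
  qed
  ultimately show ?thesis using groups sub by (simp add: internal_direct_product_def iso_def)
qed

text \<open>Allows invariants to take values in the concrete group \<open>dihedral\<close>, to be
  replaced by the Coxeter group afterwards.\<close>

lemma iso_with_factors_left:
  assumes "iso_with_factors W A B H K" "\<psi> \<in> iso H H'" "\<psi> \<one>\<^bsub>H\<^esub> = \<one>\<^bsub>H'\<^esub>"
  shows "iso_with_factors W A B H' K"
proof -
  obtain \<phi> where \<phi>: "\<phi> \<in> iso W (H \<times>\<times> K)"
    and A: "\<phi> ` A = carrier H \<times> {\<one>\<^bsub>K\<^esub>}" and B: "\<phi> ` B = {\<one>\<^bsub>H\<^esub>} \<times> carrier K"
    using assms(1) by (auto simp: iso_with_factors_def)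
  let ?\<chi> = "\<lambda>(h, k). (\<psi> h, k)"
  have img: "\<psi> ` carrier H = carrier H'" and inj: "inj_on \<psi> (carrier H)" and hom: "\<psi> \<in> hom H H'"
    using assms(2) by (auto simp: iso_def bij_betw_def)
  have "?\<chi> \<in> iso (H \<times>\<times> K) (H' \<times>\<times> K)"
  proof -
    have "?\<chi> ` (carrier H \<times> carrier K) = carrier H' \<times> carrier K" using img by force
    then show ?thesis using inj hom by (auto simp: iso_def hom_def bij_betw_def inj_on_def)
  qed
  then have "?\<chi> \<circ> \<phi> \<in> iso W (H' \<times>\<times> K)" using \<phi> iso_set_trans by blast
  moreover have "(?\<chi> \<circ> \<phi>) ` A = carrier H' \<times> {\<one>\<^bsub>K\<^esub>}"
    unfolding image_comp[symmetric] A using img by (force simp: image_iff)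
  moreover have "(?\<chi> \<circ> \<phi>) ` B = {\<one>\<^bsub>H'\<^esub>} \<times> carrier K"
    unfolding image_comp[symmetric] B using assms(3) by (force simp: image_iff)
  ultimately show ?thesis unfolding iso_with_factors_def by blast
qed

text \<open>The images of \<open>S\<close> and \<open>T\<close> generate the two factors, so \<Phi>
  is onto, and the first isomorphism theorem makes its components coordinates on the
  quotient.\<close>

lemma quotient_direct_product:
  assumes groups: "group G" "group H" "group K" and hom: "\<Phi> \<in> hom G (H \<times>\<times> K)"
    and ker: "kernel G (H \<times>\<times> K) \<Phi> = N"
    and sub: "S \<subseteq> carrier G" "T \<subseteq> carrier G" "A \<subseteq> carrier H" "B \<subseteq> carrier K"
    and gen: "generate H A = carrier H" "generate K B = carrier K"
    and img: "\<Phi> ` S = A \<times> {\<one>\<^bsub>K\<^esub>}" "\<Phi> ` T = {\<one>\<^bsub>H\<^esub>} \<times> B"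
  defines "S' \<equiv> generate (G Mod N) ((\<lambda>g. N #>\<^bsub>G\<^esub> g) ` S)"
    and "T' \<equiv> generate (G Mod N) ((\<lambda>g. N #>\<^bsub>G\<^esub> g) ` T)"
  shows "internal_direct_product (G Mod N) S' T' \<and> iso_with_factors (G Mod N) S' T' H K"
proof -
  interpret G: group G by fact
  interpret H: group H by fact
  interpret K: group K by fact
  interpret HK: group "H \<times>\<times> K" by (rule DirProd_group[OF groups(2,3)])
  interpret \<Phi>: group_hom G "H \<times>\<times> K" \<Phi>
    using hom by (simp add: group_hom_def group_hom_axioms_def G.is_group HK.is_group)
  interpret \<iota>H: group_hom H "H \<times>\<times> K" "\<lambda>h. (h, \<one>\<^bsub>K\<^esub>)"
    by unfold_locales (auto simp: hom_def)
  interpret \<iota>K: group_hom K "H \<times>\<times> K" "\<lambda>k. (\<one>\<^bsub>H\<^esub>, k)"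
    by unfold_locales (auto simp: hom_def)
  have genH: "generate (H \<times>\<times> K) (\<Phi> ` S) = carrier H \<times> {\<one>\<^bsub>K\<^esub>}"
  proof -
    have "\<Phi> ` S = (\<lambda>h. (h, \<one>\<^bsub>K\<^esub>)) ` A" using img by auto
    then show ?thesis using \<iota>H.generate_img[OF sub(3)] gen(1) by auto
  qed
  have genK: "generate (H \<times>\<times> K) (\<Phi> ` T) = {\<one>\<^bsub>H\<^esub>} \<times> carrier K"
  proof -
    have "\<Phi> ` T = (\<lambda>k. (\<one>\<^bsub>H\<^esub>, k)) ` B" using img by auto
    then show ?thesis using \<iota>K.generate_img[OF sub(4)] gen(2) by auto
  qed
  have "\<Phi> ` carrier G = carrier (H \<times>\<times> K)"
  proof
    have S1: "generate (H \<times>\<times> K) (\<Phi> ` S) \<subseteq> \<Phi> ` carrier G" "generate (H \<times>\<times> K) (\<Phi> ` T) \<subseteq> \<Phi> ` carrier G"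
      using \<Phi>.generate_img[OF sub(1)] \<Phi>.generate_img[OF sub(2)]
        G.generate_incl[OF sub(1)] G.generate_incl[OF sub(2)] by auto
    show "carrier (H \<times>\<times> K) \<subseteq> \<Phi> ` carrier G"
    proof
      fix x assume "x \<in> carrier (H \<times>\<times> K)"
      then obtain h k where hk: "x = (h, k)" "h \<in> carrier H" "k \<in> carrier K" by auto
      then have "(h, \<one>\<^bsub>K\<^esub>) \<in> \<Phi> ` carrier G" "(\<one>\<^bsub>H\<^esub>, k) \<in> \<Phi> ` carrier G"
        using S1 genH genK by auto
      then obtain a b where ab: "a \<in> carrier G" "b \<in> carrier G" "\<Phi> a = (h, \<one>\<^bsub>K\<^esub>)" "\<Phi> b = (\<one>\<^bsub>H\<^esub>, k)"
        by (metis imageE)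
      have "\<Phi> (a \<otimes>\<^bsub>G\<^esub> b) = x" using ab hk by simp
      then show "x \<in> \<Phi> ` carrier G" using ab by blast
    qed
    show "\<Phi> ` carrier G \<subseteq> carrier (H \<times>\<times> K)" using \<Phi>.hom_closed by blast
  qed
  then have iso: "(\<lambda>C. the_elem (\<Phi> ` C)) \<in> iso (G Mod N) (H \<times>\<times> K)"
    using \<Phi>.FactGroup_iso_set ker by simp
  let ?\<phi> = "\<lambda>C. the_elem (\<Phi> ` C)" and ?c = "\<lambda>g. N #>\<^bsub>G\<^esub> g"
  have normal: "normal N G" using \<Phi>.normal_kernel ker by simp
  then interpret W: group "G Mod N" by (rule normal.factorgroup_is_group)
  interpret \<phi>: group_hom "G Mod N" "H \<times>\<times> K" ?\<phi>
    using iso by (simp add: group_hom_def group_hom_axioms_def iso_def HK.is_group)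
  have c_in: "?c g \<in> carrier (G Mod N)" if "g \<in> carrier G" for g
    using that normal_imp_subgroup[OF normal] subgroup.subset
    by (auto simp: FactGroup_def RCOSETS_def)
  have \<phi>_c: "?\<phi> (?c g) = \<Phi> g" if "g \<in> carrier G" for g
  proof -
    have "\<Phi> x = \<Phi> g" if "x \<in> ?c g" for x
    proof -
      obtain n where "n \<in> carrier G" "\<Phi> n = \<one>\<^bsub>H \<times>\<times> K\<^esub>" "x = n \<otimes>\<^bsub>G\<^esub> g"
        using \<open>x \<in> ?c g\<close> unfolding ker[symmetric] r_coset_def kernel_def by blast
      then show ?thesis
        using \<Phi>.hom_mult[of n g] HK.l_one[OF \<Phi>.hom_closed, of g] \<open>g \<in> carrier G\<close> by (simp only:)
    qed
    moreover have "g \<in> ?c g"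
      using G.rcos_self[OF \<open>g \<in> carrier G\<close> normal_imp_subgroup[OF normal]] .
    ultimately have "\<Phi> ` ?c g = {\<Phi> g}" by blast
    then show ?thesis by simp
  qed
  have incl: "?c ` S \<subseteq> carrier (G Mod N)" "?c ` T \<subseteq> carrier (G Mod N)" using c_in sub by auto
  have imgs: "?\<phi> ` (?c ` S) = \<Phi> ` S" "?\<phi> ` (?c ` T) = \<Phi> ` T"
    using \<phi>_c sub by (auto simp: image_image intro!: image_cong)
  have "iso_with_factors (G Mod N) S' T' H K"
    unfolding iso_with_factors_def S'_def T'_def
    using iso \<phi>.generate_img[OF incl(1)] \<phi>.generate_img[OF incl(2)] imgs genH genK
    by (intro bexI[of _ ?\<phi>]) auto
  moreover have "subgroup S' (G Mod N)" "subgroup T' (G Mod N)"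
    unfolding S'_def T'_def using W.generate_is_subgroup incl by blast+
  ultimately show ?thesis
    using iso_with_factors_imp_internal_direct_product W.is_group groups by blast
qed

section \<open>The groups and the normaliser of the torus\<close>

no_notation fps_nth (infixl "$" 75)

lemma mat2_nth [simp]:
  "mat2 a b c d $ 1 $ 1 = a" "mat2 a b c d $ 1 $ 2 = b"
  "mat2 a b c d $ 2 $ 1 = c" "mat2 a b c d $ 2 $ 2 = d"
  by (simp_all add: mat2_def)

lemma mat2_eta: "g = mat2 (g $ 1 $ 1) (g $ 1 $ 2) (g $ 2 $ 1) (g $ 2 $ 2)"
  by (simp add: vec_eq_iff forall_2)

lemma mat2_eq_iff: "mat2 a b c d = mat2 a' b' c' d' \<longleftrightarrow> a = a' \<and> b = b' \<and> c = c' \<and> d = d'"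
  by (auto simp: vec_eq_iff forall_2)

lemma matrix_mult_2_nth: "((g::'k::comm_ring_1^2^2) ** h) $ i $ j = g $ i $ 1 * h $ 1 $ j + g $ i $ 2 * h $ 2 $ j"
  by (simp add: matrix_matrix_mult_def sum_2)

lemma mat2_mult:
  "mat2 a b c d ** mat2 a' b' c' (d'::'k::comm_ring_1) =
   mat2 (a * a' + b * c') (a * b' + b * d') (c * a' + d * c') (c * b' + d * d')"
  by (simp add: vec_eq_iff forall_2 matrix_mult_2_nth)

lemma det_mat2: "det (mat2 a b c (d::'k::comm_ring_1)) = a * d - b * c"
  by (simp add: det_2)

lemma mat_1_eq_mat2: "(mat 1 :: 'k::comm_ring_1^2^2) = mat2 1 0 0 1"
  by (simp add: vec_eq_iff forall_2 mat_def)

definition antidiagonal :: "'k::zero^2^2 \<Rightarrow> bool" where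
  "antidiagonal g \<longleftrightarrow> g $ 1 $ 1 = 0 \<and> g $ 2 $ 2 = 0"

text \<open>Covers the extensions as well as a whole field, so that rational and geometric points
  get their group laws from the same proofs.\<close>

locale subfield_set =
  fixes E :: "'k::field set"
  assumes E_closed: "0 \<in> E" "1 \<in> E" "\<And>x y. x \<in> E \<Longrightarrow> y \<in> E \<Longrightarrow> x + y \<in> E"
    "\<And>x y. x \<in> E \<Longrightarrow> y \<in> E \<Longrightarrow> x * y \<in> E" "\<And>x. x \<in> E \<Longrightarrow> - x \<in> E"
    "\<And>x. x \<in> E \<Longrightarrow> inverse x \<in> E"
begin

lemma group_GL1: "group (GL1 E)"
proof (rule groupI)
  show "\<exists>y\<in>carrier (GL1 E). y \<otimes>\<^bsub>GL1 E\<^esub> x = \<one>\<^bsub>GL1 E\<^esub>" if "x \<in> carrier (GL1 E)" for x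
    using that E_closed by (intro bexI[of _ "inverse x"]) (auto simp: GL1_def)
qed (use E_closed in \<open>auto simp: GL1_def\<close>)

lemma det_in_E:
  assumes "\<And>i j. (g::'k^2^2) $ i $ j \<in> E" shows "det g \<in> E"
  using assms E_closed(3)[OF _ E_closed(5)] E_closed(4) unfolding det_2 by (metis uminus_add_conv_diff add.commute)

lemma group_GL2: "group (GL2 E)"
proof (rule groupI)
  fix x assume x: "x \<in> carrier (GL2 E)"
  define y where "y = mat2 (x $ 2 $ 2 * inverse (det x)) (- x $ 1 $ 2 * inverse (det x))
      (- x $ 2 $ 1 * inverse (det x)) (x $ 1 $ 1 * inverse (det x))"
  have xE: "x $ i $ j \<in> E" for i j using x by (simp add: GL2_def)
  have d: "det x \<noteq> 0" "inverse (det x) \<in> E" using x det_in_E[OF xE] E_closed(6) by (auto simp: GL2_def)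
  have yx: "y ** x = mat 1"
  proof -
    have "y ** x = mat2 (det x * inverse (det x)) 0 0 (det x * inverse (det x))"
      by (simp add: vec_eq_iff forall_2 matrix_mult_2_nth y_def det_2 algebra_simps)
    then show ?thesis using d by (simp add: mat_1_eq_mat2)
  qed
  then have "det y * det x = 1" by (metis det_mul det_I)
  moreover have "y $ i $ j \<in> E" for i j
    using exhaust_2[of i] exhaust_2[of j] xE d E_closed(4,5) by (auto simp: y_def simp del: mult_minus_left)
  ultimately show "\<exists>y\<in>carrier (GL2 E). y \<otimes>\<^bsub>GL2 E\<^esub> x = \<one>\<^bsub>GL2 E\<^esub>"
    using yx by (intro bexI[of _ y]) (auto simp: GL2_def)
next
  show "x \<otimes>\<^bsub>GL2 E\<^esub> y \<in> carrier (GL2 E)" if "x \<in> carrier (GL2 E)" "y \<in> carrier (GL2 E)" for x y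
    using that E_closed(3,4) by (auto simp: GL2_def matrix_mult_2_nth det_mul)
  show "\<one>\<^bsub>GL2 E\<^esub> \<in> carrier (GL2 E)"
    using E_closed(1,2) by (simp add: GL2_def, simp add: mat_def)
  show "x \<otimes>\<^bsub>GL2 E\<^esub> y \<otimes>\<^bsub>GL2 E\<^esub> z = x \<otimes>\<^bsub>GL2 E\<^esub> (y \<otimes>\<^bsub>GL2 E\<^esub> z)" for x y z
    by (simp add: GL2_def matrix_mul_assoc)
  show "\<one>\<^bsub>GL2 E\<^esub> \<otimes>\<^bsub>GL2 E\<^esub> x = x" for x by (simp add: GL2_def)
qed

end

lemma subfield_UNIV: "subfield_set UNIV"
  by unfold_locales auto

text \<open>The disjunction expresses conjugation by \<open>g\<close> and by its inverse without
  forming an inverse; comparing entries does the rest.\<close>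

lemma monomial_conjugate_diagonal:
  fixes g t y :: "'k::field^2^2"
  assumes "det g \<noteq> 0" "diagonal g \<or> antidiagonal g" "diagonal t" "y ** g = g ** t \<or> g ** y = t ** g"
  shows "diagonal y"
  using assms
  by (auto simp: diagonal_def antidiagonal_def vec_eq_iff forall_2 matrix_mult_2_nth det_2)

text \<open>The conjugated matrix has two distinct eigenvalues, so each row of \<open>g\<close> can
  have only one nonzero entry.\<close>

lemma conjugate_diagonal_monomial:
  fixes g y :: "'k::field^2^2"
  assumes "det g \<noteq> 0" "y ** g = g ** mat2 (- 1) 0 0 1" "diagonal y" "- 1 \<noteq> (1::'k)"
  shows "diagonal g \<or> antidiagonal g"
proof -
  have two: "a = 0" if "- a = a" for a :: 'k
  proof -
    have "(1 + 1) * a = 0" using that by (simp only: neg_eq_iff_add_eq_0 distrib_right mult_1)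
    then show ?thesis using assms(4) by (simp add: eq_neg_iff_add_eq_0 neg_eq_iff_add_eq_0)
  qed
  have eq: "y $ 1 $ 1 * g $ 1 $ 1 = - g $ 1 $ 1" "y $ 1 $ 1 * g $ 1 $ 2 = g $ 1 $ 2"
    "y $ 2 $ 2 * g $ 2 $ 1 = - g $ 2 $ 1" "y $ 2 $ 2 * g $ 2 $ 2 = g $ 2 $ 2"
    using assms(2,3) by (simp_all add: diagonal_def vec_eq_iff forall_2 matrix_mult_2_nth)
  have prod0: "a = 0 \<or> b = 0" if "u * a = - a" "u * b = b" for u a b :: 'k
  proof (cases "b = 0")
    case False
    then have "u = 1" using that(2) by simp
    then show ?thesis using that(1) two[of a] by simp
  qed simp
  have "g $ 1 $ 1 = 0 \<or> g $ 1 $ 2 = 0" "g $ 2 $ 1 = 0 \<or> g $ 2 $ 2 = 0"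
    using eq prod0 by blast+
  then show ?thesis using assms(1) by (auto simp: det_2 diagonal_def antidiagonal_def)
qed

lemma (in group) conjugation_eqI:
  assumes "n \<in> carrier G" "H \<subseteq> carrier G"
    and "\<And>x. x \<in> H \<Longrightarrow> n \<otimes> x \<otimes> inv n \<in> H" "\<And>x. x \<in> H \<Longrightarrow> inv n \<otimes> x \<otimes> n \<in> H"
  shows "n <# H #> inv n = H"
proof
  show "n <# H #> inv n \<subseteq> H" using assms(3) by (auto simp: l_coset_def r_coset_def)
  show "H \<subseteq> n <# H #> inv n"
  proof
    fix x assume x: "x \<in> H"
    then have xG: "x \<in> carrier G" using assms(2) by blast
    then have "inv n \<otimes> x \<otimes> n \<otimes> inv n = inv n \<otimes> x" using assms(1) by (simp add: m_assoc)
    moreover have "n \<otimes> (inv n \<otimes> x) = x" using assms(1) xG by (simp flip: m_assoc)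
    ultimately have "x = n \<otimes> (inv n \<otimes> x \<otimes> n) \<otimes> inv n"
      using assms(1) xG by (simp add: m_assoc)
    then show "x \<in> n <# H #> inv n" using assms(4)[OF x] by (auto simp: l_coset_def r_coset_def)
  qed
qed

section \<open>Rational and geometric points over the two extensions\<close>

locale two_extensions =
  F2: tame_extension v 2 "- 1" c2 \<pi>2 + F4: tame_extension v 4 w c4 \<pi>4
  for v :: "'a::field \<Rightarrow> int" and w c2 c4 :: 'a and \<pi>2 \<pi>4 :: "'a alg_closure"
begin

abbreviation "E2 \<equiv> F2.ext"
abbreviation "E4 \<equiv> F4.ext"
abbreviation "G \<equiv> G0 E2 E4"
abbreviation "GG \<equiv> G0_geom E2 E4"

sublocale S2: subfield_set E2 by unfold_locales auto
sublocale S4: subfield_set E4 by unfold_locales auto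

lemma neg_one_neq_one_ac: "- 1 \<noteq> (1::'a alg_closure)"
  using F2.w_primitive[of 1] by (metis less_numeral_extra(1) one_less_numeral_iff power_one_right semiring_norm(76) to_ac_1 to_ac_eq_iff to_ac_minus)

lemma carrier_G: "carrier G = {(g, h). (\<forall>i j. g $ i $ j \<in> E2) \<and> det g \<noteq> 0 \<and> h \<in> E4 \<and> h \<noteq> 0 \<and>
    field_norm E2 (det g) * field_norm E4 h = 1}"
  by (auto simp: G0_def GL2_def GL1_def)

lemma mult_G [simp]: "(g, h) \<otimes>\<^bsub>G\<^esub> (g', h') = (g ** g', h * h')"
  by (simp add: G0_def GL2_def GL1_def)

lemma one_G: "\<one>\<^bsub>G\<^esub> = (mat 1, 1)"
  by (simp add: G0_def GL2_def GL1_def)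

text \<open>The norm condition cuts out the kernel of a homomorphism from the full product to the
  multiplicative group.\<close>

lemma group_G: "group G"
proof -
  let ?P = "GL2 E2 \<times>\<times> GL1 E4" and ?f = "\<lambda>(g, h). field_norm E2 (det g) * field_norm E4 h"
  interpret P: group ?P by (rule DirProd_group[OF S2.group_GL2 S4.group_GL1])
  interpret U: group "GL1 (UNIV :: 'a set)" by (rule subfield_set.group_GL1[OF subfield_UNIV])
  have "?f \<in> hom ?P (GL1 UNIV)"
  proof (rule homI)
    show "?f x \<in> carrier (GL1 UNIV)" if "x \<in> carrier ?P" for x
      using that S2.det_in_E F2.field_norm_nonzero F4.field_norm_nonzero by (auto simp: GL1_def GL2_def)
    show "?f (x \<otimes>\<^bsub>?P\<^esub> y) = ?f x \<otimes>\<^bsub>GL1 UNIV\<^esub> ?f y" if "x \<in> carrier ?P" "y \<in> carrier ?P" for x y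
      using that S2.det_in_E by (auto simp: GL1_def GL2_def det_mul F2.field_norm_mult F4.field_norm_mult)
  qed
  then interpret group_hom ?P "GL1 UNIV" ?f by unfold_locales
  have "kernel ?P (GL1 UNIV) ?f = carrier G"
    by (auto simp: kernel_def G0_def GL1_def)
  then have "group (?P\<lparr>carrier := carrier G\<rparr>)" using subgroup_kernel P.subgroup_imp_group by metis
  then show ?thesis by (simp add: G0_def)
qed

lemma carrier_GG: "carrier GG = {(g, h) \<in> (embeddings E2 \<rightarrow>\<^sub>E carrier (GL2 UNIV)) \<times> (embeddings E4 \<rightarrow>\<^sub>E carrier (GL1 UNIV)).
        (\<Prod>\<sigma>\<in>embeddings E2. det (g \<sigma>)) * (\<Prod>\<tau>\<in>embeddings E4. h \<tau>) = 1}"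
  by (simp add: G0_geom_def)

lemma mult_GG: "(g, h) \<otimes>\<^bsub>GG\<^esub> (g', h') =
    (\<lambda>\<sigma>\<in>embeddings E2. g \<sigma> ** g' \<sigma>, \<lambda>\<tau>\<in>embeddings E4. h \<tau> * h' \<tau>)"
  by (simp add: G0_geom_def GL2_def GL1_def product_group_def)

lemma group_GG: "group GG"
proof -
  let ?P = "product_group (embeddings E2) (\<lambda>_. GL2 (UNIV :: 'a alg_closure set)) \<times>\<times>
      product_group (embeddings E4) (\<lambda>_. GL1 (UNIV :: 'a alg_closure set))"
  let ?f = "\<lambda>(g, h). (\<Prod>\<sigma>\<in>embeddings E2. det (g \<sigma>)) * (\<Prod>\<tau>\<in>embeddings E4. h \<tau>) :: 'a alg_closure"
  interpret P: group ?P
    by (intro DirProd_group product_group subfield_set.group_GL2 subfield_set.group_GL1 subfield_UNIV)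
  interpret U: group "GL1 (UNIV :: 'a alg_closure set)" by (rule subfield_set.group_GL1[OF subfield_UNIV])
  have "?f \<in> hom ?P (GL1 UNIV)"
  proof (rule homI)
    show "?f x \<in> carrier (GL1 UNIV)" if "x \<in> carrier ?P" for x
      using that F2.finite_embeddings F4.finite_embeddings
      by (auto simp: GL1_def GL2_def product_group_def prod_zero_iff PiE_def Pi_def)
    show "?f (x \<otimes>\<^bsub>?P\<^esub> y) = ?f x \<otimes>\<^bsub>GL1 UNIV\<^esub> ?f y" if "x \<in> carrier ?P" "y \<in> carrier ?P" for x y
      by (cases x; cases y) (simp add: GL1_def GL2_def product_group_def det_mul prod.distrib)
  qed
  then interpret group_hom ?P "GL1 UNIV" ?f by unfold_locales
  have "kernel ?P (GL1 UNIV) ?f = carrier GG"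
    by (auto simp: kernel_def carrier_GG GL1_def product_group_def)
  then have "group (?P\<lparr>carrier := carrier GG\<rparr>)" using subgroup_kernel P.subgroup_imp_group by metis
  then show ?thesis by (simp add: G0_geom_def)
qed

definition monomial :: "'a point set" where
  "monomial = {(g, h) \<in> carrier G. diagonal g \<or> antidiagonal g}"

end

section \<open>Conjugates of rational points and the normaliser\<close>

lemma (in tame_extension) prod_embeddings:
  assumes "x \<in> ext" shows "(\<Prod>\<sigma>\<in>embeddings ext. \<sigma> x) = to_ac (field_norm ext x)"
proof -
  obtain P where "x = ac_eval P \<pi>" using assms unfolding ext_def by blast
  then show ?thesis
    unfolding embeddings_ext by (subst prod.reindex[OF inj_on_\<sigma>]) (simp add: \<sigma>_ac_eval field_norm_ac_eval to_ac_ext_norm)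
qed

lemma (in tame_extension) embeddings_hom:
  assumes "\<tau> \<in> embeddings ext" "x \<in> ext" "y \<in> ext"
  shows "\<tau> (x + y) = \<tau> x + \<tau> y" "\<tau> (x * y) = \<tau> x * \<tau> y" "\<tau> (- x) = - \<tau> x" "\<tau> 0 = 0"
    "\<tau> (x - y) = \<tau> x - \<tau> y"
proof -
  have hom: "\<tau> (x + y) = \<tau> x + \<tau> y" "\<tau> (x * y) = \<tau> x * \<tau> y" if "x \<in> ext" "y \<in> ext" for x y
    using assms that by (auto simp: embeddings_def ring_hom_def ring_of_type_algebra_def)
  have base: "\<tau> (to_ac a) = to_ac a" for a using assms by (simp add: embeddings_def)
  show "\<tau> (x + y) = \<tau> x + \<tau> y" "\<tau> (x * y) = \<tau> x * \<tau> y" using hom assms by blast+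
  show z: "\<tau> 0 = 0" using base[of 0] by simp
  have minus: "\<tau> (- u) = - \<tau> u" if "u \<in> ext" for u
    using hom[of u "- u"] that z by (simp add: eq_neg_iff_add_eq_0 add.commute)
  then show "\<tau> (- x) = - \<tau> x" using assms by blast
  show "\<tau> (x - y) = \<tau> x - \<tau> y" using hom[of x "- y"] minus[of y] assms by simp
qed

text \<open>The component at this embedding is the rational matrix itself.\<close>

lemma (in tame_extension) identity_embedding: "(\<lambda>x\<in>ext. x) \<in> embeddings ext"
  by (auto simp: embeddings_def ring_hom_def ring_of_type_algebra_def)

context two_extensions
begin

lemma det_embedding:
  fixes g :: "'a alg_closure^2^2"
  assumes "\<sigma> \<in> embeddings E2" "\<And>i j. g $ i $ j \<in> E2"
  shows "det (\<chi> i j. \<sigma> (g $ i $ j)) = \<sigma> (det g)"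
proof -
  have "det g = g $ 1 $ 1 * g $ 2 $ 2 - g $ 1 $ 2 * g $ 2 $ 1" by (simp add: det_2)
  moreover have "\<sigma> (g $ 1 $ 1 * g $ 2 $ 2 - g $ 1 $ 2 * g $ 2 $ 1)
      = \<sigma> (g $ 1 $ 1) * \<sigma> (g $ 2 $ 2) - \<sigma> (g $ 1 $ 2) * \<sigma> (g $ 2 $ 1)"
    using assms F2.embeddings_hom(2,5)[OF assms(1)] S2.E_closed(4) by simp
  ultimately show ?thesis by (simp add: det_2)
qed

lemma to_geom_carrier:
  assumes "n \<in> carrier G" shows "to_geom E2 E4 n \<in> carrier GG"
proof -
  obtain g h where n: "n = (g, h)" by (cases n)
  have g: "\<And>i j. g $ i $ j \<in> E2" "det g \<noteq> 0" "det g \<in> E2" and h: "h \<in> E4" "h \<noteq> 0"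
    and norm: "field_norm E2 (det g) * field_norm E4 h = 1"
    using assms S2.det_in_E by (auto simp: n carrier_G)
  have "(\<Prod>\<sigma>\<in>embeddings E2. det (\<chi> i j. \<sigma> (g $ i $ j))) * (\<Prod>\<tau>\<in>embeddings E4. \<tau> h)
      = to_ac (field_norm E2 (det g) * field_norm E4 h)"
    using g h by (simp add: det_embedding F2.prod_embeddings F4.prod_embeddings)
  then have "(\<Prod>\<sigma>\<in>embeddings E2. det (\<chi> i j. \<sigma> (g $ i $ j))) * (\<Prod>\<tau>\<in>embeddings E4. \<tau> h) = 1"
    by (simp only: norm to_ac_1)
  moreover have "det (\<chi> i j. \<sigma> (g $ i $ j)) \<noteq> 0" if "\<sigma> \<in> embeddings E2" for \<sigma>
    using that g F2.embedding_nonzero by (simp add: det_embedding)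
  moreover have "\<tau> h \<noteq> 0" if "\<tau> \<in> embeddings E4" for \<tau>
    using that h F4.embedding_nonzero by simp
  ultimately show ?thesis
    by (auto simp: n to_geom_def carrier_GG GL1_def GL2_def)
qed

text \<open>A normalising element must conjugate one regular element into the torus, and at the
  identity embedding this makes \<open>g\<close> monomial. Conversely, embeddings preserve zeros, so
  all conjugates of a monomial matrix are monomial.\<close>

lemma normalizer_M0_eq: "normalizer_M0 E2 E4 = monomial"
proof -
  interpret GG: group GG by (rule group_GG)
  let ?M = "M0_geom E2 E4"
  have M: "?M \<subseteq> carrier GG" by (auto simp: M0_geom_def)
  have norm_iff: "x \<in> normalizer GG ?M \<longleftrightarrow> x \<in> carrier GG \<and> x <#\<^bsub>GG\<^esub> ?M #>\<^bsub>GG\<^esub> inv\<^bsub>GG\<^esub> x = ?M" for x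
    using M by (auto simp: normalizer_def stabilizer_def)
  have "n \<in> normalizer_M0 E2 E4 \<longleftrightarrow> n \<in> monomial" for n
  proof (cases "n \<in> carrier G")
    case False
    then show ?thesis by (auto simp: normalizer_M0_def monomial_def)
  next
    case True
    obtain g h where n: "n = (g, h)" by (cases n)
    have g: "\<And>i j. g $ i $ j \<in> E2" "det g \<noteq> 0" "det g \<in> E2" and h: "h \<in> E4" "h \<noteq> 0"
      using True S2.det_in_E by (auto simp: n carrier_G)
    let ?g = "\<lambda>\<sigma>. (\<chi> i j. \<sigma> (g $ i $ j)) :: 'a alg_closure^2^2"
    let ?x = "to_geom E2 E4 n"
    have x: "?x = (\<lambda>\<sigma>\<in>embeddings E2. ?g \<sigma>, \<lambda>\<tau>\<in>embeddings E4. \<tau> h)"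
      by (simp add: to_geom_def n)
    have x_in: "?x \<in> carrier GG" using True by (rule to_geom_carrier)
    have det: "det (?g \<sigma>) \<noteq> 0" if "\<sigma> \<in> embeddings E2" for \<sigma>
      using that g F2.embedding_nonzero by (simp add: det_embedding)
    show ?thesis
    proof
      assume "n \<in> normalizer_M0 E2 E4"
      then have eq: "?x <#\<^bsub>GG\<^esub> ?M #>\<^bsub>GG\<^esub> inv\<^bsub>GG\<^esub> ?x = ?M"
        by (auto simp: normalizer_M0_def norm_iff)
      \<comment> \<open>The regular test element: its determinant \<open>- 1\<close> has norm 1
        since the degree is 2, and every embedding fixes its entries.\<close>
      have "to_geom E2 E4 (mat2 (- 1) 0 0 1, 1) \<in> carrier GG"
      proof (rule to_geom_carrier)
        have "field_norm E2 (- 1) = 1" using F2.field_norm_to_ac[of "- 1"] by simp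
        moreover have "mat2 (- 1) 0 0 1 $ i $ j \<in> E2" for i j :: 2
          using exhaust_2[of i] exhaust_2[of j] by auto
        ultimately show "(mat2 (- 1) 0 0 1, 1) \<in> carrier G" by (auto simp: carrier_G det_mat2)
      qed
      moreover have "(\<chi> i j. \<sigma> (mat2 (- 1) 0 0 1 $ i $ j)) = mat2 (- 1) 0 0 1"
        if "\<sigma> \<in> embeddings E2" for \<sigma>
      proof -
        have "\<sigma> (to_ac a) = to_ac a" for a using that by (simp add: embeddings_def)
        from this[of 0] this[of 1] this[of "- 1"] show ?thesis by (simp add: vec_eq_iff forall_2)
      qed
      ultimately have t: "(\<lambda>\<sigma>\<in>embeddings E2. mat2 (- 1) 0 0 1, \<lambda>\<tau>\<in>embeddings E4. \<tau> 1) \<in> ?M"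
        (is "?t \<in> _")
        by (auto simp: M0_geom_def to_geom_def diagonal_def cong: restrict_cong)
      let ?y = "?x \<otimes>\<^bsub>GG\<^esub> ?t \<otimes>\<^bsub>GG\<^esub> inv\<^bsub>GG\<^esub> ?x"
      have "?y \<in> ?x <#\<^bsub>GG\<^esub> ?M #>\<^bsub>GG\<^esub> inv\<^bsub>GG\<^esub> ?x" using t by (auto simp: l_coset_def r_coset_def)
      then have y: "?y \<in> ?M" using eq by simp
      have yx: "?y \<otimes>\<^bsub>GG\<^esub> ?x = ?x \<otimes>\<^bsub>GG\<^esub> ?t"
        using x_in t M by (simp add: GG.m_assoc subset_iff)
      obtain y1 y2 where y12: "?y = (y1, y2)" by (cases ?y)
      let ?i = "\<lambda>x\<in>E2. x"
      have i: "?i \<in> embeddings E2" by (rule F2.identity_embedding)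
      have gi: "?g ?i = g" using g(1) by (simp add: vec_eq_iff)
      have "y1 ?i ** g = g ** mat2 (- 1) 0 0 1"
      proof -
        have "(y1, y2) \<otimes>\<^bsub>GG\<^esub> ?x = ?x \<otimes>\<^bsub>GG\<^esub> ?t" using yx unfolding y12 .
        from fun_cong[OF arg_cong[OF this[unfolded x mult_GG], of fst], of ?i]
        have "y1 ?i ** ?g ?i = ?g ?i ** mat2 (- 1) 0 0 1" using i by (simp only: fst_conv restrict_apply if_True)
        then show ?thesis unfolding gi .
      qed
      moreover have "diagonal (y1 ?i)" using y i unfolding y12 M0_geom_def by auto
      ultimately have "diagonal g \<or> antidiagonal g"
        using conjugate_diagonal_monomial[OF g(2)] neg_one_neq_one_ac by blast
      then show "n \<in> monomial" using True by (auto simp: monomial_def n)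
    next
      assume "n \<in> monomial"
      then have mono: "diagonal (?g \<sigma>) \<or> antidiagonal (?g \<sigma>)" if "\<sigma> \<in> embeddings E2" for \<sigma>
        using F2.embeddings_hom(4)[OF that F2.ext_closed(3,3)]
        by (auto simp: monomial_def n diagonal_def antidiagonal_def)
      have diag: "y \<in> ?M" if y: "y \<in> carrier GG" and t: "t \<in> ?M"
        and eq: "y \<otimes>\<^bsub>GG\<^esub> ?x = ?x \<otimes>\<^bsub>GG\<^esub> t \<or> ?x \<otimes>\<^bsub>GG\<^esub> y = t \<otimes>\<^bsub>GG\<^esub> ?x" for y t
      proof -
        obtain y1 y2 t1 t2 where yt: "y = (y1, y2)" "t = (t1, t2)" by (cases y, cases t)
        have "diagonal (y1 \<sigma>)" if \<sigma>: "\<sigma> \<in> embeddings E2" for \<sigma>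
        proof (rule monomial_conjugate_diagonal[OF det[OF \<sigma>] mono[OF \<sigma>]])
          show "diagonal (t1 \<sigma>)" using t \<sigma> by (auto simp: M0_geom_def yt)
          show "y1 \<sigma> ** ?g \<sigma> = ?g \<sigma> ** t1 \<sigma> \<or> ?g \<sigma> ** y1 \<sigma> = t1 \<sigma> ** ?g \<sigma>"
            using eq \<sigma> unfolding yt x mult_GG by (auto dest: fun_cong[of _ _ \<sigma>])
        qed
        then show ?thesis using y by (auto simp: M0_geom_def yt)
      qed
      have "?x <#\<^bsub>GG\<^esub> ?M #>\<^bsub>GG\<^esub> inv\<^bsub>GG\<^esub> ?x = ?M"
      proof (rule GG.conjugation_eqI[OF x_in M])
        fix t assume t: "t \<in> ?M"
        then have tG: "t \<in> carrier GG" using M by blast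
        show "?x \<otimes>\<^bsub>GG\<^esub> t \<otimes>\<^bsub>GG\<^esub> inv\<^bsub>GG\<^esub> ?x \<in> ?M"
          using x_in tG by (intro diag[OF _ t]) (auto simp: GG.m_assoc)
        show "inv\<^bsub>GG\<^esub> ?x \<otimes>\<^bsub>GG\<^esub> t \<otimes>\<^bsub>GG\<^esub> ?x \<in> ?M"
          using x_in tG by (intro diag[OF _ t]) (auto simp: GG.m_assoc[symmetric])
      qed
      then show "n \<in> normalizer_M0 E2 E4"
        using True x_in by (auto simp: normalizer_M0_def norm_iff)
    qed
  qed
  then show ?thesis by blast
qed

end

section \<open>Monomial elements and their invariants\<close>

locale depth_zero_type = tame_local_field v p q \<zeta> + two_extensions v w c "\<zeta> * c" \<pi>2 \<pi>4
  for v :: "'a::field \<Rightarrow> int" and p q :: nat and \<zeta> w c :: 'a and \<pi>2 \<pi>4 :: "'a alg_closure" +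
  fixes \<eta> :: "'a \<Rightarrow> complex"
  assumes \<eta>_hom: "\<eta> \<in> hom (GL1 UNIV) (GL1 UNIV)" and \<eta>_one_units: "\<forall>x \<in> prime_ideal v. \<eta> (1 + x) = 1"
    and \<eta>_\<zeta>: "\<eta> \<zeta> ^ 2 = - 1"
begin

lemma \<eta>_mult: "x \<noteq> 0 \<Longrightarrow> y \<noteq> 0 \<Longrightarrow> \<eta> (x * y) = \<eta> x * \<eta> y"
  using \<eta>_hom by (auto simp: hom_def GL1_def)

lemma \<eta>_nonzero: "x \<noteq> 0 \<Longrightarrow> \<eta> x \<noteq> 0"
  using \<eta>_hom by (auto simp: hom_def GL1_def)

lemma \<eta>_power: "x \<noteq> 0 \<Longrightarrow> \<eta> (x ^ n) = \<eta> x ^ n"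
proof (induction n)
  case 0
  show ?case using \<eta>_one_units[rule_format, of 0] by simp
qed (simp add: \<eta>_mult)

lemma \<eta>_rescong:
  assumes "rescong a b" "unit b" shows "\<eta> a = \<eta> b"
proof -
  have b: "b \<noteq> 0" and a: "a \<noteq> 0" using assms rescong_unit unit_nonzero by blast+
  have "inverse b * (a - b) \<in> prime_ideal v"
    using assms unit_integers by (auto simp: rescong_def)
  then have "\<eta> (1 + inverse b * (a - b)) = 1" using \<eta>_one_units by blast
  moreover have "1 + inverse b * (a - b) = inverse b * a" using b by (simp add: field_simps)
  moreover have "b * (inverse b * a) = a" using b by simp
  ultimately have 1: "\<eta> (inverse b * a) = 1" by simp
  have "b * (inverse b * a) = a" using b by simp
  then have "\<eta> a = \<eta> (b * (inverse b * a))" by (simp only:)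
  also have "\<dots> = \<eta> b * \<eta> (inverse b * a)" using a b by (intro \<eta>_mult) auto
  finally show ?thesis using 1 by simp
qed

text \<open>A unit is congruent to a power of \<zeta>, and \<eta> sends \<zeta> to a fourth root of
  unity.\<close>

lemma \<eta>_unit_power_4:
  assumes "unit u" shows "\<eta> u ^ 4 = 1"
proof -
  obtain k where "rescong u (\<zeta> ^ k)" using unit_rescong_\<zeta>_power[OF assms] .
  then have "\<eta> u = \<eta> \<zeta> ^ k"
    using \<eta>_rescong \<eta>_power unit_\<zeta> unit_nonzero by (metis unit_closed(5))
  moreover have "\<eta> \<zeta> ^ 4 = 1"
  proof -
    have "\<eta> \<zeta> ^ 4 = (\<eta> \<zeta> ^ 2) ^ 2" by (simp flip: power_mult)
    then show ?thesis by (simp add: \<eta>_\<zeta>)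
  qed
  ultimately show ?thesis by (metis mult.commute power_mult power_one)
qed

text \<open>
  The monomial matrix with entries \<open>x\<close>, \<open>y\<close> in the two rows, of valuations \<open>m + k\<close> and \<open>m - k\<close>.
  The congruence compares the residue classes of \<open>det g\<close> and of \<open>h\<^sup>2\<close>, up to powers of
  the uniformisers; membership in \<open>G0\<close> only determines it up to the sign \<open>s\<close>.
\<close>

definition invariants :: "'a point \<Rightarrow> int \<times> bool \<Rightarrow> int \<Rightarrow> 'a \<Rightarrow> bool" where
  "invariants n d m s \<longleftrightarrow> n \<in> carrier G \<and> (s = 1 \<or> s = - 1) \<and>
     (\<exists>x y h a b r. n = (if snd d then mat2 0 x y 0 else mat2 x 0 0 y, h) \<and>
        F2.has_lead x (m + fst d) a \<and> F2.has_lead y (m - fst d) b \<and> F4.has_lead h (- 2 * m) r \<and>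
        rescong ((if snd d then - 1 else 1) * (a * b * r ^ 2)) (s * \<zeta> powi m))"

lemma invariantsI:
  assumes "(if f then mat2 0 x y 0 else mat2 x 0 0 y, h) \<in> carrier G"
    and "F2.has_lead x (m + k) a" "F2.has_lead y (m - k) b" "F4.has_lead h (- 2 * m) r"
    and "s = 1 \<or> s = - 1"
    and "rescong ((if f then - 1 else 1) * (a * b * r ^ 2)) (s * \<zeta> powi m)"
  shows "invariants (if f then mat2 0 x y 0 else mat2 x 0 0 y, h) (k, f) m s"
  unfolding invariants_def fst_conv snd_conv using assms by blast

lemma sign_unit: "s = 1 \<or> s = - 1 \<Longrightarrow> unit s"
  by auto

lemma field_norm_sign: "s = 1 \<or> s = - 1 \<Longrightarrow> field_norm E2 (to_ac s) = 1"
  using F2.field_norm_to_ac[of s] by auto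

lemma has_lead_unit: "F2.has_lead x n a \<Longrightarrow> unit a" "F4.has_lead h n a \<Longrightarrow> unit a"
  by (simp_all add: F2.has_lead_def F4.has_lead_def)

text \<open>Fermat's little theorem in the residue field, through the powers of \<zeta>.\<close>

lemma unit_power_q:
  assumes "unit t" shows "rescong (t ^ (q - 1)) 1"
proof -
  obtain k where "rescong t (\<zeta> ^ k)" using unit_rescong_\<zeta>_power[OF assms] .
  then have "rescong (t ^ (q - 1)) ((\<zeta> ^ k) ^ (q - 1))"
    by (rule rescong_power) (auto intro: unit_integers)
  moreover have "(\<zeta> ^ k) ^ (q - 1) = 1"
    by (metis \<zeta>_root mult.commute power_mult power_one)
  ultimately show ?thesis by simp
qed

lemma invariants_exist:
  assumes "n \<in> monomial" obtains d m s where "invariants n d m s"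
proof -
  obtain g h where n: "n = (g, h)" by (cases n)
  have G: "(g, h) \<in> carrier G" using assms by (simp add: monomial_def n)
  have gE: "g $ i $ j \<in> E2" for i j using G by (auto simp: carrier_G)
  have det: "det g \<noteq> 0" and h: "h \<in> E4" "h \<noteq> 0"
    and norm: "field_norm E2 (det g) * field_norm E4 h = 1"
    using G by (auto simp: carrier_G)
  obtain f x y where g: "g = (if f then mat2 0 x y 0 else mat2 x 0 0 y)" and xy: "x \<in> E2" "y \<in> E2"
  proof (cases "diagonal g")
    case True
    then have "g = mat2 (g $ 1 $ 1) 0 0 (g $ 2 $ 2)" using mat2_eta[of g] by (simp add: diagonal_def)
    then show ?thesis using that[of False] gE by auto
  next
    case False
    then have "g = mat2 0 (g $ 1 $ 2) (g $ 2 $ 1) 0"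
      using mat2_eta[of g] assms by (simp add: monomial_def n antidiagonal_def)
    then show ?thesis using that[of True] gE by auto
  qed
  \<comment> \<open>The sign of the permutation. It changes the determinant but not its norm, the
    degree being 2.\<close>
  define \<delta> :: 'a where "\<delta> = (if f then - 1 else 1)"
  have \<delta>: "\<delta> = 1 \<or> \<delta> = - 1" "\<delta> ^ 2 = 1" by (auto simp: \<delta>_def)
  have det_g: "det g = to_ac \<delta> * (x * y)" by (simp add: g det_mat2 \<delta>_def)
  have nz: "x \<noteq> 0" "y \<noteq> 0" using det det_g by auto
  obtain n1 a where lx: "F2.has_lead x n1 a" using F2.has_lead_exists xy nz by blast
  obtain n2 b where ly: "F2.has_lead y n2 b" using F2.has_lead_exists xy nz by blast
  obtain l r where lh: "F4.has_lead h l r" using F4.has_lead_exists h by blast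
  have u: "unit a" "unit b" "unit r" using has_lead_unit lx ly lh by blast+
  obtain ua where ua: "field_norm E2 x = c powi n1 * ua" "rescong ua (a ^ 2)" "unit ua"
    using F2.has_lead_norm[OF lx] by metis
  obtain ub where ub: "field_norm E2 y = c powi n2 * ub" "rescong ub (b ^ 2)" "unit ub"
    using F2.has_lead_norm[OF ly] by metis
  obtain ur where ur: "field_norm E4 h = (\<zeta> * c) powi l * ur" "rescong ur (r ^ 4)" "unit ur"
    using F4.has_lead_norm[OF lh] by metis
  have "field_norm E2 (det g) = field_norm E2 x * field_norm E2 y"
    using xy field_norm_sign[OF \<delta>(1)] by (simp add: det_g F2.field_norm_mult)
  then have N: "field_norm E2 x * field_norm E2 y * field_norm E4 h = 1" using norm by simp
  have nzN: "field_norm E2 x \<noteq> 0" "field_norm E2 y \<noteq> 0" "field_norm E4 h \<noteq> 0" using N by auto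
  have "v (field_norm E2 x * field_norm E2 y * field_norm E4 h) = n1 + n2 + l"
    using nzN F2.v_field_norm[OF lx] F2.v_field_norm[OF ly] F4.v_field_norm[OF lh] by (simp add: v_mult)
  then have l: "l = - (n1 + n2)" using N by simp
  have c0: "c \<noteq> 0" using F2.c_nonzero .
  have z0: "\<zeta> \<noteq> 0" using unit_\<zeta> unit_nonzero by blast
  let ?t = "\<delta> * (a * b * r ^ 2)" and ?L = "n1 + n2"
  have ut: "unit ?t" using u sign_unit[OF \<delta>(1)] by auto
  have "c powi n1 * c powi n2 * c powi l = 1" using c0 by (simp add: l flip: power_int_add)
  \<comment> \<open>The power of \<zeta> comes from the quartic component alone, whose uniformiser
    has norm \<open>\<zeta> * c\<close>.\<close>
  moreover have "\<zeta> powi l * (ua * ub * ur) * (c powi n1 * c powi n2 * c powi l) = 1"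
    using N by (simp add: ua(1) ub(1) ur(1) power_int_mult_distrib algebra_simps)
  ultimately have "\<zeta> powi l * (ua * ub * ur) = 1" by simp
  moreover have "\<zeta> powi ?L * \<zeta> powi l = 1" using z0 by (simp add: l flip: power_int_add)
  ultimately have "\<zeta> powi ?L = ua * ub * ur"
    by (metis mult.assoc mult.right_neutral mult_1)
  moreover have "rescong (ua * ub * ur) (a ^ 2 * b ^ 2 * r ^ 4)"
    using ua ub ur u unit_integers by (intro rescong_mult) auto
  moreover have "?t ^ 2 = a ^ 2 * b ^ 2 * r ^ 4"
    using \<delta>(2) by (simp add: power_mult_distrib flip: power_mult)
  ultimately have tL: "rescong (?t ^ 2) (\<zeta> powi ?L)" using rescong_sym by simp
  \<comment> \<open>odd powers of \<open>\<zeta>\<close> are not squares in the residue field\<close>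
  have "even ?L"
  proof (rule ccontr)
    assume odd: "odd ?L"
    let ?H = "(q - 1) div 2"
    have "2 * ?H = q - 1" using q_mod_4 by presburger
    then have "(?t ^ 2) ^ ?H = ?t ^ (q - 1)" by (simp flip: power_mult)
    then have "rescong ((?t ^ 2) ^ ?H) 1" using unit_power_q[OF ut] by simp
    moreover have "rescong ((?t ^ 2) ^ ?H) ((\<zeta> powi ?L) ^ ?H)"
      using tL by (rule rescong_power) (auto intro: unit_integers)
    moreover have "(\<zeta> powi ?L) ^ ?H = (\<zeta> ^ ?H) powi ?L"
      by (metis mult.commute power_int_mult power_int_of_nat)
    moreover have "(- 1) powi ?L = (- 1 :: 'a)" using odd by (simp add: power_int_minus_left)
    ultimately have "rescong 1 (- 1)"
      using \<zeta>_half_power rescong_sym rescong_trans by metis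
    then show False using two_unit by blast
  qed
  then obtain m where m: "?L = 2 * m" by blast
  have "\<zeta> powi (m + m) = \<zeta> powi m * \<zeta> powi m" using z0 by (intro power_int_add) auto
  then have "\<zeta> powi ?L = (\<zeta> powi m) ^ 2" unfolding m mult_2 power2_eq_square .
  \<comment> \<open>Dividing by one square root of \<open>\<zeta> powi ?L\<close> leaves an element
    whose square is congruent to 1, hence a sign.\<close>
  then have "rescong ((?t * inverse (\<zeta> powi m)) ^ 2) ((\<zeta> powi m) ^ 2 * inverse (\<zeta> powi m) ^ 2)"
    using tL unfolding power_mult_distrib[of _ "inverse _"]
    by (intro rescong_mult) (auto intro: unit_integers)
  moreover have "(\<zeta> powi m) ^ 2 * inverse (\<zeta> powi m) ^ 2 = 1"
    using z0 by (simp flip: power_mult_distrib)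
  ultimately have "rescong ((?t * inverse (\<zeta> powi m)) ^ 2) 1" by simp
  then obtain s where s: "s = 1 \<or> s = - 1" "rescong (?t * inverse (\<zeta> powi m)) s"
    using rescong_square_1[of "?t * inverse (\<zeta> powi m)"] ut unit_integers by (metis unit_closed(3,4) unit_power_int unit_\<zeta>)
  have "rescong (?t * inverse (\<zeta> powi m) * \<zeta> powi m) (s * \<zeta> powi m)"
    using s sign_unit[OF s(1)] by (intro rescong_mult) (auto intro: unit_integers)
  moreover have "?t * inverse (\<zeta> powi m) * \<zeta> powi m = ?t" using z0 by (simp add: mult.assoc)
  ultimately have "rescong ?t (s * \<zeta> powi m)" by (simp only:)
  moreover have "m + (n1 - m) = n1" "m - (n1 - m) = n2" "- 2 * m = l" using m l by auto
  ultimately have "invariants n (n1 - m, f) m s"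
    using invariantsI[of f x y h m "n1 - m" a b r s] lx ly lh s(1) G by (simp add: n g \<delta>_def)
  then show ?thesis by (rule that)
qed

text \<open>A nonzero \<open>x\<close> tells the diagonal from the antidiagonal shape, uniqueness of
  leading terms gives the integers, and 1 and \<open>- 1\<close> are not congruent.\<close>

lemma invariants_unique:
  assumes "invariants n d m s" "invariants n d' m' s'" shows "d = d'" "m = m'" "s = s'"
proof -
  obtain k f k' f' where d: "d = (k, f)" "d' = (k', f')" by (cases d, cases d')
  obtain x y h a b r where 1: "n = (if f then mat2 0 x y 0 else mat2 x 0 0 y, h)"
    "F2.has_lead x (m + k) a" "F2.has_lead y (m - k) b" "F4.has_lead h (- 2 * m) r"
    "rescong ((if f then - 1 else 1) * (a * b * r ^ 2)) (s * \<zeta> powi m)" "s = 1 \<or> s = - 1"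
    using assms(1) by (auto simp: invariants_def d)
  obtain x' y' h' a' b' r' where 2: "n = (if f' then mat2 0 x' y' 0 else mat2 x' 0 0 y', h')"
    "F2.has_lead x' (m' + k') a'" "F2.has_lead y' (m' - k') b'" "F4.has_lead h' (- 2 * m') r'"
    "rescong ((if f' then - 1 else 1) * (a' * b' * r' ^ 2)) (s' * \<zeta> powi m')" "s' = 1 \<or> s' = - 1"
    using assms(2) by (auto simp: invariants_def d)
  have "x \<noteq> 0" "x' \<noteq> 0" using 1 2 F2.has_lead_norm by metis+
  then have f: "f = f'" and eq: "x = x'" "y = y'" "h = h'"
    using 1(1) 2(1) by (auto simp: mat2_eq_iff split: if_splits)
  note lead' = 2(2-4)[folded eq]
  have "m + k = m' + k'" "m - k = m' - k'" and ab: "rescong a a'" "rescong b b'" "rescong r r'"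
    using F2.has_lead_unique[OF 1(2) lead'(1)] F2.has_lead_unique[OF 1(3) lead'(2)]
      F4.has_lead_unique[OF 1(4) lead'(3)] by blast+
  then have mk: "m = m'" "k = k'" by auto
  then show "d = d'" "m = m'" using d f by auto
  have u: "unit a'" "unit b'" "unit r'" using has_lead_unit 2 by blast+
  then have "rescong ((if f then - 1 else 1) * (a * b * r ^ 2)) ((if f then - 1 else 1) * (a' * b' * r' ^ 2))"
    using ab unit_integers by (intro rescong_mult rescong_power) (auto intro!: unit_integers)
  from rescong_trans[OF rescong_sym[OF 1(5)] rescong_trans[OF this 2(5)[folded f mk]]]
  have "rescong (\<zeta> powi m * s) (\<zeta> powi m * s')"
    by (simp only: mult.commute[of "\<zeta> powi m"])
  then have "rescong s s'" using rescong_cancel by blast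
  then show "s = s'" using 1(6) 2(6) two_unit rescong_sym by auto
qed

text \<open>An antidiagonal left factor uses the rows of the right factor in swapped order, so
  \<open>k'\<close> enters with opposite sign: this is the law of \<open>dihedral\<close>.
  Permutation signs, residues and powers of \<zeta> simply multiply.\<close>

lemma invariants_mult:
  assumes "invariants n d m s" "invariants n' d' m' s'"
  shows "invariants (n \<otimes>\<^bsub>G\<^esub> n') (d \<otimes>\<^bsub>dihedral\<^esub> d') (m + m') (s * s')"
proof -
  interpret G: group G by (rule group_G)
  obtain k f k' f' where d: "d = (k, f)" "d' = (k', f')" by (cases d, cases d')
  obtain x y h a b r where 1: "n = (if f then mat2 0 x y 0 else mat2 x 0 0 y, h)"
    "F2.has_lead x (m + k) a" "F2.has_lead y (m - k) b" "F4.has_lead h (- 2 * m) r"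
    "rescong ((if f then - 1 else 1) * (a * b * r ^ 2)) (s * \<zeta> powi m)" "s = 1 \<or> s = - 1"
    using assms(1) by (auto simp: invariants_def d)
  obtain x' y' h' a' b' r' where 2: "n' = (if f' then mat2 0 x' y' 0 else mat2 x' 0 0 y', h')"
    "F2.has_lead x' (m' + k') a'" "F2.has_lead y' (m' - k') b'" "F4.has_lead h' (- 2 * m') r'"
    "rescong ((if f' then - 1 else 1) * (a' * b' * r' ^ 2)) (s' * \<zeta> powi m')" "s' = 1 \<or> s' = - 1"
    using assms(2) by (auto simp: invariants_def d)
  let ?x' = "if f then y' else x'" and ?y' = "if f then x' else y'"
  let ?a' = "if f then b' else a'" and ?b' = "if f then a' else b'"
  let ?d = "d \<otimes>\<^bsub>dihedral\<^esub> d'"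
  have "n \<otimes>\<^bsub>G\<^esub> n' \<in> carrier G" using assms by (auto simp: invariants_def)
  moreover have "s * s' = 1 \<or> s * s' = - 1" using 1(6) 2(6) by auto
  moreover have "n \<otimes>\<^bsub>G\<^esub> n' =
      (if snd ?d then mat2 0 (x * ?x') (y * ?y') 0 else mat2 (x * ?x') 0 0 (y * ?y'), h * h')"
    by (simp add: 1(1) 2(1) d mat2_mult)
  moreover have "F2.has_lead (x * ?x') (m + m' + fst ?d) (a * ?a')"
    using F2.has_lead_mult[OF 1(2) 2(2)] F2.has_lead_mult[OF 1(2) 2(3)]
    by (cases f) (simp_all add: d algebra_simps)
  moreover have "F2.has_lead (y * ?y') (m + m' - fst ?d) (b * ?b')"
    using F2.has_lead_mult[OF 1(3) 2(2)] F2.has_lead_mult[OF 1(3) 2(3)]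
    by (cases f) (simp_all add: d algebra_simps)
  moreover have "F4.has_lead (h * h') (- 2 * (m + m')) (r * r')"
    using F4.has_lead_mult[OF 1(4) 2(4)] by (simp add: algebra_simps)
  moreover have "rescong ((if snd ?d then - 1 else 1) * (a * ?a' * (b * ?b') * (r * r') ^ 2))
      (s * s' * \<zeta> powi (m + m'))"
  proof -
    have "\<zeta> \<noteq> 0" using unit_\<zeta> unit_nonzero by blast
    then have eq1: "s * s' * \<zeta> powi (m + m') = s * \<zeta> powi m * (s' * \<zeta> powi m')"
      by (simp add: power_int_add)
    have eq2: "(if snd ?d then - 1 else 1) * (a * ?a' * (b * ?b') * (r * r') ^ 2)
      = (if f then - 1 else 1) * (a * b * r ^ 2) * ((if f' then - 1 else 1) * (a' * b' * r' ^ 2))"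
      by (cases f; cases f') (simp_all add: d algebra_simps)
    have "unit s" "unit s'" using 1(6) 2(6) sign_unit by blast+
    then show ?thesis
      unfolding eq1 eq2 by (intro rescong_mult[OF 1(5) 2(5)]) (auto intro: unit_integers)
  qed
  ultimately show ?thesis unfolding invariants_def by blast
qed

lemma invariants_monomial: "invariants n d m s \<Longrightarrow> n \<in> monomial"
  by (auto simp: invariants_def monomial_def diagonal_def antidiagonal_def)

lemma group_monomial: "group (G\<lparr>carrier := monomial\<rparr>)"
proof -
  interpret G: group G by (rule group_G)
  have "subgroup monomial G"
  proof (rule G.subgroupI)
    show "monomial \<subseteq> carrier G" by (auto simp: monomial_def)
    have "\<one>\<^bsub>G\<^esub> \<in> monomial" using G.one_closed by (auto simp: monomial_def one_G diagonal_def mat_def)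
    then show "monomial \<noteq> {}" by blast
    show "n \<otimes>\<^bsub>G\<^esub> n' \<in> monomial" if "n \<in> monomial" "n' \<in> monomial" for n n'
      using that invariants_exist invariants_mult invariants_monomial by metis
    show "inv\<^bsub>G\<^esub> n \<in> monomial" if n: "n \<in> monomial" for n
    proof -
      obtain g h g' h' where gh: "n = (g, h)" "inv\<^bsub>G\<^esub> n = (g', h')" by (cases n, cases "inv\<^bsub>G\<^esub> n")
      have nG: "n \<in> carrier G" using n by (auto simp: monomial_def)
      have "g ** g' = mat 1" using G.r_inv[OF nG] gh by (simp add: one_G)
      moreover have "det g \<noteq> 0" "diagonal g \<or> antidiagonal g"
        using n by (auto simp: gh monomial_def carrier_G)
      ultimately have "diagonal g' \<or> antidiagonal g'"
        by (auto simp: diagonal_def antidiagonal_def vec_eq_iff forall_2 matrix_mult_2_nth det_2 mat_def)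
      then show ?thesis using G.inv_closed[OF nG] unfolding gh(2) monomial_def by simp
    qed
  qed
  then show ?thesis by (rule G.subgroup_imp_group)
qed

section \<open>Compact subgroups of the torus and the stabiliser of the character\<close>

abbreviation "K_st_M \<equiv> K_M E2 E4 (K_st v E2 E4)"
abbreviation "K_par_M \<equiv> K_M E2 E4 (K_par v E2 E4)"

text \<open>Units are the elements of leading exponent 0, so \<open>m + k\<close> and
  \<open>m - k\<close> vanish, and with them \<open>m\<close> and \<open>k\<close>; the sign stays
  free.\<close>

lemma in_K_st_M: "n \<in> K_st_M \<longleftrightarrow> (\<exists>s. invariants n (0, False) 0 s)"
proof
  assume n: "n \<in> K_st_M"
  then have "n \<in> monomial" by (auto simp: K_M_def M0_def monomial_def)
  then obtain d m s where inv: "invariants n d m s" by (rule invariants_exist)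
  obtain x y h a b r where 1: "n = (if snd d then mat2 0 x y 0 else mat2 x 0 0 y, h)"
    "F2.has_lead x (m + fst d) a" "F2.has_lead y (m - fst d) b"
    using inv by (auto simp: invariants_def)
  have "x \<noteq> 0" using 1 F2.has_lead_norm by metis
  then have f: "\<not> snd d" using n 1(1) by (auto simp: K_M_def M0_def diagonal_def)
  then obtain a' b' where "F2.has_lead x 0 a'" "F2.has_lead y 0 b'"
    using n 1(1) by (auto simp: K_M_def K_st_def iwahori_def F2.ext_units_iff)
  then have "m + fst d = 0" "m - fst d = 0" using F2.has_lead_unique(1) 1 by blast+
  then have "d = (0, False)" "m = 0" using f by (auto simp: prod_eq_iff)
  then show "\<exists>s. invariants n (0, False) 0 s" using inv by blast
next
  assume "\<exists>s. invariants n (0, False) 0 s"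
  then obtain x y h a b r where 1: "n = (mat2 x 0 0 y, h)" "n \<in> carrier G"
    "F2.has_lead x 0 a" "F2.has_lead y 0 b" "F4.has_lead h 0 r"
    by (auto simp: invariants_def)
  then have "x \<in> ext_units v E2" "y \<in> ext_units v E2" "h \<in> ext_units v E4"
    using F2.ext_units_iff F4.ext_units_iff by blast+
  moreover have "mat2 x 0 0 y \<in> carrier (GL2 E2)" using 1(1,2) by (simp add: G0_def)
  ultimately show "n \<in> K_st_M"
    using 1(1,2) F2.zero_ext_prime_ideal by (auto simp: K_M_def K_st_def M0_def iwahori_def diagonal_def)
qed

text \<open>For \<open>m = 0\<close> and a diagonal matrix, the sign is the residue of the
  determinant times \<open>h ^ 2\<close>, the very quantity that the parahoric condition sets to
  1.\<close>

lemma in_K_par_M: "n \<in> K_par_M \<longleftrightarrow> invariants n (0, False) 0 1"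
proof -
  have par: "n \<in> K_par_M \<longleftrightarrow> s = 1" if inv: "invariants n (0, False) 0 s" for s
  proof -
    obtain x y h a b r where 1: "n = (mat2 x 0 0 y, h)" "n \<in> carrier G"
      "F2.has_lead x 0 a" "F2.has_lead y 0 b" "F4.has_lead h 0 r" "rescong (a * b * r ^ 2) s"
      using inv by (auto simp: invariants_def)
    have s: "s = 1 \<or> s = - 1" using inv by (simp add: invariants_def)
    have u: "a \<in> integers v" "b \<in> integers v" "r \<in> integers v" using 1 has_lead_unit unit_integers by blast+
    have "F2.has_lead (det (mat2 x 0 0 y)) 0 (a * b)"
      using F2.has_lead_mult[OF 1(3,4)] by (simp add: det_mat2)
    then have "reduction v E2 (det (mat2 x 0 0 y)) = residue_class (a * b)" by (rule F2.reduction_ext)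
    moreover have "reduction v E4 h = residue_class r" using 1(5) by (rule F4.reduction_ext)
    moreover have "residue_class r [^]\<^bsub>residue_field v\<^esub> (2::nat) = residue_class (r ^ 2)"
      using u by (simp add: numeral_2_eq_2 residue_one residue_mult nat_pow_def)
    ultimately have "reduction v E2 (det (mat2 x 0 0 y)) \<otimes>\<^bsub>residue_field v\<^esub>
        (reduction v E4 h [^]\<^bsub>residue_field v\<^esub> (2::nat)) = residue_class (a * b * r ^ 2)"
      using u by (simp add: residue_mult integers_power)
    moreover have "residue_class (a * b * r ^ 2) = residue_class 1 \<longleftrightarrow> s = 1"
    proof -
      have "residue_class (a * b * r ^ 2) = residue_class 1 \<longleftrightarrow> rescong 1 s"
        using 1(6) rescong_sym rescong_trans unfolding residue_class_eq_iff by blast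
      then show ?thesis using s two_unit by auto
    qed
    ultimately have "n \<in> K_par v E2 E4 \<longleftrightarrow> n \<in> K_st v E2 E4 \<and> s = 1"
      by (simp add: K_par_def 1(1) residue_one)
    moreover have "n \<in> K_st_M" using in_K_st_M inv by blast
    ultimately show ?thesis unfolding K_M_def by blast
  qed
  show ?thesis
  proof
    assume n: "n \<in> K_par_M"
    then have "n \<in> K_st_M" by (auto simp: K_M_def K_par_def)
    then show "invariants n (0, False) 0 1" using n par in_K_st_M by metis
  qed (use par in blast)
qed

text \<open>The norm of \<open>h\<close> is congruent to a fourth power, which \<eta> kills; \<eta>
  of the norm of \<open>x\<close> squares to 1, so a product equal to 1 means equality.\<close>

lemma rho_swap:
  assumes "invariants (mat2 x 0 0 y, h) (0, False) 0 s"
  shows "\<eta> (field_norm E2 x) = \<eta> (field_norm E2 y)"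
proof -
  obtain a b r where l: "F2.has_lead x 0 a" "F2.has_lead y 0 b" "F4.has_lead h 0 r"
    and G: "(mat2 x 0 0 y, h) \<in> carrier G"
    using assms by (auto simp: invariants_def mat2_eq_iff)
  have u: "unit a" "unit b" "unit r" using l has_lead_unit by blast+
  obtain ua where ua: "field_norm E2 x = ua" "rescong ua (a ^ 2)" "unit ua" "x \<in> E2"
    using F2.has_lead_norm[OF l(1)] by (metis mult_1 power_int_0_right)
  obtain ub where ub: "field_norm E2 y = ub" "rescong ub (b ^ 2)" "unit ub" "y \<in> E2"
    using F2.has_lead_norm[OF l(2)] by (metis mult_1 power_int_0_right)
  obtain ur where ur: "field_norm E4 h = ur" "rescong ur (r ^ 4)" "unit ur"
    using F4.has_lead_norm[OF l(3)] by (metis mult_1 power_int_0_right)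
  have nz: "ua \<noteq> 0" "ub \<noteq> 0" "ur \<noteq> 0" "a \<noteq> 0" "r \<noteq> 0" using ua ub ur u unit_nonzero by blast+
  have "field_norm E2 (x * y) * field_norm E4 h = 1" using G by (simp add: carrier_G det_mat2)
  then have "ua * ub * ur = 1" using ua ub ur by (simp add: F2.field_norm_mult)
  then have "\<eta> ua * \<eta> ub * \<eta> ur = 1"
    using nz \<eta>_power[of 1 0] by (simp flip: \<eta>_mult)
  moreover have "\<eta> ur = 1"
    using \<eta>_rescong[OF ur(2)] u nz \<eta>_unit_power_4 by (simp add: \<eta>_power)
  moreover have "\<eta> ua * \<eta> ua = 1"
  proof -
    have "\<eta> ua = \<eta> a ^ 2" using \<eta>_rescong[OF ua(2)] u nz by (simp add: \<eta>_power)
    then show ?thesis using \<eta>_unit_power_4[OF u(1)] by (simp flip: power_add)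
  qed
  ultimately have "\<eta> ua * \<eta> ub = \<eta> ua * \<eta> ua" by simp
  then show ?thesis using \<eta>_nonzero[OF nz(1)] ua ub by simp
qed

text \<open>Conjugation by a monomial element fixes \<open>x\<close> or swaps its two diagonal
  entries. The swap preserves the sign, hence membership in either compact group, and preserves the
  character by \<open>rho_swap\<close>.\<close>

lemma N_rho_eq:
  assumes K: "K_M E2 E4 K = K_st_M \<or> K_M E2 E4 K = K_par_M"
  shows "N_rho \<eta> E2 E4 K = monomial"
proof -
  interpret G: group G by (rule group_G)
  let ?K = "K_M E2 E4 K"
  have inv: "\<exists>s. invariants x (0, False) 0 s" if "x \<in> ?K" for x
    using K that in_K_st_M in_K_par_M by metis
  have K_iff: "x \<in> ?K \<longleftrightarrow> y \<in> ?K" if "invariants x (0, False) 0 s" "invariants y (0, False) 0 s" for x y s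
    using K in_K_st_M in_K_par_M that invariants_unique(3) by metis
  have KG: "?K \<subseteq> carrier G" using inv by (auto simp: invariants_def)
  have conj: "inv\<^bsub>G\<^esub> n \<otimes>\<^bsub>G\<^esub> x \<otimes>\<^bsub>G\<^esub> n \<in> ?K \<and> n \<otimes>\<^bsub>G\<^esub> x \<otimes>\<^bsub>G\<^esub> inv\<^bsub>G\<^esub> n \<in> ?K \<and>
      rho_M \<eta> E2 (inv\<^bsub>G\<^esub> n \<otimes>\<^bsub>G\<^esub> x \<otimes>\<^bsub>G\<^esub> n) = rho_M \<eta> E2 x" if n: "n \<in> monomial" and x: "x \<in> ?K" for n x
  proof -
    obtain s where s: "invariants x (0, False) 0 s" using inv[OF x] by blast
    obtain x1 x2 h a b r where 1: "x = (mat2 x1 0 0 x2, h)" "F2.has_lead x1 0 a" "F2.has_lead x2 0 b"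
      "F4.has_lead h 0 r" "rescong (a * b * r ^ 2) s" "s = 1 \<or> s = - 1" "x \<in> carrier G"
      using s by (auto simp: invariants_def)
    obtain g h' where gh: "n = (g, h')" by (cases n)
    have nG: "n \<in> carrier G" using n by (auto simp: monomial_def)
    let ?sw = "(mat2 x2 0 0 x1, h)"
    have swG: "?sw \<in> carrier G"
    proof -
      have E: "mat2 x1 0 0 x2 $ i $ j \<in> E2" for i j using 1(1,7) by (auto simp: carrier_G)
      then have "mat2 x2 0 0 x1 $ i $ j \<in> E2" for i j
        using exhaust_2[of i] exhaust_2[of j] E[of 1 1] E[of 2 2] by auto
      then show ?thesis using 1(1,7) by (auto simp: carrier_G det_mat2 mult.commute)
    qed
    have sw: "invariants ?sw (0, False) 0 s"
      using invariantsI[of False x2 x1 h 0 0 b a r s] 1 swG by (simp add: mult.commute[of b a])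
    have swK: "?sw \<in> ?K" using K_iff[OF s sw] x by blast
    have rho: "rho_M \<eta> E2 ?sw = rho_M \<eta> E2 x"
      using rho_swap[of x1 x2 h s] s by (simp add: rho_M_def 1(1))
    \<comment> \<open>Stated without inverses, so that one \<open>y\<close> serves for conjugation
      in both directions.\<close>
    have "\<exists>y \<in> {x, ?sw}. n \<otimes>\<^bsub>G\<^esub> y = x \<otimes>\<^bsub>G\<^esub> n \<and> y \<otimes>\<^bsub>G\<^esub> n = n \<otimes>\<^bsub>G\<^esub> x"
    proof (cases "diagonal g")
      case True
      then have "g = mat2 (g $ 1 $ 1) 0 0 (g $ 2 $ 2)" using mat2_eta[of g] by (simp add: diagonal_def)
      then obtain u t where g: "g = mat2 u 0 0 t" by blast
      show ?thesis by (simp add: gh g 1(1) mat2_mult mult.commute)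
    next
      case False
      then have "g = mat2 0 (g $ 1 $ 2) (g $ 2 $ 1) 0"
        using mat2_eta[of g] n by (simp add: monomial_def gh antidiagonal_def)
      then obtain u t where g: "g = mat2 0 u t 0" by blast
      show ?thesis by (simp add: gh g 1(1) mat2_mult mult.commute)
    qed
    then obtain y where y: "y = x \<or> y = ?sw" "n \<otimes>\<^bsub>G\<^esub> y = x \<otimes>\<^bsub>G\<^esub> n" "y \<otimes>\<^bsub>G\<^esub> n = n \<otimes>\<^bsub>G\<^esub> x" by blast
    have yG: "y \<in> carrier G" using y(1) 1(7) swG by blast
    have "inv\<^bsub>G\<^esub> n \<otimes>\<^bsub>G\<^esub> x \<otimes>\<^bsub>G\<^esub> n = inv\<^bsub>G\<^esub> n \<otimes>\<^bsub>G\<^esub> (n \<otimes>\<^bsub>G\<^esub> y)"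
      using nG 1(7) y(2) by (simp add: G.m_assoc)
    also have "\<dots> = y" using nG yG by (simp flip: G.m_assoc)
    finally have e1: "inv\<^bsub>G\<^esub> n \<otimes>\<^bsub>G\<^esub> x \<otimes>\<^bsub>G\<^esub> n = y" .
    have "n \<otimes>\<^bsub>G\<^esub> x \<otimes>\<^bsub>G\<^esub> inv\<^bsub>G\<^esub> n = y \<otimes>\<^bsub>G\<^esub> n \<otimes>\<^bsub>G\<^esub> inv\<^bsub>G\<^esub> n"
      using y(3) by simp
    also have "\<dots> = y" using nG yG by (simp add: G.m_assoc)
    finally have e2: "n \<otimes>\<^bsub>G\<^esub> x \<otimes>\<^bsub>G\<^esub> inv\<^bsub>G\<^esub> n = y" .
    show ?thesis unfolding e1 e2 using y(1) x swK rho by blast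
  qed
  have "n <#\<^bsub>G\<^esub> ?K #>\<^bsub>G\<^esub> inv\<^bsub>G\<^esub> n = ?K" if "n \<in> monomial" for n
    using that conj KG by (intro G.conjugation_eqI) (auto simp: monomial_def)
  then show ?thesis using conj by (auto simp: N_rho_def normalizer_M0_eq)
qed

end

section \<open>Generators of the abelian factors\<close>

lemma generate_integer_group: "generate integer_group {1} = UNIV"
proof -
  interpret group integer_group by simp
  show ?thesis by (subst generate_pow) auto
qed

lemma generate_integer_group_times_mod_2:
  "generate (integer_group \<times>\<times> integer_mod_group 2) {(1, 0), (0, 1)}
    = carrier (integer_group \<times>\<times> integer_mod_group 2)"
proof -
  let ?K = "integer_group \<times>\<times> integer_mod_group 2"
  interpret K: group ?K by (intro DirProd_group) auto
  interpret \<iota>: group_hom integer_group ?K "\<lambda>m. (m, 0)"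
    by (intro group_hom.intro group_hom_axioms.intro) (auto simp: hom_def)
  have sub: "{(1, 0), (0, 1)} \<subseteq> carrier ?K" by (auto simp: carrier_integer_mod_group)
  have "generate ?K {(1, 0)} = range (\<lambda>m. (m, 0))"
    using \<iota>.generate_img[of "{1}"] by (simp add: generate_integer_group)
  moreover have "generate ?K {(1, 0)} \<subseteq> generate ?K {(1, 0), (0, 1)}"
    by (intro K.mono_generate) auto
  ultimately have fst: "(m, 0) \<in> generate ?K {(1, 0), (0, 1)}" for m by auto
  have "(m, k) \<in> generate ?K {(1, 0), (0, 1)}" if "k \<in> carrier (integer_mod_group 2)" for m k
  proof -
    have "k = 0 \<or> k = 1" using that by (auto simp: carrier_integer_mod_group)
    moreover have "(m, 0) \<otimes>\<^bsub>?K\<^esub> (0, 1) \<in> generate ?K {(1, 0), (0, 1)}"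
      by (rule generate.eng[OF fst]) (simp add: generate.incl)
    then have "(m, 1) \<in> generate ?K {(1, 0), (0, 1)}" by simp
    ultimately show ?thesis using fst by auto
  qed
  then show ?thesis using K.generate_incl[OF sub] by auto
qed

section \<open>The invariants as homomorphisms with prescribed kernels\<close>

context depth_zero_type
begin

definition invariant_triple :: "'a point \<Rightarrow> (int \<times> bool) \<times> int \<times> 'a" where
  "invariant_triple n = (SOME t. case t of (d, m, s) \<Rightarrow> invariants n d m s)"

lemma invariant_triple_eq: "invariants n d m s \<Longrightarrow> invariant_triple n = (d, m, s)"
  unfolding invariant_triple_def
  by (rule some_equality) (auto dest: invariants_unique)

definition \<Phi>_st :: "'a point \<Rightarrow> (int \<times> bool) \<times> int" where
  "\<Phi>_st n = (case invariant_triple n of (d, m, s) \<Rightarrow> (d, m))"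

text \<open>The sign is rewritten additively to land in \<open>integer_mod_group 2\<close>;
  \<open>\<Phi>_st\<close> drops it, since \<open>K_st_M\<close> allows either sign.\<close>

definition \<Phi>_par :: "'a point \<Rightarrow> (int \<times> bool) \<times> int \<times> int" where
  "\<Phi>_par n = (case invariant_triple n of (d, m, s) \<Rightarrow> (d, m, if s = 1 then 0 else 1))"

lemma \<Phi>_eq:
  assumes "invariants n d m s"
  shows "\<Phi>_st n = (d, m)" "\<Phi>_par n = (d, m, if s = 1 then 0 else 1)"
  using invariant_triple_eq[OF assms] by (simp_all add: \<Phi>_st_def \<Phi>_par_def)

abbreviation "monomial_group \<equiv> G\<lparr>carrier := monomial\<rparr>"

lemma \<Phi>_st_hom: "\<Phi>_st \<in> hom monomial_group (dihedral \<times>\<times> integer_group)"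
proof (rule homI)
  fix n n' assume "n \<in> carrier monomial_group" "n' \<in> carrier monomial_group"
  then obtain d m s d' m' s' where inv: "invariants n d m s" "invariants n' d' m' s'"
    using invariants_exist by (metis partial_object.select_convs(1) partial_object.update_convs(1) partial_object.surjective)
  show "\<Phi>_st (n \<otimes>\<^bsub>monomial_group\<^esub> n') = \<Phi>_st n \<otimes>\<^bsub>dihedral \<times>\<times> integer_group\<^esub> \<Phi>_st n'"
    using \<Phi>_eq(1)[OF invariants_mult[OF inv]] \<Phi>_eq(1)[OF inv(1)] \<Phi>_eq(1)[OF inv(2)] by simp
qed auto

lemma \<Phi>_par_hom: "\<Phi>_par \<in> hom monomial_group (dihedral \<times>\<times> (integer_group \<times>\<times> integer_mod_group 2))"
proof (rule homI)
  fix n assume "n \<in> carrier monomial_group"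
  then have "n \<in> monomial" by simp
  then obtain d m s where inv: "invariants n d m s" by (rule invariants_exist)
  then show "\<Phi>_par n \<in> carrier (dihedral \<times>\<times> (integer_group \<times>\<times> integer_mod_group 2))"
    using \<Phi>_eq(2)[OF inv] by (auto simp: carrier_integer_mod_group)
  fix n' assume "n' \<in> carrier monomial_group"
  then have "n' \<in> monomial" by simp
  then obtain d' m' s' where inv': "invariants n' d' m' s'" by (rule invariants_exist)
  have s: "s = 1 \<or> s = - 1" "s' = 1 \<or> s' = - 1" using inv inv' by (auto simp: invariants_def)
  then have "(if s * s' = 1 then 0 else 1) = ((if s = 1 then 0 else 1) + (if s' = 1 then 0 else 1)) mod (2 :: int)"
    using neg_one_neq_one by auto
  then show "\<Phi>_par (n \<otimes>\<^bsub>monomial_group\<^esub> n')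
      = \<Phi>_par n \<otimes>\<^bsub>dihedral \<times>\<times> (integer_group \<times>\<times> integer_mod_group 2)\<^esub> \<Phi>_par n'"
    using \<Phi>_eq(2)[OF invariants_mult[OF inv inv']] \<Phi>_eq(2)[OF inv] \<Phi>_eq(2)[OF inv'] by simp
qed

lemma kernel_\<Phi>_st: "kernel monomial_group (dihedral \<times>\<times> integer_group) \<Phi>_st = K_st_M"
proof -
  have "n \<in> monomial \<and> \<Phi>_st n = ((0, False), 0) \<longleftrightarrow> n \<in> K_st_M" for n
  proof
    assume n: "n \<in> monomial \<and> \<Phi>_st n = ((0, False), 0)"
    then obtain d m s where inv: "invariants n d m s" using invariants_exist by blast
    then show "n \<in> K_st_M" using n \<Phi>_eq(1)[OF inv] in_K_st_M by auto
  next
    assume "n \<in> K_st_M"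
    then obtain s where inv: "invariants n (0, False) 0 s" using in_K_st_M by blast
    show "n \<in> monomial \<and> \<Phi>_st n = ((0, False), 0)"
      using \<Phi>_eq(1)[OF inv] invariants_monomial[OF inv] by simp
  qed
  then show ?thesis by (auto simp: kernel_def)
qed

lemma kernel_\<Phi>_par:
  "kernel monomial_group (dihedral \<times>\<times> (integer_group \<times>\<times> integer_mod_group 2)) \<Phi>_par = K_par_M"
proof -
  have "n \<in> monomial \<and> \<Phi>_par n = ((0, False), 0, 0) \<longleftrightarrow> n \<in> K_par_M" for n
  proof
    assume n: "n \<in> monomial \<and> \<Phi>_par n = ((0, False), 0, 0)"
    then obtain d m s where inv: "invariants n d m s" using invariants_exist by blast
    then show "n \<in> K_par_M" using n \<Phi>_eq(2)[OF inv] in_K_par_M by (auto split: if_splits)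
  next
    assume "n \<in> K_par_M"
    then have inv: "invariants n (0, False) 0 1" using in_K_par_M by blast
    show "n \<in> monomial \<and> \<Phi>_par n = ((0, False), 0, 0)"
      using \<Phi>_eq(2)[OF inv] invariants_monomial[OF inv] by simp
  qed
  then show ?thesis by (auto simp: kernel_def)
qed

section \<open>Invariants of the given elements and the structure of the quotient\<close>

definition "s_elem = (mat2 0 1 (- 1) 0 :: 'a alg_closure^2^2, 1 :: 'a alg_closure)"
definition "s'_elem = (mat2 0 (inverse \<pi>2) (- \<pi>2) 0, 1 :: 'a alg_closure)"
definition "z_elem = (mat2 (to_ac \<zeta> * \<pi>2) 0 0 \<pi>2, inverse (\<pi>4 ^ 2))"
definition "\<epsilon>_elem = (mat2 (- 1) 0 0 1 :: 'a alg_closure^2^2, 1 :: 'a alg_closure)"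

lemma mat2_carrier_G:
  assumes "a \<in> E2" "b \<in> E2" "c' \<in> E2" "d \<in> E2" "h \<in> E4" "h \<noteq> 0" "a * d - b * c' \<noteq> 0"
    and "field_norm E2 (a * d - b * c') * field_norm E4 h = 1"
  shows "(mat2 a b c' d, h) \<in> carrier G"
proof -
  have "mat2 a b c' d $ i $ j \<in> E2" for i j
    using exhaust_2[of i] exhaust_2[of j] assms(1-4) by auto
  then show ?thesis using assms by (auto simp: carrier_G det_mat2)
qed

lemma has_lead_sign: "F2.has_lead 1 0 1" "F2.has_lead (- 1) 0 (- 1)" "F4.has_lead 1 0 1"
  using F2.has_lead_to_ac[of 1] F2.has_lead_to_ac[of "- 1"] F4.has_lead_to_ac[of 1] by simp_all

lemma invariants_s: "invariants s_elem (reflection False) 0 1"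
proof -
  have "(mat2 0 1 (- 1) 0, 1) \<in> carrier G" by (rule mat2_carrier_G) auto
  then show ?thesis
    using invariantsI[of True 1 "- 1" 1 0 0 1 "- 1" 1 1] has_lead_sign
    by (simp add: s_elem_def reflection_def)
qed

text \<open>Entries of valuations -1 and 1 give \<open>m = 0\<close> and \<open>k = - 1\<close>; the
  minus sign of the second entry is undone by the sign of the permutation.\<close>

lemma invariants_s': "invariants s'_elem (reflection True) 0 1"
proof -
  have "(mat2 0 (inverse \<pi>2) (- \<pi>2) 0, 1) \<in> carrier G" by (rule mat2_carrier_G) auto
  moreover have "F2.has_lead (inverse \<pi>2) (- 1) 1" using F2.has_lead_inverse[OF F2.has_lead_\<pi>] by simp
  moreover have "F2.has_lead (- \<pi>2) 1 (- 1)"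
    using F2.has_lead_mult[OF has_lead_sign(2) F2.has_lead_\<pi>] by simp
  ultimately show ?thesis
    using invariantsI[of True "inverse \<pi>2" "- \<pi>2" 1 0 "- 1" 1 "- 1" 1 1] has_lead_sign
    by (simp add: s'_elem_def reflection_def)
qed

text \<open>The factor \<zeta> in the first entry makes \<open>a * b * r ^ 2\<close> equal to
  \<open>\<zeta> powi 1\<close>, so the sign is 1 and the element has no component of order
  2.\<close>

lemma invariants_z: "invariants z_elem (0, False) 1 1"
proof -
  have z0: "\<zeta> \<noteq> 0" using unit_\<zeta> unit_nonzero by blast
  have P4: "\<pi>4 ^ 2 \<in> E4" "field_norm E4 (\<pi>4 ^ 2) = (\<zeta> * c) ^ 2"
    using F4.field_norm_power[of \<pi>4 2] F4.field_norm_\<pi> by auto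
  have "(mat2 (to_ac \<zeta> * \<pi>2) 0 0 \<pi>2, inverse (\<pi>4 ^ 2)) \<in> carrier G"
  proof (rule mat2_carrier_G)
    have "field_norm E2 (to_ac \<zeta> * \<pi>2 * \<pi>2) = (\<zeta> * c) ^ 2"
      by (simp add: F2.field_norm_mult F2.field_norm_to_ac F2.field_norm_\<pi> power2_eq_square)
    moreover have "field_norm E4 (inverse (\<pi>4 ^ 2)) = inverse ((\<zeta> * c) ^ 2)"
      using P4 by (subst F4.field_norm_inverse) auto
    ultimately show "field_norm E2 (to_ac \<zeta> * \<pi>2 * \<pi>2 - 0 * 0) * field_norm E4 (inverse (\<pi>4 ^ 2)) = 1"
      using z0 F2.c_nonzero by simp
  qed (use z0 P4 in auto)
  moreover have "F2.has_lead (to_ac \<zeta> * \<pi>2) 1 \<zeta>"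
    using F2.has_lead_mult[OF F2.has_lead_to_ac[OF unit_\<zeta>] F2.has_lead_\<pi>] by simp
  moreover have "F4.has_lead (inverse (\<pi>4 ^ 2)) (- 2) 1"
    using F4.has_lead_inverse[OF F4.has_lead_power[OF F4.has_lead_\<pi>, of 2]] by simp
  ultimately show ?thesis
    using invariantsI[of False "to_ac \<zeta> * \<pi>2" \<pi>2 "inverse (\<pi>4 ^ 2)" 1 0 \<zeta> 1 1 1] F2.has_lead_\<pi>
    by (simp add: z_elem_def)
qed

text \<open>The determinant \<open>- 1\<close> has norm 1 but residue different from 1: the element
  lies in the stabiliser and outside the parahoric subgroup.\<close>

lemma invariants_\<epsilon>: "invariants \<epsilon>_elem (0, False) 0 (- 1)"
proof -
  have "field_norm E2 (- 1) = 1" using field_norm_sign[of "- 1"] by simp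
  then have "(mat2 (- 1) 0 0 1, 1) \<in> carrier G" by (intro mat2_carrier_G) auto
  then show ?thesis
    using invariantsI[of False "- 1" 1 1 0 0 "- 1" 1 1 "- 1"] has_lead_sign
    by (simp add: \<epsilon>_elem_def)
qed

text \<open>Serves both compact groups, which differ in the homomorphism, its target
  \<open>Z\<close> and the generators \<open>T\<close>, while the dihedral part is the same.\<close>

lemma W_rho_structure:
  assumes K: "K_M E2 E4 K = K_st_M \<or> K_M E2 E4 K = K_par_M"
    and hom: "\<Phi> \<in> hom monomial_group (dihedral \<times>\<times> Z)" and "group Z"
    and ker: "kernel monomial_group (dihedral \<times>\<times> Z) \<Phi> = K_M E2 E4 K"
    and T: "T \<subseteq> monomial" "B \<subseteq> carrier Z" "generate Z B = carrier Z"
      "\<Phi> ` T = {\<one>\<^bsub>dihedral\<^esub>} \<times> B"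
    and S: "\<Phi> ` {s_elem, s'_elem} = range reflection \<times> {\<one>\<^bsub>Z\<^esub>}"
  defines "W \<equiv> W_rho \<eta> E2 E4 K"
  defines "S' \<equiv> generate W (W_class E2 E4 K ` {s_elem, s'_elem})" and "T' \<equiv> generate W (W_class E2 E4 K ` T)"
  shows "internal_direct_product W S' T' \<and> iso_with_factors W S' T' W_aff_A1 Z"
proof -
  have W: "W = monomial_group Mod K_M E2 E4 K"
    by (simp add: W_def W_rho_def N_rho_eq[OF K])
  have cls: "W_class E2 E4 K n = K_M E2 E4 K #>\<^bsub>monomial_group\<^esub> n" for n
    by (simp add: W_class_def r_coset_def)
  have "{s_elem, s'_elem} \<subseteq> carrier monomial_group"
    using invariants_s invariants_s' invariants_monomial by auto
  moreover have "T \<subseteq> carrier monomial_group" using T(1) by simp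
  ultimately have "internal_direct_product W S' T' \<and> iso_with_factors W S' T' dihedral Z"
    using quotient_direct_product[OF group_monomial group_dihedral \<open>group Z\<close> hom ker _ _ _ T(2) generate_dihedral T(3) S T(4)]
    by (simp add: W S'_def T'_def cls)
  moreover have "{w. word_value w = \<one>\<^bsub>dihedral\<^esub>} = \<one>\<^bsub>W_aff_A1\<^esub>" by (simp add: one_W_aff_A1)
  ultimately show ?thesis using iso_with_factors_left[OF _ dihedral_iso_W_aff_A1] by blast
qed

lemma W_rho_K_st:
  fixes K W cls
  defines "K \<equiv> K_st v E2 E4"
  defines "W \<equiv> W_rho \<eta> E2 E4 K" and "cls \<equiv> W_class E2 E4 K"
  shows "internal_direct_product W (generate W {cls s_elem, cls s'_elem}) (generate W {cls z_elem}) \<and>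
    iso_with_factors W (generate W {cls s_elem, cls s'_elem}) (generate W {cls z_elem}) W_aff_A1 integer_group"
proof -
  have "\<Phi>_st ` {z_elem} = {\<one>\<^bsub>dihedral\<^esub>} \<times> {1}"
    using \<Phi>_eq(1)[OF invariants_z] by simp
  moreover have "\<Phi>_st ` {s_elem, s'_elem} = range reflection \<times> {\<one>\<^bsub>integer_group\<^esub>}"
    using \<Phi>_eq(1)[OF invariants_s] \<Phi>_eq(1)[OF invariants_s'] by (auto simp: UNIV_bool)
  ultimately show ?thesis
    using W_rho_structure[of K \<Phi>_st integer_group "{z_elem}" "{1}"] \<Phi>_st_hom kernel_\<Phi>_st
      invariants_monomial[OF invariants_z]
    by (simp add: K_def W_def cls_def generate_integer_group)
qed

lemma W_rho_K_par:
  fixes K W cls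
  defines "K \<equiv> K_par v E2 E4"
  defines "W \<equiv> W_rho \<eta> E2 E4 K" and "cls \<equiv> W_class E2 E4 K"
  shows "internal_direct_product W (generate W {cls s_elem, cls s'_elem}) (generate W {cls z_elem, cls \<epsilon>_elem}) \<and>
    iso_with_factors W (generate W {cls s_elem, cls s'_elem}) (generate W {cls z_elem, cls \<epsilon>_elem})
      W_aff_A1 (integer_group \<times>\<times> integer_mod_group 2)"
proof -
  let ?Z = "integer_group \<times>\<times> integer_mod_group 2"
  have "\<Phi>_par ` {z_elem, \<epsilon>_elem} = {\<one>\<^bsub>dihedral\<^esub>} \<times> {(1, 0), (0, 1)}"
    using \<Phi>_eq(2)[OF invariants_z] \<Phi>_eq(2)[OF invariants_\<epsilon>] neg_one_neq_one by auto
  moreover have "\<Phi>_par ` {s_elem, s'_elem} = range reflection \<times> {\<one>\<^bsub>?Z\<^esub>}"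
    using \<Phi>_eq(2)[OF invariants_s] \<Phi>_eq(2)[OF invariants_s'] by (auto simp: UNIV_bool)
  moreover have "{(1, 0), (0, 1)} \<subseteq> carrier ?Z" by (auto simp: carrier_integer_mod_group)
  moreover have "group ?Z" by (intro DirProd_group) auto
  ultimately show ?thesis
    using W_rho_structure[of K \<Phi>_par ?Z "{z_elem, \<epsilon>_elem}" "{(1, 0), (0, 1)}"] \<Phi>_par_hom kernel_\<Phi>_par
      invariants_monomial[OF invariants_z] invariants_monomial[OF invariants_\<epsilon>]
      generate_integer_group_times_mod_2
    by (simp add: K_def W_def cls_def)
qed

end

theorem proposition3p4:
  fixes v :: "'a::field \<Rightarrow> int"
    and p q :: nat
    and \<pi>F \<zeta> :: 'a
    and sqrt_m1 :: complex
    and \<eta> :: "'a \<Rightarrow> complex"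
    and E2 E4 :: "'a alg_closure set"
    and \<pi>2 \<pi>4 :: "'a alg_closure"
    and K0 :: "'a point set"
  assumes "nonarch_local_field v"
    and "Factorial_Ring.prime p" and "odd p"
    and "[p] \<cdot>\<^bsub>residue_field v\<^esub> \<one>\<^bsub>residue_field v\<^esub> = \<zero>\<^bsub>residue_field v\<^esub>"
    and "q = Coset.order (residue_field v)" and "4 dvd q - 1"
    and "uniformizer v \<pi>F"
    and "\<zeta> ^ (q - 1) = 1" and "\<forall>k. 0 < k \<and> k < q - 1 \<longrightarrow> \<zeta> ^ k \<noteq> 1"
    and "sqrt_m1 ^ 2 = -1"
    and "\<eta> \<in> hom (GL1 UNIV) (GL1 UNIV)"
    and "\<eta> \<pi>F = 1" and "\<forall>x \<in> prime_ideal v. \<eta> (1 + x) = 1" and "\<eta> \<zeta> = sqrt_m1"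
    and "E2 = splitting_field (Polynomial.monom 1 2 + [:\<pi>F:])"
    and "E4 = splitting_field (Polynomial.monom 1 4 + [:\<zeta> * \<pi>F:])"
    and "\<pi>2 \<in> E2" and "\<pi>2 ^ 2 = - to_ac \<pi>F"
    and "\<pi>4 \<in> E4" and "\<pi>4 ^ 4 = - to_ac (\<zeta> * \<pi>F)"
    and "K0 = K_st v E2 E4 \<or> K0 = K_par v E2 E4"
  shows
    "let W = W_rho \<eta> E2 E4 K0;
         s = W_class E2 E4 K0 (mat2 0 1 (-1) 0, 1);
         s' = W_class E2 E4 K0 (mat2 0 (inverse \<pi>2) (- \<pi>2) 0, 1);
         z = W_class E2 E4 K0 (mat2 (to_ac \<zeta> * \<pi>2) 0 0 \<pi>2, inverse (\<pi>4 ^ 2));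
         \<epsilon> = W_class E2 E4 K0 (mat2 (-1) 0 0 1, 1)
     in (K0 = K_st v E2 E4 \<longrightarrow>
           internal_direct_product W (generate W {s, s'}) (generate W {z}) \<and>
           iso_with_factors W (generate W {s, s'}) (generate W {z}) W_aff_A1 integer_group) \<and>
        (K0 = K_par v E2 E4 \<longrightarrow>
           internal_direct_product W (generate W {s, s'}) (generate W {z, \<epsilon>}) \<and>
           iso_with_factors W (generate W {s, s'}) (generate W {z, \<epsilon>})
             W_aff_A1 (integer_group \<times>\<times> integer_mod_group 2))"
proof -
  interpret V: local_field v using assms(1) by unfold_locales
  interpret T: tame_local_field v p q \<zeta>
    using assms(3-6,8,9) V.of_nat_prime_ideal_iff by unfold_locales auto
  \<comment> \<open>A primitive fourth root of unity in the base field; this is where divisibility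
    of \<open>q - 1\<close> by 4 enters.\<close>
  define w where "w = \<zeta> ^ ((q - 1) div 4)"
  have \<pi>F: "\<pi>F \<noteq> 0" "v \<pi>F = 1" using assms(7) by (auto simp: uniformizer_def)
  have q: "4 * ((q - 1) div 4) = q - 1" "(q - 1) div 4 > 0"
    using assms(6) T.q_ge_2 by (auto simp: dvd_mult_div_cancel div_greater_zero_iff dest: dvd_imp_le)
  have w_power: "w ^ k = \<zeta> ^ (k * ((q - 1) div 4))" for k
    by (simp add: w_def mult.commute flip: power_mult)
  have w4: "w ^ 4 = 1" using assms(8) q by (simp add: w_power)
  have "2 * ((q - 1) div 4) = (q - 1) div 2" using q by presburger
  then have w2: "w ^ 2 = - 1" using T.\<zeta>_half_power by (simp add: w_power)
  have w_primitive: "w ^ k \<noteq> 1" if "0 < k" "k < 4" for k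
  proof -
    have "0 < k * ((q - 1) div 4)" "k * ((q - 1) div 4) < q - 1"
      using that q(2) by (simp, subst q(1)[symmetric], simp)
    then show ?thesis using assms(9) by (simp add: w_power)
  qed
  interpret F2: tame_extension v 2 "- 1" \<pi>F \<pi>2
  proof unfold_locales
    show "(- 1) ^ k \<noteq> (1 :: 'a)" if "0 < k" "k < 2" for k
      using that T.neg_one_neq_one by (cases "k = 1") auto
  qed (use \<pi>F assms(18) in \<open>auto simp: numeral_2_eq_2\<close>)
  interpret F4: tame_extension v 4 w "\<zeta> * \<pi>F" \<pi>4
  proof unfold_locales
    \<comment> \<open>The exponents add up to 0 + 1 + 2 + 3 = 4 + 2.\<close>
    have "(\<Prod>k<4. w ^ k) = w ^ 4 * w ^ 2"
      by (simp add: eval_nat_numeral)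
    then show "(\<Prod>k<4. w ^ k) = - 1" by (simp add: w4 w2)
    show "\<zeta> * \<pi>F \<noteq> 0" "v (\<zeta> * \<pi>F) = 1"
      using \<pi>F T.unit_\<zeta> by (auto simp: V.unit_def V.v_mult)
  qed (use w_primitive w4 assms(20) in auto)
  interpret D: depth_zero_type v p q \<zeta> w \<pi>F \<pi>2 \<pi>4 \<eta>
    using assms(10,11,13,14) by unfold_locales auto
  have E: "E2 = F2.ext" "E4 = F4.ext"
    using assms(15,16) F2.splitting_field_kummer F4.splitting_field_kummer
    by (simp_all add: F2.kummer_poly_def F4.kummer_poly_def)
  show ?thesis
    using D.W_rho_K_st D.W_rho_K_par
    unfolding D.s_elem_def D.s'_elem_def D.z_elem_def D.\<epsilon>_elem_def E Let_def by blast
qed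

end
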